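(* Let $A=\mathbb K\langle x_1,\dots,x_r\rangle$ be a finitely generated free algebra. I. The embedding $\zeta_{\mathbb K}=\zeta^{(\bullet)}_{\mathbb K}\to C^{(\bullet)}(A)[1]$, $\omega\mapsto\Phi_\omega$, is an embedding of complexes whose image is a Lie subalgebra of $\mathbf g=C^{(\bullet)}(A)[1]$ equipped with the generalized necklace bracket. II. On this image the bracket of two cyclic $\xi\delta$-monomials $U,W$ is $[U,W]=U\circ W-W\circ U$, where $U\circ W$ is the linear combination (with Koszul signs) of the cyclic $\xi\delta$-monomials obtained by all possible gluings of a letter $\delta_j$ of $U$ with a letter $x_j$ of $W$ (same index $j$): writing cyclically $U=\delta_j\alpha$ and $W=x_j\beta$ with respect to the chosen letters, the result of the gluing is the cyclic $\xi\delta$-monomial $\alpha\beta$ (the two circles are glued at $\delta_j$ and $x_j$, cut at the place of gluing and opened up to a single cyclic word, with $\delta_j$ and $x_j$ disappearing).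
   Context: $\mathbb K$ is a field of characteristic zero; $A$ is concentrated in degree $0$. **Higher cyclic Hochschild complex.** $\mathcal B=[\cdots\to A^{\otimes 4}\to A^{\otimes3}\xrightarrow{D_3}A\otimes A]$ is the bar resolution of the diagonal bimodule $A$. $A^{\otimes N}_{cycl}$ is $A^{\otimes N}$ with the $A^{\otimes N}$-bimodule structure $(a_1\otimes\cdots\otimes a_N)\bullet(x_1\otimes\cdots\otimes x_N)\bullet(b_1\otimes\cdots\otimes b_N)=a_1x_1b_2\otimes\cdots\otimes a_Nx_Nb_1$. $C^{(\bullet)}(A)=\prod_{N\ge1}C^{(N)}(A)$ with $$C^{(N)}(A)=\mathrm{Hom}_{A^{\otimes N}\text{-}mod\text{-}A^{\otimes N}}(\mathcal B^{\otimes N},A^{\otimes N}_{cycl})^{\mathbb Z_N}\cong\prod_{r_1,\dots,r_N\ge0}\mathrm{Hom}_{\mathbb K}\Big(\bigotimes_{i=1}^NA^{\otimes r_i},A^{\otimes N}\Big)^{\mathbb Z_N},$$ with differential dual to that of $\mathcal B^{\otimes N}$. Invariants are taken for the action in which the generator of $\mathbb Z_N$ simultaneously rotates the $N$ input blocks and the $N$ outputs, with the Koszul sign of permuting the input blocks (inputs regarded as elements of $A[1]$) and the additional sign $(-1)^{(d-1)(N-1)}$, where $d$ is a fixed integer (mainly $d=2$). Output $i$ is adjacent to input block $i$ (acting on it on the left) and to block $i+1$ (acting on the right), indices mod $N$. **Generalized necklace bracket.** On $C^{(\bullet)}(A)[1]$, $[f,g]_{g.n}=f\circ g-(-1)^\sigma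 g\circ f$, where $f\circ g$ is the sum over all insertions of one output of $g$ into one input of $f$, followed by cyclic symmetrization, with all signs assigned by the Koszul rule. Explicitly, for $f$ with $N$ and $g$ with $M$ outputs, inserting output $j$ of $g$ into an input of block $\alpha$ of $f$, splitting that block as (left part $L$, inserted entry, right part $R$), gives an operation with $N+M-1$ outputs, in cyclic order $f_\alpha,f_{\alpha+1},\dots,f_{\alpha-1},g_{j+1},\dots,g_{j-1}$ ($f_k$, $g_k$ denoting output $k$), and input blocks in cyclic order: ($L$ followed by block $j$ of $g$), blocks $\alpha+1,\dots,\alpha-1$ of $f$, (block $j+1$ of $g$ followed by $R$), blocks $j+2,\dots,j-1$ of $g$; for $M=1$ the two combined blocks merge into one: ($L$, the block of $g$, $R$). This makes $C^{(\bullet)}(A)[1]$ a graded Lie algebra. **Small complex.** Let $\mathcal F\subset\mathcal B$ be generated by $A^{\otimes k}$, $k\ge4$, and $\ker D_3$; $R_{\min}=\mathcal B/\mathcal F=[0\to\Omega\to A\otimes A]$ with $\Omega=A^{\otimes3}/\ker D_3\cong\ker(A\otimes A\to A)$. Then $\zeta^{(N)}_{\mathbb K}$ is the complex $\mathrm{Hom}_{A^{\otimes N}\text{-}mod\text{-}A^{\otimes N}}(R_{\min}^{\otimes N},A^{\otimes N}_{cycl})^{\mathbb Z_N}$, written as a complex over $\mathbb K$, and $\zeta_{\mathbb K}=\zeta_{\mathbb K}^{(\bullet)}$ is the collection of all of them, $N\ge1$. It is spanned by cyclic $\xi\delta$-monomials: cyclic words $\omega=c_1u_1c_2u_2\cdots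 c_Nu_N$ with $c_i\in\{\xi,\delta_1,\dots,\delta_r\}$ and $u_i$ monomials in $x_1,\dots,x_r$ (a cyclic word stands for the corresponding $\mathbb Z_N$-symmetrized element). Here $\delta_i$ stands for the element of the basis dual to the free basis $dx_i=1\otimes x_i-x_i\otimes1$ of $\Omega$, and $\xi$ for the element dual to the generator $1\otimes 1$ of $A\otimes A$. **Embedding $\omega\mapsto\Phi_\omega$.** $\Phi_\omega$ has one input from $A$ for each $c_i\in\{\delta_1,\dots,\delta_r\}$, no input for each $c_i=\xi$, and $N$ outputs. On monomial inputs $w_i$ (for those $i$ with $c_i=\delta_{k_i}$) its value is the $\mathbb Z_N$-symmetrization of $$\sum\ (a_1u_1b_2)\otimes(a_2u_2b_3)\otimes\cdots\otimes(a_Nu_Nb_1),$$ the sum being over all choices, for each $i$ with $c_i=\delta_{k_i}$, of an occurrence of $x_{k_i}$ in $w_i$, written $w_i=a_ix_{k_i}b_i$; one puts $a_i=b_i=1$ when $c_i=\xi$. *)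

theory Defs
  imports Complex_Main "HOL-Library.Poly_Mapping" "HOL-Library.Function_Algebras"
begin

section \<open>The free algebra and its tensor powers\<close>

text \<open>
  The generators \<open>x\<^sub>1, \<dots>, x\<^sub>r\<close> are indexed by a finite type \<open>'x\<close>. The free algebra
  \<open>A\<close> has the words in \<open>'x\<close> as its basis (multiplication is concatenation, the unit is the
  empty word). A tensor \<open>u\<^sub>1 \<otimes> \<dots> \<otimes> u\<^sub>N\<close> of words is the list \<open>[u\<^sub>1, \<dots>, u\<^sub>N]\<close>; a
  \<open>tensor\<close> is a finite linear combination of such lists, and lies in the \<open>N\<close>-th tensor power
  of \<open>A\<close> if all its keys have length \<open>N\<close>.
\<close>

type_synonym 'x word = "'x list"
type_synonym ('x, 'k) tensor = "'x word list \<Rightarrow>\<^sub>0 'k"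

definition scale :: "'k::field \<Rightarrow> ('b \<Rightarrow>\<^sub>0 'k) \<Rightarrow> ('b \<Rightarrow>\<^sub>0 'k)" where
  "scale a p = Poly_Mapping.map ((*) a) p"

definition lin_ext :: "('b \<Rightarrow> ('c \<Rightarrow>\<^sub>0 'k)) \<Rightarrow> ('b \<Rightarrow>\<^sub>0 'k::field) \<Rightarrow> ('c \<Rightarrow>\<^sub>0 'k)" where
  "lin_ext h p = (\<Sum>v\<in>Poly_Mapping.keys p. scale (Poly_Mapping.lookup p v) (h v))"

definition lin_map :: "('b \<Rightarrow> 'c) \<Rightarrow> ('b \<Rightarrow>\<^sub>0 'k::field) \<Rightarrow> ('c \<Rightarrow>\<^sub>0 'k)" where
  "lin_map h = lin_ext (\<lambda>v. Poly_Mapping.single (h v) 1)"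

definition ksign :: "int \<Rightarrow> 'k::ring_1" where
  "ksign e = (if even e then 1 else - 1)"

text \<open>
  The bimodule structure of the cyclic tensor power on basis elements: the \<open>i\<close>-th factor of
  \<open>as \<bullet> v \<bullet> bs\<close> is \<open>a\<^sub>i v\<^sub>i b\<^sub>i\<^sub>+\<^sub>1\<close>, indices mod \<open>N\<close>.
\<close>

definition cyc_act :: "'x word list \<Rightarrow> 'x word list \<Rightarrow> 'x word list \<Rightarrow> 'x word list" where
  "cyc_act as v bs = map2 (@) (map2 (@) as v) (rotate1 bs)"

definition bimod :: "'x word list \<Rightarrow> 'x word list \<Rightarrow> ('x, 'k::field) tensor \<Rightarrow> ('x, 'k) tensor" where
  "bimod as bs = lin_map (\<lambda>v. cyc_act as v bs)"


section \<open>Cyclically invariant cochains\<close>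

text \<open>
  Both complexes consist of bimodule homomorphisms from an \<open>N\<close>-fold tensor power of a complex of
  free bimodules to the cyclic tensor power. Such a homomorphism is recorded by its values on the
  bimodule generators, i.e. on lists \<open>[b\<^sub>1, \<dots>, b\<^sub>N]\<close> of homogeneous generators of the factors:
  \<^item> for the bar resolution, \<open>b\<^sub>i\<close> is an input block \<open>[w\<^sub>1, \<dots>, w\<^sub>r]\<close> of \<open>r\<close> words,
    standing for \<open>1 \<otimes> w\<^sub>1 \<otimes> \<dots> \<otimes> w\<^sub>r \<otimes> 1\<close>, of degree \<open>r\<close>;
  \<^item> for the small resolution, \<open>b\<^sub>i\<close> is \<open>1 \<otimes> 1\<close> (degree 0) or one of the \<open>dx\<^sub>j\<close> (degree 1).

  A function on lists of all lengths at once is a family indexed by \<open>N\<close> (and by the degrees of the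
  blocks), i.e. an element of the direct product.
\<close>

type_synonym ('b, 'x, 'k) cochain = "'b list \<Rightarrow> ('x, 'k) tensor"
type_synonym ('x, 'k) operation = "('x word list, 'x, 'k) cochain"

definition total_deg :: "('b \<Rightarrow> nat) \<Rightarrow> 'b list \<Rightarrow> int" where
  "total_deg deg X = int (sum_list (map deg X))"

abbreviation inputs :: "'x word list list \<Rightarrow> int" where
  "inputs \<equiv> total_deg length"

definition rotr :: "'b list \<Rightarrow> 'b list" where
  "rotr X = (if X = [] then [] else last X # butlast X)"

text \<open>
  The action of the generator of the cyclic group: inputs and outputs are rotated simultaneously,
  with the Koszul sign for moving the last block past the others and the additional sign
  \<open>(-1)\<^bsup>(d-1)(N-1)\<^esup>\<close>.
\<close>

definition rot :: "int \<Rightarrow> ('b \<Rightarrow> nat) \<Rightarrow> ('b, 'x, 'k::field) cochain \<Rightarrow> ('b, 'x, 'k) cochain" where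
  "rot d deg f X =
     scale (ksign (int (deg (last X)) * total_deg deg (butlast X) + (d - 1) * (int (length X) - 1)))
       (lin_map rotate1 (f (rotr X)))"

text \<open>Cyclic symmetrization is the projection onto the invariants.\<close>

definition symmetrize :: "int \<Rightarrow> ('b \<Rightarrow> nat) \<Rightarrow> ('b, 'x, 'k::field) cochain \<Rightarrow> ('b, 'x, 'k) cochain" where
  "symmetrize d deg f X = scale (1 / of_nat (length X)) (\<Sum>s<length X. (rot d deg ^^ s) f X)"

definition invariants :: "int \<Rightarrow> ('b \<Rightarrow> nat) \<Rightarrow> ('b, 'x, 'k::field) cochain set" where
  "invariants d deg =
     {f. f [] = 0 \<and> (\<forall>X. \<forall>v\<in>Poly_Mapping.keys (f X). length v = length X) \<and> rot d deg f = f}"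

definition homogeneous :: "('b \<Rightarrow> nat) \<Rightarrow> nat \<Rightarrow> nat \<Rightarrow> ('b, 'x, 'k::field) cochain \<Rightarrow> bool" where
  "homogeneous deg N n f \<longleftrightarrow> (\<forall>X. f X \<noteq> 0 \<longrightarrow> length X = N \<and> total_deg deg X = int n)"

definition component :: "('b \<Rightarrow> nat) \<Rightarrow> nat \<Rightarrow> nat \<Rightarrow> ('b, 'x, 'k::field) cochain \<Rightarrow> ('b, 'x, 'k) cochain" where
  "component deg N n f X = (if length X = N \<and> total_deg deg X = int n then f X else 0)"

definition cscale :: "'k::field \<Rightarrow> ('b, 'x, 'k) cochain \<Rightarrow> ('b, 'x, 'k) cochain" where
  "cscale a f = (\<lambda>X. scale a (f X))"


section \<open>The higher cyclic Hochschild complex\<close>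

definition hochschild :: "int \<Rightarrow> ('x, 'k::field) operation set" where
  "hochschild d = invariants d length"

text \<open>
  A basis element \<open>a\<^sub>0 \<otimes> a\<^sub>1 \<otimes> \<dots> \<otimes> a\<^sub>r \<otimes> a\<^sub>r\<^sub>+\<^sub>1\<close> of the bar resolution is a list of
  \<open>r + 2\<close> words. \<open>hom_ext f\<close> is the bimodule homomorphism with the values \<open>f\<close> on generators,
  evaluated on a tensor product of \<open>N\<close> such elements.
\<close>

definition hom_ext :: "('x, 'k::field) operation \<Rightarrow> 'x word list list \<Rightarrow> ('x, 'k) tensor" where
  "hom_ext f Ys = bimod (map hd Ys) (map last Ys) (f (map (\<lambda>ys. butlast (tl ys)) Ys))"

definition merge :: "nat \<Rightarrow> 'x word list \<Rightarrow> 'x word list" where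
  "merge k ys = take k ys @ [ys ! k @ ys ! Suc k] @ drop (Suc (Suc k)) ys"

text \<open>
  Precomposition with the differential of the tensor power of the bar resolution. The differential
  of the resolution itself is
  \<open>a\<^sub>0 \<otimes> \<dots> \<otimes> a\<^sub>r\<^sub>+\<^sub>1 \<mapsto> \<Sum>\<^sub>k (-1)\<^bsup>k+1\<^esup> a\<^sub>0 \<otimes> \<dots> \<otimes> a\<^sub>k a\<^sub>k\<^sub>+\<^sub>1 \<otimes> \<dots> \<otimes> a\<^sub>r\<^sub>+\<^sub>1\<close>.
  The overall sign is the one for which \<open>D\<^sub>3 (1 \<otimes> x \<otimes> 1) = 1 \<otimes> x - x \<otimes> 1 = dx\<close>, so that
  the isomorphism of \<open>\<Omega>\<close> with the kernel of the multiplication induced by \<open>D\<^sub>3\<close> takes the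
  class of \<open>1 \<otimes> x \<otimes> 1\<close> to \<open>dx\<close>. A block with \<open>r = 0\<close> has differential zero.
\<close>

definition hochschild_diff :: "('x, 'k::field) operation \<Rightarrow> ('x, 'k) operation" where
  "hochschild_diff f X =
     (let Ys = map (\<lambda>B. [[]] @ B @ [[]]) X in
      \<Sum>i | i < length X \<and> X ! i \<noteq> []. \<Sum>k\<le>length (X ! i).
        scale (ksign (inputs (take i X) + int k + 1)) (hom_ext f (Ys[i := merge k (Ys ! i)])))"


section \<open>The generalized necklace bracket\<close>

text \<open>
  \<open>graft L R Xs Ys\<close> is the cyclic list of input blocks after an output of \<open>g\<close> has been inserted
  into an input of \<open>f\<close>. Here \<open>f\<close> and \<open>g\<close> are already rotated so that the input lies in the
  first block of \<open>f\<close> and the output is the first output of \<open>g\<close>; the blocks of \<open>f\<close> are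
  (\<open>L\<close>, inserted entry, \<open>R\<close>) followed by \<open>Xs\<close>, those of \<open>g\<close> are \<open>Ys\<close>.
\<close>

fun graft :: "'w list \<Rightarrow> 'w list \<Rightarrow> 'w list list \<Rightarrow> 'w list list \<Rightarrow> 'w list list" where
  "graft L R Xs [] = []"
| "graft L R Xs [Y] = (L @ Y @ R) # Xs"
| "graft L R Xs (Y # Y' # Ys) = (L @ Y) # Xs @ (Y' @ R) # Ys"

definition grafts :: "'w list list \<Rightarrow> ('w list \<times> 'w list \<times> 'w list list \<times> 'w list list) set" where
  "grafts Z = {(L, R, Xs, Ys). Ys \<noteq> [] \<and> graft L R Xs Ys = Z}"

text \<open>
  The Koszul rule. An input is odd, an output has the parity \<open>d - 1\<close>, which accounts for the
  additional sign in the cyclic action. An operation with \<open>n\<close> inputs and \<open>N\<close> outputs, one of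
  them shifted so that it can be inserted, then has the parity \<open>(n - 1) + (d - 1)(N - 1)\<close>. With
  respect to this degree the bracket below is antisymmetric and satisfies the Jacobi identity
  in the graded sense.
\<close>

definition lie_deg :: "int \<Rightarrow> int \<Rightarrow> int \<Rightarrow> int" where
  "lie_deg d N n = (n - 1) + (d - 1) * (N - 1)"

text \<open>
  Permuting the inputs from the order of \<open>graft L R Xs Ys\<close> to the order
  (\<open>L\<close>, \<open>Ys\<close>, \<open>R\<close>, \<open>Xs\<close>) in which \<open>g\<close> and \<open>f\<close> are applied.
\<close>

fun shuffle_exp :: "'x word list \<Rightarrow> 'x word list list \<Rightarrow> 'x word list list \<Rightarrow> int" where
  "shuffle_exp R Xs (Y # Y' # Ys) =
     inputs Xs * (int (length Y') + int (length R) + inputs Ys) + int (length R) * inputs Ys"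
| "shuffle_exp R Xs Ys = 0"

text \<open>
  The remaining terms: \<open>g\<close> passes \<open>L\<close>, and the outputs of \<open>g\<close> other than the inserted one pass
  \<open>R\<close> and \<open>Xs\<close>.
\<close>

definition graft_exp ::
    "int \<Rightarrow> 'x word list \<Rightarrow> 'x word list \<Rightarrow> 'x word list list \<Rightarrow> 'x word list list \<Rightarrow> int" where
  "graft_exp d L R Xs Ys =
     int (length L) * lie_deg d (int (length Ys)) (inputs Ys)
     + (d - 1) * (int (length Ys) - 1) * (int (length R) + inputs Xs)
     + shuffle_exp R Xs Ys"

definition insertion ::
    "int \<Rightarrow> ('x, 'k::field) operation \<Rightarrow> ('x, 'k) operation \<Rightarrow>
      'x word list \<times> 'x word list \<times> 'x word list list \<times> 'x word list list \<Rightarrow> ('x, 'k) tensor" where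
  "insertion d f g = (\<lambda>(L, R, Xs, Ys).
     scale (ksign (graft_exp d L R Xs Ys))
       (lin_ext (\<lambda>v. lin_map (\<lambda>w. w @ tl v) (f ((L @ [hd v] @ R) # Xs))) (g Ys)))"

text \<open>
  The sum over all blocks of \<open>f\<close> and all outputs of \<open>g\<close> is the sum over the rotations of \<open>f\<close>
  and of \<open>g\<close> (with their signs); the sum over the entries of a block is the one over \<open>grafts\<close>.
\<close>

definition circ ::
    "int \<Rightarrow> ('x, 'k::field) operation \<Rightarrow> ('x, 'k) operation \<Rightarrow> ('x, 'k) operation" where
  "circ d f g = symmetrize d length (\<lambda>Z.
     \<Sum>(L, R, Xs, Ys)\<in>grafts Z. \<Sum>s<Suc (length Xs). \<Sum>t<length Ys.
       insertion d ((rot d length ^^ s) f) ((rot d length ^^ t) g) (L, R, Xs, Ys))"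

text \<open>
  On homogeneous elements the bracket is \<open>f \<circ> g - (-1)\<^bsup>|f||g|\<^esup> g \<circ> f\<close>; it is extended to the
  direct product by bilinearity, only finitely many pairs of components contributing to the value
  on given inputs.
\<close>

definition bracket ::
    "int \<Rightarrow> ('x, 'k::field) operation \<Rightarrow> ('x, 'k) operation \<Rightarrow> ('x, 'k) operation" where
  "bracket d f g Z =
     (\<Sum>N = 1..length Z. \<Sum>n\<le>Suc (sum_list (map length Z)).
        let M = Suc (length Z) - N;
            m = Suc (sum_list (map length Z)) - n;
            f' = component length N n f;
            g' = component length M m g
        in circ d f' g' Z
           - scale (ksign (lie_deg d (int N) (int n) * lie_deg d (int M) (int m))) (circ d g' f' Z))"

definition lie_subalgebra :: "int \<Rightarrow> ('x, 'k::field) operation set \<Rightarrow> bool" where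
  "lie_subalgebra d S \<longleftrightarrow> S \<subseteq> hochschild d \<and> 0 \<in> S
     \<and> (\<forall>f\<in>S. \<forall>g\<in>S. f + g \<in> S) \<and> (\<forall>a. \<forall>f\<in>S. cscale a f \<in> S)
     \<and> (\<forall>f\<in>S. \<forall>g\<in>S. bracket d f g \<in> S)"


section \<open>The small complex\<close>

text \<open>
  \<open>Xi\<close> is dual to the generator \<open>1 \<otimes> 1\<close> of \<open>A \<otimes> A\<close> and \<open>Delta j\<close> to the generator
  \<open>dx\<^sub>j\<close> of \<open>\<Omega>\<close>. The value \<open>\<phi> [c\<^sub>1, \<dots>, c\<^sub>N]\<close> is the value of the homomorphism
  \<open>\<phi>\<close> on the tensor product of the generators dual to the \<open>c\<^sub>i\<close>; its coefficient at
  \<open>u\<^sub>1 \<otimes> \<dots> \<otimes> u\<^sub>N\<close> is the coefficient of the word \<open>c\<^sub>1 u\<^sub>1 \<dots> c\<^sub>N u\<^sub>N\<close>.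
\<close>

datatype 'x gen = Xi | Delta 'x

fun gdeg :: "'x gen \<Rightarrow> nat" where
  "gdeg Xi = 0"
| "gdeg (Delta j) = 1"

type_synonym ('x, 'k) small = "('x gen, 'x, 'k) cochain"

text \<open>
  \<open>zeta_prod\<close> is the direct product over \<open>N\<close> of the complexes for the single \<open>N\<close>, \<open>zeta\<close> their
  direct sum, which is the linear span of the cyclic monomials.
\<close>

definition zeta_prod :: "int \<Rightarrow> ('x, 'k::field) small set" where
  "zeta_prod d = invariants d gdeg"

definition zeta :: "int \<Rightarrow> ('x, 'k::field) small set" where
  "zeta d = {\<phi> \<in> zeta_prod d. \<exists>N. \<forall>c. \<phi> c \<noteq> 0 \<longrightarrow> length c \<le> N}"

text \<open>
  Precomposition with the differential of the tensor power of the small resolution, in which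
  \<open>dx\<^sub>j \<mapsto> 1 \<otimes> x\<^sub>j - x\<^sub>j \<otimes> 1\<close>.
\<close>

definition zeta_diff :: "('x, 'k::field) small \<Rightarrow> ('x, 'k) small" where
  "zeta_diff \<phi> c =
     (let N = length c; one = replicate N [] in
      \<Sum>i<N. case c ! i of
          Xi \<Rightarrow> 0
        | Delta j \<Rightarrow> scale (ksign (total_deg gdeg (take i c)))
            (bimod one (one[i := [j]]) (\<phi> (c[i := Xi])) - bimod (one[i := [j]]) one (\<phi> (c[i := Xi]))))"

text \<open>
  A monomial \<open>c\<^sub>1 u\<^sub>1 \<dots> c\<^sub>N u\<^sub>N\<close> is the list of the pairs \<open>(c\<^sub>i, u\<^sub>i)\<close>; \<open>cyc_mono\<close> is the
  cyclic monomial it represents.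
\<close>

type_synonym 'x monomial = "('x gen \<times> 'x word) list"

definition cyc_mono :: "int \<Rightarrow> 'x monomial \<Rightarrow> ('x, 'k::field) small" where
  "cyc_mono d U = symmetrize d gdeg
     (\<lambda>c. if c = map fst U then Poly_Mapping.single (map snd U) 1 else 0)"


section \<open>The embedding\<close>

fun splittings :: "'x gen \<Rightarrow> 'x word list \<Rightarrow> ('x word \<times> 'x word) set" where
  "splittings Xi B = (if B = [] then {([], [])} else {})"
| "splittings (Delta j) B = {(a, b). B = [a @ [j] @ b]}"

definition Phi_unsym :: "'x monomial \<Rightarrow> ('x, 'k::field) operation" where
  "Phi_unsym U X =
     (if length X = length U
      then \<Sum>ab\<in>listset (map2 splittings (map fst U) X).
             Poly_Mapping.single (cyc_act (map fst ab) (map snd U) (map snd ab)) 1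
      else 0)"

definition Phi_mono :: "int \<Rightarrow> 'x monomial \<Rightarrow> ('x, 'k::field) operation" where
  "Phi_mono d U = symmetrize d length (Phi_unsym U)"

text \<open>The linear extension of \<open>Phi_mono\<close>.\<close>

definition Phi :: "int \<Rightarrow> ('x::finite, 'k::field) small \<Rightarrow> ('x, 'k) operation" where
  "Phi d \<phi> X = (\<Sum>c | length c = length X. lin_ext (\<lambda>u. Phi_mono d (zip c u) X) (\<phi> c))"


section \<open>Gluing of cyclic monomials\<close>

text \<open>
  Let \<open>Delta j\<close> be the first letter of \<open>U = Delta j \<alpha>\<close>, and let the letter at position \<open>k\<close> of
  the first word of \<open>W\<close> be \<open>x\<^sub>j\<close>, so that cyclically \<open>W = x\<^sub>j \<beta>\<close>. With
  \<open>\<alpha> = u\<^sub>1 c\<^sub>2 u\<^sub>2 \<dots> c\<^sub>N u\<^sub>N\<close> and \<open>\<beta> = q e\<^sub>2 v\<^sub>2 \<dots> e\<^sub>M v\<^sub>M e\<^sub>1 p\<close>, where the first word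
  of \<open>W\<close> is \<open>p x\<^sub>j q\<close>, the cyclic word \<open>\<alpha> \<beta>\<close> is written starting with \<open>e\<^sub>1\<close>, as
  \<open>e\<^sub>1 (p u\<^sub>1) c\<^sub>2 u\<^sub>2 \<dots> c\<^sub>N (u\<^sub>N q) e\<^sub>2 v\<^sub>2 \<dots> e\<^sub>M v\<^sub>M\<close>.
\<close>

definition glue_word :: "'x monomial \<Rightarrow> 'x monomial \<Rightarrow> nat \<Rightarrow> 'x monomial" where
  "glue_word U W k =
     (let (e, v) = hd W;
          Z = (e, take k v @ snd (hd U)) # tl U
      in butlast Z @ [(fst (last Z), snd (last Z) @ drop (Suc k) v)] @ tl W)"

definition mdeg :: "'x monomial \<Rightarrow> int" where
  "mdeg U = total_deg gdeg (map fst U)"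

text \<open>The Koszul sign of rotating a monomial by \<open>s\<close> places.\<close>

definition rotate_exp :: "int \<Rightarrow> nat \<Rightarrow> 'x monomial \<Rightarrow> int" where
  "rotate_exp d s U = mdeg (take s U) * mdeg (drop s U) + (d - 1) * (int (length U) - 1) * int s"

text \<open>
  The sum over all pairs of a letter \<open>Delta j\<close> (position \<open>s\<close> in \<open>U\<close>) and a letter \<open>x\<^sub>j\<close>
  (position \<open>k\<close> of the word number \<open>t\<close> of \<open>W\<close>). After both monomials have been rotated, the
  Koszul sign is that of moving the inputs of \<open>c\<^sub>2, \<dots>, c\<^sub>N\<close> past the inputs of
  \<open>e\<^sub>2, \<dots>, e\<^sub>M\<close> and past the \<open>M - 1\<close> outputs of \<open>W\<close> that are not cut.
\<close>

definition glue :: "int \<Rightarrow> 'x monomial \<Rightarrow> 'x monomial \<Rightarrow> ('x, 'k::field) small" where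
  "glue d U W =
     (\<Sum>s<length U. \<Sum>t<length W. \<Sum>k | k < length (snd (W ! t)) \<and> fst (U ! s) = Delta (snd (W ! t) ! k).
        let U' = rotate s U; W' = rotate t W in
        cscale (ksign (rotate_exp d s U + rotate_exp d t W
                  + mdeg (tl U') * (mdeg (tl W') + (d - 1) * (int (length W) - 1))))
          (cyc_mono d (glue_word U' W' k)))"

definition mono_lie_deg :: "int \<Rightarrow> 'x monomial \<Rightarrow> int" where
  "mono_lie_deg d U = lie_deg d (int (length U)) (mdeg U)"

end

theory Submission
  imports Defs
begin

text \<open>
  \<^bold>\<open>The embedding.\<close> The small resolution is a quotient of the bar resolution. On generators the
  quotient map is the identity for an empty block, sends a block with one word \<open>w\<close> to
  \<open>dw = \<Sum> a dx\<^sub>j b\<close>, summed over the ways of writing \<open>w = a x\<^sub>j b\<close>, and kills all longer blocks.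
  The operation \<open>\<Phi>\<^sub>\<omega>\<close> is the pullback of \<open>\<omega>\<close> along (the tensor power of) this map; the
  symmetrization in its definition does nothing to the pullback of an invariant cochain, because
  pulling back commutes with rotation (\<open>pullback_rot\<close>, \<open>Phi_invariant\<close>). Injectivity holds since the
  value of \<open>\<omega>\<close> on a list of generators is the value of its pullback on the blocks that lift them
  (\<open>pullback_generator_blocks\<close>). Compatibility with the differentials is a statement about one
  block at a time (\<open>hochschild_term_pullback\<close>): a block with one word gives a telescoping sum
  because \<open>D (1 \<otimes> w \<otimes> 1) = 1 \<otimes> w - w \<otimes> 1\<close>, a block with two words gives zero by the Leibniz rule
  \<open>d(w w') = (dw) w' + w (dw')\<close>, and longer blocks stay too long.

  \<^bold>\<open>The bracket.\<close> Since \<open>\<Phi>\<^sub>U\<close> vanishes on blocks with more than one word, inserting an output of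
  \<open>\<Phi>\<^sub>W\<close> into an input of \<open>\<Phi>\<^sub>U\<close> only sees the blocks in which the inserted word stands alone
  (\<open>circ_eq_composite\<close>). After rotating both monomials, the letter \<open>\<delta>\<^sub>j\<close> of \<open>U\<close> differentiates the
  first output \<open>a v b\<close> of \<open>\<Phi>\<^sub>W\<close>, where \<open>v\<close> is the first word of \<open>W\<close>, \<open>a\<close> is the left part of the
  input of the first letter of \<open>W\<close>, and \<open>b\<close> is the right part of the input of the following letter.
  Cutting inside \<open>v\<close> gives exactly the gluing of cyclic monomials (\<open>Phi_unsym_glue_word\<close>).
  Cutting inside \<open>a\<close> or \<open>b\<close> gives terms in which one and the same input is differentiated by a letter
  of \<open>U\<close> and by a letter of \<open>W\<close> (\<open>composite_Phi_unsym\<close>). These are not of the form \<open>\<Phi>\<^sub>\<omega>\<close>, but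
  cutting to the right of the letter of \<open>W\<close> in \<open>U \<circ> W\<close> is the same, up to a rotation, as cutting to
  the left of the letter of \<open>U\<close> in \<open>W \<circ> U\<close> (\<open>left_cut_rotate1\<close>), with signs that agree
  (\<open>exchange_parity\<close>). So they cancel in the bracket (\<open>commutator_Phi_mono\<close>), as the second order
  parts of two vector fields do in their commutator.

  \<^bold>\<open>Closure.\<close> A homogeneous invariant cochain is a finite combination of cyclic monomials, as there
  are finitely many letters. By bilinearity the bracket of two elements of the image has, on inputs
  with given numbers of outputs and entries, the values of some \<open>\<Phi>\<^sub>\<omega>\<close>; these \<open>\<omega>\<close> are assembled
  to a single one (\<open>patch_Phi\<close>, \<open>bracket_closed\<close>).
\<close>

(* A sum of cochains has to stay a sum of functions under simplification, so that the rules for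
   linear operators on cochains apply to it. *)
declare plus_fun_apply [simp del] zero_fun_apply [simp del]

lemmas pointwise = fun_eq_iff plus_fun_apply zero_fun_apply minus_apply

section \<open>Linear extension\<close>

abbreviation keys :: "('b \<Rightarrow>\<^sub>0 'k::zero) \<Rightarrow> 'b set" where
  "keys \<equiv> Poly_Mapping.keys"

abbreviation single :: "'b \<Rightarrow> 'k::zero \<Rightarrow> ('b \<Rightarrow>\<^sub>0 'k)" where
  "single \<equiv> Poly_Mapping.single"

lemma lookup_scale [simp]: "Poly_Mapping.lookup (scale a p) v = a * Poly_Mapping.lookup p v"
  by (simp add: scale_def Poly_Mapping.map.rep_eq when_def)

lemma scale_zero [simp]: "scale a 0 = 0" "scale 0 p = 0"
  by (auto intro!: poly_mapping_eqI)

lemma scale_one [simp]: "scale 1 p = p"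
  by (auto intro!: poly_mapping_eqI)

lemma scale_scale [simp]: "scale a (scale b p) = scale (a * b) p"
  by (auto intro!: poly_mapping_eqI)

lemma scale_add: "scale a (p + q) = scale a p + scale a q"
  by (auto intro!: poly_mapping_eqI simp: lookup_add algebra_simps)

lemma scale_add_left: "scale (a + b) p = scale a p + scale b p"
  by (auto intro!: poly_mapping_eqI simp: lookup_add algebra_simps)

lemma scale_minus: "scale (- a) p = - scale a p"
  by (auto intro!: poly_mapping_eqI)

lemma scale_diff: "scale a (p - q) = scale a p - scale a q"
  by (rule poly_mapping_eqI) (simp add: lookup_minus right_diff_distrib)

lemma scale_sum: "scale a (sum f I) = (\<Sum>i\<in>I. scale a (f i))"
  by (induction I rule: infinite_finite_induct) (simp_all add: scale_add)

lemma scale_single [simp]: "scale a (single v b) = single v (a * b)"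
  by (auto intro!: poly_mapping_eqI simp: lookup_single when_def)

lemma sum_const_scale: "(\<Sum>i\<in>I. p) = scale (of_nat (card I)) p"
  by (induction I rule: infinite_finite_induct) (simp_all add: scale_add_left)

lemma lin_ext_superset:
  assumes "finite S" "keys p \<subseteq> S"
  shows "lin_ext h p = (\<Sum>v\<in>S. scale (Poly_Mapping.lookup p v) (h v))"
  unfolding lin_ext_def using assms
  by (intro sum.mono_neutral_left) (auto simp: in_keys_iff)

lemma lin_ext_zero [simp]: "lin_ext h 0 = 0"
  by (simp add: lin_ext_def)

lemma lin_ext_add: "lin_ext h (p + q) = lin_ext h p + lin_ext h q"
proof -
  let ?S = "keys p \<union> keys q"
  have *: "lin_ext h r = (\<Sum>v\<in>?S. scale (Poly_Mapping.lookup r v) (h v))"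
    if "r = p \<or> r = q \<or> r = p + q" for r
    using that Poly_Mapping.keys_add[of p q] by (intro lin_ext_superset) auto
  show ?thesis
    by (simp add: * lookup_add scale_add_left sum.distrib)
qed

lemma lin_ext_scale: "lin_ext h (scale a p) = scale a (lin_ext h p)"
proof -
  have "keys (scale a p) \<subseteq> keys p"
    by (auto simp: in_keys_iff)
  then have "lin_ext h (scale a p)
      = (\<Sum>v\<in>keys p. scale (Poly_Mapping.lookup (scale a p) v) (h v))"
    by (intro lin_ext_superset) auto
  then show ?thesis
    by (simp add: lin_ext_def scale_sum)
qed

lemma lin_ext_sum: "lin_ext h (sum f I) = (\<Sum>i\<in>I. lin_ext h (f i))"
  by (induction I rule: infinite_finite_induct) (simp_all add: lin_ext_add)

lemma lin_ext_single [simp]: "lin_ext h (single v a) = scale a (h v)"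
  by (subst lin_ext_superset[of "{v}"]) auto

lemma lin_ext_cong:
  "(\<And>v. v \<in> keys p \<Longrightarrow> h v = k v) \<Longrightarrow> lin_ext h p = lin_ext k p"
  by (simp add: lin_ext_def)

lemma lin_ext_fun_add: "lin_ext (\<lambda>v. h v + k v) p = lin_ext h p + lin_ext k p"
  by (simp add: lin_ext_def scale_add sum.distrib)

lemma lin_ext_fun_scale: "lin_ext (\<lambda>v. scale a (h v)) p = scale a (lin_ext h p)"
  by (simp add: lin_ext_def scale_sum mult.commute)

lemma lin_ext_fun_sum: "lin_ext (\<lambda>v. \<Sum>i\<in>I. h i v) p = (\<Sum>i\<in>I. lin_ext (h i) p)"
  unfolding lin_ext_def scale_sum by (rule sum.swap)

lemma lin_ext_fun_zero [simp]: "lin_ext (\<lambda>v. 0) p = 0"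
  by (simp add: lin_ext_def)

lemma lin_ext_lin_ext: "lin_ext h (lin_ext k p) = lin_ext (\<lambda>v. lin_ext h (k v)) p"
  by (subst (2 3) lin_ext_def) (simp add: lin_ext_sum lin_ext_scale)

lemma lin_ext_swap:
  "lin_ext (\<lambda>x. lin_ext (\<lambda>y. G x y) q) p = lin_ext (\<lambda>y. lin_ext (\<lambda>x. G x y) p) q"
  unfolding lin_ext_def scale_sum scale_scale by (subst sum.swap) (simp only: mult.commute)

lemma lin_ext_id: "lin_ext (\<lambda>v. single v 1) p = p"
  by (rule poly_mapping_eqI)
     (auto simp: lin_ext_def lookup_sum lookup_single when_def in_keys_iff)

lemma lin_map_zero [simp]: "lin_map h 0 = 0"
  by (simp add: lin_map_def)

lemma lin_map_add: "lin_map h (p + q) = lin_map h p + lin_map h q"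
  by (simp add: lin_map_def lin_ext_add)

lemma lin_map_scale: "lin_map h (scale a p) = scale a (lin_map h p)"
  by (simp add: lin_map_def lin_ext_scale)

lemma lin_map_sum: "lin_map h (sum f I) = (\<Sum>i\<in>I. lin_map h (f i))"
  by (simp add: lin_map_def lin_ext_sum)

lemma lin_map_single [simp]: "lin_map h (single v a) = single (h v) a"
  by (simp add: lin_map_def)

lemma lin_map_cong:
  "(\<And>v. v \<in> keys p \<Longrightarrow> h v = k v) \<Longrightarrow> lin_map h p = lin_map k p"
  unfolding lin_map_def by (rule lin_ext_cong) simp

lemma lin_map_id: "(\<And>v. v \<in> keys p \<Longrightarrow> h v = v) \<Longrightarrow> lin_map h p = p"
  using lin_map_cong[of p h "\<lambda>v. v"] by (simp add: lin_map_def lin_ext_id)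

lemma lin_map_lin_ext: "lin_map h (lin_ext k p) = lin_ext (\<lambda>v. lin_map h (k v)) p"
  by (simp add: lin_map_def lin_ext_lin_ext)

lemma lin_ext_lin_map: "lin_ext h (lin_map k p) = lin_ext (\<lambda>v. h (k v)) p"
  by (simp add: lin_map_def lin_ext_lin_ext)

lemma lin_map_lin_map: "lin_map h (lin_map k p) = lin_map (\<lambda>v. h (k v)) p"
  by (simp add: lin_map_def lin_ext_lin_ext)

lemma lin_map_diff: "lin_map h (p - q) = lin_map h p - lin_map h q"
  using lin_map_add[of h "p - q" q] by simp

lemma keys_lin_map: "keys (lin_map h p) \<subseteq> h ` keys p"
proof -
  have "keys (lin_map h p)
      \<subseteq> (\<Union>v\<in>keys p. keys (scale (Poly_Mapping.lookup p v) (single (h v) 1)))"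
    unfolding lin_map_def lin_ext_def by (rule Poly_Mapping.keys_sum)
  then show ?thesis by (auto split: if_splits)
qed

lemma keys_scale: "keys (scale a p) \<subseteq> keys p"
  by (auto simp: in_keys_iff)

lemma keys_sum_in:
  "v \<in> keys (\<Sum>i\<in>I. f i) \<Longrightarrow> \<exists>i\<in>I. v \<in> keys (f i)"
  using Poly_Mapping.keys_sum[of f I] by auto

lemma keys_lin_ext:
  assumes "v \<in> keys (lin_ext h p)"
  shows "\<exists>y\<in>keys p. v \<in> keys (h y)"
proof -
  obtain y where "y \<in> keys p"
    "v \<in> keys (scale (Poly_Mapping.lookup p y) (h y))"
    using keys_sum_in[OF assms[unfolded lin_ext_def]] by blast
  then show ?thesis
    using subsetD[OF keys_scale] by metis
qed

lemma ksign_add: "ksign (a + b) = ksign a * (ksign b :: 'k::ring_1)"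
  by (auto simp: ksign_def)

lemma ksign_cong: "even (a - b) \<Longrightarrow> ksign a = ksign b"
  by (auto simp: ksign_def)

lemma ksign_even [simp]: "even a \<Longrightarrow> ksign a = 1"
  by (auto simp: ksign_def)

lemma cscale_cscale [simp]: "cscale a (cscale b f) = cscale (a * b) f"
  by (simp add: cscale_def)

lemma cscale_one [simp]: "cscale 1 f = f"
  by (simp add: cscale_def)

lemma cscale_zero [simp]: "cscale a 0 = 0" "cscale 0 f = 0"
  by (simp_all add: cscale_def pointwise)

lemma cscale_add: "cscale a (f + g) = cscale a f + cscale a g"
  by (simp add: cscale_def pointwise scale_add)

lemma sum_fun_apply: "(\<Sum>i\<in>I. f i) x = (\<Sum>i\<in>I. f i x)"
  for f :: "'i \<Rightarrow> 'b \<Rightarrow> 'c::comm_monoid_add"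
  by (induction I rule: infinite_finite_induct) (simp_all add: plus_fun_apply zero_fun_apply)

lemma cscale_sum: "cscale a (sum f I) = (\<Sum>i\<in>I. cscale a (f i))"
  by (simp add: cscale_def pointwise sum_fun_apply scale_sum)

section \<open>Cyclic rotation and symmetrization\<close>

lemma total_deg_Nil [simp]: "total_deg deg [] = 0"
  by (simp add: total_deg_def)

lemma total_deg_Cons [simp]: "total_deg deg (x # X) = int (deg x) + total_deg deg X"
  by (simp add: total_deg_def)

lemma total_deg_append [simp]: "total_deg deg (X @ Y) = total_deg deg X + total_deg deg Y"
  by (simp add: total_deg_def)

text \<open>
  The conditions on elements of \<open>invariants\<close> other than invariance. They are what makes a full turn the
  identity, and hence symmetrization a projection.
\<close>

definition well_shaped :: "('b, 'x, 'k::field) cochain \<Rightarrow> bool" where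
  "well_shaped f \<longleftrightarrow> f [] = 0 \<and> (\<forall>X. \<forall>v\<in>keys (f X). length v = length X)"

lemma invariants_iff: "f \<in> invariants d deg \<longleftrightarrow> well_shaped f \<and> rot d deg f = f"
  by (auto simp: invariants_def well_shaped_def)

lemma rotr_snoc [simp]: "rotr (P @ [x]) = x # P"
  by (simp add: rotr_def)

lemma length_rotr [simp]: "length (rotr X) = length X"
  by (simp add: rotr_def)

lemma total_deg_rotr [simp]: "total_deg deg (rotr X) = total_deg deg X"
  by (cases X rule: rev_cases) (simp_all add: rotr_def)

lemma rot_snoc:
  "rot d deg f (P @ [x]) = scale (ksign (int (deg x) * total_deg deg P + (d - 1) * int (length P)))
     (lin_map rotate1 (f (x # P)))"
  by (simp add: rot_def)

text \<open>
  Moving the last \<open>s\<close> blocks to the front one after the other has the sign of moving them there as a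
  whole, since Koszul signs are biadditive in the degrees; the signs among the moved blocks themselves
  occur twice.
\<close>

lemma rot_power_append:
  fixes f :: "('b, 'x, 'k::field) cochain"
  assumes "length Q = s"
  shows "(rot d deg ^^ s) f (P @ Q) =
    scale (ksign (total_deg deg Q * total_deg deg P + (d - 1) * (int (length P + length Q) - 1) * int s))
      (lin_map (rotate s) (f (Q @ P)))"
  using assms
proof (induction s arbitrary: P Q)
  case 0
  then show ?case by (simp add: lin_map_id)
next
  case (Suc s)
  then obtain Q' x where Q: "Q = Q' @ [x]" "length Q' = s"
    by (metis length_Suc_conv_rev)
  define D where "D = total_deg deg"
  have "(rot d deg ^^ Suc s) f (P @ Q) = rot d deg ((rot d deg ^^ s) f) ((P @ Q') @ [x])"
    by (simp add: Q)
  also have "\<dots> = scale (ksign (int (deg x) * D (P @ Q') + (d - 1) * int (length (P @ Q'))))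
     (lin_map rotate1 ((rot d deg ^^ s) f ((x # P) @ Q')))"
    by (simp only: rot_snoc D_def) simp
  also have "\<dots> = scale (ksign (int (deg x) * D (P @ Q') + (d - 1) * int (length (P @ Q'))
       + (D Q' * D (x # P) + (d - 1) * (int (length (x # P) + length Q') - 1) * int s)))
     (lin_map (\<lambda>v. rotate1 (rotate s v)) (f (Q @ P)))"
    by (subst Suc.IH) (simp_all add: Q lin_map_scale lin_map_lin_map ksign_add D_def)
  also have "ksign (int (deg x) * D (P @ Q') + (d - 1) * int (length (P @ Q'))
       + (D Q' * D (x # P) + (d - 1) * (int (length (x # P) + length Q') - 1) * int s)) =
     (ksign (D Q * D P + (d - 1) * (int (length P + length Q) - 1) * int (Suc s)) :: 'k)"
    by (rule ksign_cong) (simp add: Q D_def algebra_simps)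
  finally show ?case by (simp add: D_def rotate_def)
qed

text \<open>
  In a full turn a block of degree \<open>r\<close> passes the others with the sign exponent \<open>r (n - r)\<close>, where
  \<open>n\<close> is the total degree. These add up to an even number, as \<open>n\<^sup>2 - n\<close> is even, and so is
  \<open>N (N - 1)\<close>. Hence the rotations are an action of the cyclic group, and symmetrization is the
  projection onto its invariants.
\<close>

lemma rot_period:
  assumes "well_shaped f"
  shows "(rot d deg ^^ length X) f X = f X"
proof -
  have "(rot d deg ^^ length X) f ([] @ X) =
    scale (ksign ((d - 1) * (int (length X) - 1) * int (length X))) (lin_map (rotate (length X)) (f X))"
    by (subst rot_power_append) simp_all
  moreover have "even ((d - 1) * (int (length X) - 1) * int (length X))"
    by simp
  moreover have "lin_map (rotate (length X)) (f X) = f X"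
    using assms by (intro lin_map_id) (auto simp: well_shaped_def)
  ultimately show ?thesis by simp
qed

lemma rot_Nil: "f [] = 0 \<Longrightarrow> rot d deg f [] = 0"
  by (simp add: rot_def rotr_def)

lemma rot_add: "rot d deg (f + g) = rot d deg f + rot d deg g"
  by (simp add: rot_def pointwise lin_map_add scale_add)

lemma rot_cscale: "rot d deg (cscale a f) = cscale a (rot d deg f)"
  by (simp add: rot_def pointwise lin_map_scale cscale_def mult.commute)

lemma rot_zero [simp]: "rot d deg 0 = 0"
  by (simp add: rot_def pointwise)

lemma rot_power_add: "(rot d deg ^^ s) (f + g) = (rot d deg ^^ s) f + (rot d deg ^^ s) g"
  by (induction s) (simp_all add: rot_add)

lemma rot_power_cscale: "(rot d deg ^^ s) (cscale a f) = cscale a ((rot d deg ^^ s) f)"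
  by (induction s) (simp_all add: rot_cscale)

lemma rot_power_zero [simp]: "(rot d deg ^^ s) 0 = 0"
  by (induction s) simp_all

lemma symmetrize_add: "symmetrize d deg (f + g) = symmetrize d deg f + symmetrize d deg g"
  by (simp add: symmetrize_def pointwise rot_power_add sum.distrib scale_add)

lemma symmetrize_cscale: "symmetrize d deg (cscale a f) = cscale a (symmetrize d deg f)"
  unfolding symmetrize_def rot_power_cscale
  by (simp add: cscale_def scale_sum mult.commute)

lemma symmetrize_zero [simp]: "symmetrize d deg 0 = 0"
  by (simp add: symmetrize_def pointwise)

lemma symmetrize_sum: "symmetrize d deg (sum f I) = (\<Sum>i\<in>I. symmetrize d deg (f i))"
  by (induction I rule: infinite_finite_induct) (simp_all add: symmetrize_add)

lemma well_shapedD: "well_shaped f \<Longrightarrow> v \<in> keys (f X) \<Longrightarrow> length v = length X"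
  by (simp add: well_shaped_def)

lemma well_shaped_Nil: "well_shaped f \<Longrightarrow> f [] = 0"
  by (simp add: well_shaped_def)

lemma well_shapedI:
  "f [] = 0 \<Longrightarrow> (\<And>X v. v \<in> keys (f X) \<Longrightarrow> length v = length X) \<Longrightarrow> well_shaped f"
  by (simp add: well_shaped_def)

lemma well_shaped_rot:
  assumes "well_shaped f"
  shows "well_shaped (rot d deg f)"
proof (rule well_shapedI)
  fix X v
  assume "v \<in> keys (rot d deg f X)"
  then have "v \<in> rotate1 ` keys (f (rotr X))"
    unfolding rot_def by (metis keys_scale keys_lin_map subsetD)
  then show "length v = length X"
    by (auto dest: well_shapedD[OF assms])
qed (simp add: rot_Nil well_shaped_Nil[OF assms])

lemma well_shaped_rot_power: "well_shaped f \<Longrightarrow> well_shaped ((rot d deg ^^ s) f)"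
  by (induction s) (simp_all add: well_shaped_rot)

lemma well_shaped_add:
  assumes "well_shaped f" "well_shaped g"
  shows "well_shaped (f + g)"
proof (rule well_shapedI)
  fix X v
  assume "v \<in> keys ((f + g) X)"
  then have "v \<in> keys (f X) \<or> v \<in> keys (g X)"
    using Poly_Mapping.keys_add[of "f X" "g X"] by (auto simp: plus_fun_apply)
  then show "length v = length X"
    by (auto dest: well_shapedD[OF assms(1)] well_shapedD[OF assms(2)])
qed (simp add: assms well_shaped_Nil plus_fun_apply)

lemma well_shaped_cscale:
  assumes "well_shaped f"
  shows "well_shaped (cscale a f)"
proof (rule well_shapedI)
  fix X v
  assume "v \<in> keys (cscale a f X)"
  then have "v \<in> keys (f X)"
    unfolding cscale_def by (rule subsetD[OF keys_scale])
  then show "length v = length X"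
    by (rule well_shapedD[OF assms])
qed (simp add: cscale_def well_shaped_Nil[OF assms])

lemma well_shaped_zero [simp]: "well_shaped 0"
  by (simp add: well_shaped_def zero_fun_apply)

lemma well_shaped_symmetrize:
  assumes "well_shaped f"
  shows "well_shaped (symmetrize d deg f)"
  unfolding well_shaped_def symmetrize_def
proof (intro conjI allI ballI)
  fix X v
  assume "v \<in> keys (scale (1 / of_nat (length X)) (\<Sum>s<length X. (rot d deg ^^ s) f X))"
  then have "v \<in> keys (\<Sum>s<length X. (rot d deg ^^ s) f X)"
    by (rule subsetD[OF keys_scale])
  then obtain s where "v \<in> keys ((rot d deg ^^ s) f X)"
    by (meson keys_sum_in)
  then show "length v = length X"
    by (rule well_shapedD[OF well_shaped_rot_power[OF assms]])
qed simp

lemma rot_symmetrize: "rot d deg (symmetrize d deg f) = symmetrize d deg (rot d deg f)"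
proof
  fix X :: "'a list"
  let ?e = "ksign (int (deg (last X)) * total_deg deg (butlast X) + (d - 1) * (int (length X) - 1)) :: 'c"
  have rot: "rot d deg g X = scale ?e (lin_map rotate1 (g (rotr X)))" for g
    by (simp add: rot_def)
  have "rot d deg (symmetrize d deg f) X =
      scale (1 / of_nat (length X)) (\<Sum>s<length X. rot d deg ((rot d deg ^^ s) f) X)"
    unfolding rot symmetrize_def
    by (simp add: lin_map_scale lin_map_sum scale_sum mult.commute)
  also have "\<dots> = symmetrize d deg (rot d deg f) X"
    by (simp add: symmetrize_def funpow_swap1)
  finally show "rot d deg (symmetrize d deg f) X = symmetrize d deg (rot d deg f) X" .
qed

lemma symmetrize_rot:
  assumes "well_shaped f"
  shows "symmetrize d deg (rot d deg f) = symmetrize d deg f"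
proof
  fix X :: "'a list"
  let ?r = "\<lambda>s. (rot d deg ^^ s) f X"
  have "(\<Sum>s<length X. ?r (Suc s)) + ?r 0 = (\<Sum>s<length X. ?r s) + ?r (length X)"
    using sum.lessThan_Suc_shift[of ?r "length X"] sum.lessThan_Suc[of ?r "length X"]
    by (simp only: add.commute)
  moreover have "?r (length X) = ?r 0"
    using rot_period[OF assms] by simp
  ultimately have "(\<Sum>s<length X. ?r (Suc s)) = (\<Sum>s<length X. ?r s)"
    by simp
  then show "symmetrize d deg (rot d deg f) X = symmetrize d deg f X"
    by (simp add: symmetrize_def funpow_swap1)
qed

lemma symmetrize_rot_power:
  "well_shaped f \<Longrightarrow> symmetrize d deg ((rot d deg ^^ s) f) = symmetrize d deg f"
proof (induction s)
  case (Suc s)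
  then show ?case
    by (simp add: symmetrize_rot[OF well_shaped_rot_power])
qed simp

lemma symmetrize_invariant: "well_shaped f \<Longrightarrow> symmetrize d deg f \<in> invariants d deg"
  by (simp add: invariants_iff well_shaped_symmetrize rot_symmetrize symmetrize_rot)

lemma rot_power_invariant: "f \<in> invariants d deg \<Longrightarrow> (rot d deg ^^ s) f = f"
  by (induction s) (simp_all add: invariants_iff)

lemma symmetrize_eq:
  fixes f :: "('b, 'x, 'k::field_char_0) cochain"
  assumes "f \<in> invariants d deg"
  shows "symmetrize d deg f = f"
proof
  fix X
  have "f [] = 0"
    using assms by (simp add: invariants_def)
  then show "symmetrize d deg f X = f X"
    unfolding symmetrize_def rot_power_invariant[OF assms]
    by (cases "X = []") (simp_all add: sum_const_scale)
qed

lemma invariants_add: "f \<in> invariants d deg \<Longrightarrow> g \<in> invariants d deg \<Longrightarrow> f + g \<in> invariants d deg"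
  by (simp add: invariants_iff well_shaped_add rot_add)

lemma invariants_cscale: "f \<in> invariants d deg \<Longrightarrow> cscale a f \<in> invariants d deg"
  by (simp add: invariants_iff well_shaped_cscale rot_cscale)

lemma invariants_zero [simp]: "0 \<in> invariants d deg"
  by (simp add: invariants_iff)

section \<open>The pullback of cochains of the small complex\<close>

lemma sum_listset_Cons:
  "(\<Sum>l\<in>listset (A # As). F l) = (\<Sum>a\<in>A. \<Sum>l\<in>listset As. F (a # l))"
proof -
  have "listset (A # As) = (\<lambda>(a, l). a # l) ` (A \<times> listset As)"
    by (auto simp: set_Cons_def)
  moreover have "inj_on (\<lambda>(a, l). a # l) (A \<times> listset As)"
    by (auto simp: inj_on_def)
  ultimately have "(\<Sum>l\<in>listset (A # As). F l) = (\<Sum>(a, l)\<in>A \<times> listset As. F (a # l))"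
    by (simp add: sum.reindex case_prod_unfold del: listset.simps)
  then show ?thesis
    by (simp only: sum.cartesian_product)
qed

lemma sum_listset_append:
  "(\<Sum>l\<in>listset (As @ Bs). F l) = (\<Sum>l\<in>listset As. \<Sum>m\<in>listset Bs. F (l @ m))"
proof (induction As arbitrary: F)
  case Nil
  then show ?case by simp
next
  case (Cons A As)
  have "(\<Sum>l\<in>listset ((A # As) @ Bs). F l) = (\<Sum>a\<in>A. \<Sum>l\<in>listset (As @ Bs). F (a # l))"
    by (simp only: append_Cons sum_listset_Cons)
  also have "\<dots> = (\<Sum>a\<in>A. \<Sum>l\<in>listset As. \<Sum>m\<in>listset Bs. F (a # l @ m))"
    by (simp only: Cons.IH)
  also have "\<dots> = (\<Sum>l\<in>listset (A # As). \<Sum>m\<in>listset Bs. F (l @ m))"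
    by (simp only: sum_listset_Cons append_Cons)
  finally show ?case .
qed

lemma listset_length: "l \<in> listset As \<Longrightarrow> length l = length As"
  by (induction As arbitrary: l) (auto simp: set_Cons_def)

text \<open>
  This is what turns signs that depend on the degrees of the inputs into signs that depend on the
  monomial.
\<close>

lemma splittings_length: "s \<in> splittings c B \<Longrightarrow> length B = gdeg c"
  by (cases c) (auto split: if_splits)

lemma finite_splittings [simp]: "finite (splittings c B)"
proof (cases c)
  case (Delta j)
  have "splittings c B \<subseteq> (\<lambda>k. (take k (hd B), drop (Suc k) (hd B))) ` {..<length (hd B)}"
  proof
    fix s
    assume "s \<in> splittings c B"
    then obtain a b where "s = (a, b)" "B = [a @ [j] @ b]"
      using Delta by auto
    then show "s \<in> (\<lambda>k. (take k (hd B), drop (Suc k) (hd B))) ` {..<length (hd B)}"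
      by (intro image_eqI[of _ _ "length a"]) auto
  qed
  then show ?thesis
    by (rule finite_subset) simp
qed simp

abbreviation msplits :: "'x monomial \<Rightarrow> 'x word list list \<Rightarrow> ('x word \<times> 'x word) list set" where
  "msplits U X \<equiv> listset (map2 splittings (map fst U) X)"

lemma msplits_length: "l \<in> msplits U X \<Longrightarrow> length U = length X \<Longrightarrow> length l = length X"
  by (drule listset_length) simp

lemma msplits_degrees:
  "l \<in> msplits U X \<Longrightarrow> length U = length X \<Longrightarrow> map length X = map gdeg (map fst U)"
proof (induction U arbitrary: l X)
  case (Cons y U)
  then obtain B X' where "X = B # X'"
    by (cases X) auto
  with Cons show ?case
    by (auto simp: set_Cons_def dest: splittings_length)
qed simp

lemma msplits_total_deg:
  assumes "l \<in> msplits U X" "length U = length X"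
  shows "inputs X = mdeg U"
  using msplits_degrees[OF assms] by (simp add: total_deg_def mdeg_def)

lemma mdeg_simps [simp]:
  "mdeg [] = 0" "mdeg (y # U) = int (gdeg (fst y)) + mdeg U" "mdeg (U @ V) = mdeg U + mdeg V"
  by (simp_all add: mdeg_def)

lemma cyc_act_rotate1:
  assumes "length as = length us" "length bs = length us"
  shows "rotate1 (cyc_act (a # as) (u # us) (b # bs)) = cyc_act (as @ [a]) (us @ [u]) (bs @ [b])"
proof (cases us)
  case Nil
  with assms show ?thesis by (simp add: cyc_act_def)
next
  case (Cons u' us')
  with assms obtain a' as' b' bs' where *: "as = a' # as'" "bs = b' # bs'"
    "length as' = length us'" "length bs' = length us'"
    by (auto simp: length_Suc_conv)
  define M where "M = (a' @ u') # map2 (@) as' us'"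
  have "zip (M @ [a @ u]) ((bs' @ [b]) @ [b']) = zip M (bs' @ [b]) @ zip [a @ u] [b']"
    by (rule zip_append) (simp add: M_def *)
  with * show ?thesis
    by (simp add: cyc_act_def Cons M_def)
qed

lemma Phi_unsym_Cons:
  assumes "length U = length X"
  shows "(Phi_unsym (y # U) (B # X) :: ('x, 'k::field) tensor) =
    (\<Sum>s\<in>splittings (fst y) B. \<Sum>l\<in>msplits U X.
       single (cyc_act (fst s # map fst l) (snd y # map snd U) (snd s # map snd l)) 1)"
proof -
  have "(Phi_unsym (y # U) (B # X) :: ('x, 'k) tensor) =
    (\<Sum>ab\<in>listset (splittings (fst y) B # map2 splittings (map fst U) X).
       single (cyc_act (map fst ab) (map snd (y # U)) (map snd ab)) 1)"
    using assms by (simp add: Phi_unsym_def del: listset.simps)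
  then show ?thesis
    by (simp only: sum_listset_Cons list.map)
qed

lemma Phi_unsym_snoc:
  assumes "length U = length X"
  shows "(Phi_unsym (U @ [y]) (X @ [B]) :: ('x, 'k::field) tensor) =
    (\<Sum>s\<in>splittings (fst y) B. \<Sum>l\<in>msplits U X.
       single (cyc_act (map fst l @ [fst s]) (map snd U @ [snd y]) (map snd l @ [snd s])) 1)"
proof -
  have *: "map2 splittings (map fst (U @ [y])) (X @ [B]) =
      map2 splittings (map fst U) X @ [splittings (fst y) B]"
    using assms by simp
  have "(Phi_unsym (U @ [y]) (X @ [B]) :: ('x, 'k) tensor) =
    (\<Sum>ab\<in>listset (map2 splittings (map fst U) X @ [splittings (fst y) B]).
       single (cyc_act (map fst ab) (map snd (U @ [y])) (map snd ab)) 1)"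
    unfolding Phi_unsym_def * using assms by simp
  also have "\<dots> = (\<Sum>l\<in>msplits U X. \<Sum>s\<in>splittings (fst y) B.
       single (cyc_act (map fst l @ [fst s]) (map snd U @ [snd y]) (map snd l @ [snd s])) 1)"
    by (simp only: sum_listset_append sum_listset_Cons) simp
  finally show ?thesis
    by (simp only: sum.swap[of _ "msplits U X"])
qed

text \<open>
  Rotating the operation of a monomial is rotating the monomial, with the sign by which the
  cochain with a single coefficient is rotated (\<open>rot_mono_cochain\<close>). Both are the Koszul sign of the
  moved letter.
\<close>

lemma rot_Phi_unsym:
  "rot d length (Phi_unsym (y # U) :: ('x, 'k::field) operation) =
     cscale (ksign (int (gdeg (fst y)) * mdeg U + (d - 1) * int (length U))) (Phi_unsym (U @ [y]))"
proof
  fix X :: "'x word list list"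
  show "rot d length (Phi_unsym (y # U) :: ('x, 'k::field) operation) X =
     cscale (ksign (int (gdeg (fst y)) * mdeg U + (d - 1) * int (length U))) (Phi_unsym (U @ [y])) X"
  proof (cases "length X = Suc (length U)")
    case False
    then show ?thesis
      by (simp add: rot_def cscale_def Phi_unsym_def)
  next
    case True
    then obtain P B where X: "X = P @ [B]" "length U = length P"
      by (metis length_Suc_conv_rev)
    have "scale (ksign (int (length B) * inputs P + (d - 1) * int (length P)))
        (lin_map rotate1 (single (cyc_act (fst s # map fst l) (snd y # map snd U) (snd s # map snd l)) 1)) =
      scale (ksign (int (gdeg (fst y)) * mdeg U + (d - 1) * int (length U)))
        (single (cyc_act (map fst l @ [fst s]) (map snd U @ [snd y]) (map snd l @ [snd s])) (1::'k))"
      if "s \<in> splittings (fst y) B" "l \<in> msplits U P" for s l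
      using splittings_length[OF that(1)] msplits_total_deg[OF that(2) X(2)]
        msplits_length[OF that(2) X(2)] X(2)
      by (simp add: cyc_act_rotate1)
    then show ?thesis
      unfolding X(1) rot_snoc cscale_def Phi_unsym_snoc[OF X(2)] Phi_unsym_Cons[OF X(2)]
        lin_map_sum scale_sum
      by (intro sum.cong refl)
  qed
qed

definition mono_cochain :: "'x monomial \<Rightarrow> ('x, 'k::field) small" where
  "mono_cochain U = (\<lambda>c. if c = map fst U then single (map snd U) 1 else 0)"

lemma cyc_mono_eq: "cyc_mono d U = symmetrize d gdeg (mono_cochain U)"
  by (simp add: cyc_mono_def mono_cochain_def)

lemma rot_mono_cochain:
  "rot d gdeg (mono_cochain (y # U) :: ('x, 'k::field) small) =
     cscale (ksign (int (gdeg (fst y)) * mdeg U + (d - 1) * int (length U))) (mono_cochain (U @ [y]))"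
proof
  fix c :: "'x gen list"
  show "rot d gdeg (mono_cochain (y # U) :: ('x, 'k::field) small) c =
     cscale (ksign (int (gdeg (fst y)) * mdeg U + (d - 1) * int (length U))) (mono_cochain (U @ [y])) c"
  proof (cases c rule: rev_cases)
    case Nil
    then show ?thesis
      by (simp add: rot_Nil mono_cochain_def cscale_def)
  next
    case (snoc P x)
    then show ?thesis
      by (auto simp: rot_snoc mono_cochain_def cscale_def mdeg_def)
  qed
qed

lemma well_shaped_mono_cochain: "U \<noteq> [] \<Longrightarrow> well_shaped (mono_cochain U)"
  by (rule well_shapedI) (auto simp: mono_cochain_def split: if_splits)

text \<open>
  The operation of a cochain before symmetrization, which is composition with the quotient map
  from the bar resolution to the small one.
\<close>

definition pullback :: "('x::finite, 'k::field) small \<Rightarrow> ('x, 'k) operation" where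
  "pullback \<phi> X = (\<Sum>c | length c = length X. lin_ext (\<lambda>u. Phi_unsym (zip c u) X) (\<phi> c))"

lemma finite_UNIV_gen: "finite (UNIV :: 'x::finite gen set)"
proof -
  have "(UNIV :: 'x gen set) \<subseteq> insert Xi (range Delta)"
    by (metis UNIV_I gen.exhaust insertI1 insertI2 rangeI subsetI)
  then show ?thesis
    by (rule finite_subset) simp
qed

lemma finite_letters: "finite {c :: 'x::finite gen list. length c = n}"
  using finite_lists_length_eq[OF finite_UNIV_gen, of n] by simp

lemma pullback_add: "pullback (\<phi> + \<psi>) = pullback \<phi> + pullback \<psi>"
  by (simp add: pullback_def pointwise lin_ext_add sum.distrib)

lemma pullback_cscale: "pullback (cscale a \<phi>) = cscale a (pullback \<phi>)"
  by (simp add: pullback_def cscale_def fun_eq_iff lin_ext_scale scale_sum)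

lemma pullback_zero [simp]: "pullback 0 = 0"
  by (simp add: pullback_def pointwise)

lemma Phi_add: "Phi d (\<phi> + \<psi>) = Phi d \<phi> + Phi d \<psi>"
  by (simp add: Phi_def pointwise lin_ext_add sum.distrib)

lemma Phi_cscale: "Phi d (cscale a \<phi>) = cscale a (Phi d \<phi>)"
  by (simp add: Phi_def cscale_def fun_eq_iff lin_ext_scale scale_sum)

lemma Phi_zero [simp]: "Phi d 0 = 0"
  by (simp add: Phi_def pointwise)

lemma Phi_sum: "Phi d (sum f I) = (\<Sum>i\<in>I. Phi d (f i))"
  by (induction I rule: infinite_finite_induct) (simp_all add: Phi_add)

lemma sum_letters_mono_cochain:
  fixes U :: "'x::finite monomial"
  assumes "\<And>U. length X \<noteq> length U \<Longrightarrow> F U X = 0"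
  shows "(\<Sum>c | length c = length X. lin_ext (\<lambda>u. F (zip c u) X) (mono_cochain U c)) = F U X"
proof (cases "length X = length U")
  case False
  have "lin_ext (\<lambda>u. F (zip c u) X) (mono_cochain U c) = 0" if "length c = length X" for c
    using False that by (auto simp: mono_cochain_def)
  with False assms show ?thesis
    by simp
next
  case True
  have "(\<Sum>c | length c = length X. lin_ext (\<lambda>u. F (zip c u) X) (mono_cochain U c)) =
     (\<Sum>c \<in> {map fst U}. lin_ext (\<lambda>u. F (zip c u) X) (mono_cochain U c))"
    using True by (intro sum.mono_neutral_right) (auto simp: mono_cochain_def finite_letters)
  then show ?thesis
    by (simp add: mono_cochain_def zip_map_fst_snd)
qed

lemma pullback_mono_cochain: "pullback (mono_cochain U) = Phi_unsym U"
  unfolding pullback_def fun_eq_iff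
  by (intro allI sum_letters_mono_cochain) (simp add: Phi_unsym_def)

lemma keys_Phi_unsym: "v \<in> keys (Phi_unsym U X) \<Longrightarrow> length v = length X"
proof -
  assume v: "v \<in> keys (Phi_unsym U X)"
  then have len: "length U = length X"
    by (auto simp: Phi_unsym_def split: if_splits)
  from v len obtain ab where "ab \<in> msplits U X" "v = cyc_act (map fst ab) (map snd U) (map snd ab)"
    by (auto simp: Phi_unsym_def dest!: keys_sum_in split: if_splits)
  then show "length v = length X"
    using msplits_length[of ab U X] len by (simp add: cyc_act_def)
qed

lemma well_shaped_Phi_unsym: "U \<noteq> [] \<Longrightarrow> well_shaped (Phi_unsym U)"
  by (rule well_shapedI) (auto simp: keys_Phi_unsym, simp add: Phi_unsym_def)

lemma Phi_mono_cochain: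
  assumes "U \<noteq> []"
  shows "Phi d (mono_cochain U) = Phi_mono d U"
  unfolding Phi_def fun_eq_iff
proof (intro allI sum_letters_mono_cochain)
  fix X :: "'a word list list" and V :: "'a monomial"
  assume "length X \<noteq> length V"
  then have "(rot d length ^^ s) (Phi_unsym V) X = (0 :: ('a, 'b) tensor)" for s
  proof (induction s arbitrary: X)
    case (Suc s)
    then show ?case
      by (simp add: rot_def[of d length "(rot d length ^^ s) (Phi_unsym V)"])
  qed (simp add: Phi_unsym_def)
  then show "Phi_mono d V X = (0 :: ('a, 'b) tensor)"
    by (simp add: Phi_mono_def symmetrize_def)
qed

text \<open>
  A cochain with a fixed number of outputs is a finite combination of monomials, because there are
  finitely many lists of letters of a given length and each value is a finite combination of words.
\<close>

lemma well_shaped_induct: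
  fixes \<phi> :: "('x::finite, 'k::field) small"
  assumes "well_shaped \<phi>" and supp: "\<And>c. \<phi> c \<noteq> 0 \<Longrightarrow> length c = n"
    and zero: "P 0" and add: "\<And>\<phi> \<psi>. P \<phi> \<Longrightarrow> P \<psi> \<Longrightarrow> P (\<phi> + \<psi>)"
    and mono: "\<And>a U. length U = n \<Longrightarrow> \<phi> (map fst U) \<noteq> 0 \<Longrightarrow> P (cscale a (mono_cochain U))"
  shows "P \<phi>"
proof -
  let ?K = "\<lambda>c. keys (\<phi> c)"
  have P_sum: "P (sum f I)" if "\<And>i. i \<in> I \<Longrightarrow> P (f i)" for f :: "'i \<Rightarrow> ('x, 'k) small" and I
    using that by (induction I rule: infinite_finite_induct) (auto intro: zero add)
  have expand: "\<phi> = (\<Sum>c | length c = n. \<Sum>u\<in>?K c.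
      cscale (Poly_Mapping.lookup (\<phi> c) u) (mono_cochain (zip c u)))"
  proof
    fix e
    have "(\<Sum>u\<in>?K c. cscale (Poly_Mapping.lookup (\<phi> c) u) (mono_cochain (zip c u)) e) =
        (if e = c then \<phi> e else 0)" for c
    proof -
      have *: "cscale (Poly_Mapping.lookup (\<phi> c) u) (mono_cochain (zip c u)) e =
        (if e = c then scale (Poly_Mapping.lookup (\<phi> c) u) (single u 1) else 0)"
        if "u \<in> ?K c" for u
        using well_shapedD[OF assms(1) that] by (simp add: cscale_def mono_cochain_def)
      have "(\<Sum>u\<in>?K c. cscale (Poly_Mapping.lookup (\<phi> c) u) (mono_cochain (zip c u)) e) =
         (if e = c then lin_ext (\<lambda>u. single u 1) (\<phi> c) else 0)"
        by (simp only: * lin_ext_def cong: sum.cong) simp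
      then show ?thesis
        by (simp add: lin_ext_id)
    qed
    then show "\<phi> e = (\<Sum>c | length c = n. \<Sum>u\<in>?K c.
      cscale (Poly_Mapping.lookup (\<phi> c) u) (mono_cochain (zip c u))) e"
      using supp[of e] by (auto simp: sum_fun_apply finite_letters)
  qed
  have "P (\<Sum>c | length c = n. \<Sum>u\<in>?K c.
      cscale (Poly_Mapping.lookup (\<phi> c) u) (mono_cochain (zip c u)))"
  proof (intro P_sum)
    fix c u
    assume "c \<in> {c. length c = n}" "u \<in> ?K c"
    then show "P (cscale (Poly_Mapping.lookup (\<phi> c) u) (mono_cochain (zip c u)))"
      using well_shapedD[OF assms(1), of u c] by (intro mono) auto
  qed
  then show ?thesis
    by (subst expand)
qed

text \<open>
  Statements about all of a direct product are reduced to a single number of outputs: rotation,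
  pullback and symmetrization do not mix different lengths.
\<close>

definition truncate :: "nat \<Rightarrow> ('b, 'x, 'k::field) cochain \<Rightarrow> ('b, 'x, 'k) cochain" where
  "truncate n f X = (if length X = n then f X else 0)"

lemma well_shaped_truncate: "well_shaped f \<Longrightarrow> well_shaped (truncate n f)"
  by (rule well_shapedI) (auto simp: truncate_def well_shaped_Nil well_shapedD split: if_splits)

lemma pullback_truncate: "length X = n \<Longrightarrow> pullback (truncate n \<phi>) X = pullback \<phi> X"
  by (simp add: pullback_def truncate_def)

lemma Phi_truncate: "length X = n \<Longrightarrow> Phi d (truncate n \<phi>) X = Phi d \<phi> X"
  by (simp add: Phi_def truncate_def)

lemma rot_truncate: "rot d deg (truncate n f) = truncate n (rot d deg f)"
  by (simp add: rot_def truncate_def fun_eq_iff)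

lemma rot_power_local:
  "(\<And>X. length X = n \<Longrightarrow> f X = g X) \<Longrightarrow> length X = n \<Longrightarrow> (rot d deg ^^ s) f X = (rot d deg ^^ s) g X"
proof (induction s arbitrary: X)
  case (Suc s)
  then show ?case
    by (simp add: rot_def[of d deg "(rot d deg ^^ s) _"])
qed simp

lemma symmetrize_local:
  assumes "\<And>X. length X = n \<Longrightarrow> f X = g X" "length X = n"
  shows "symmetrize d deg f X = symmetrize d deg g X"
  unfolding symmetrize_def using rot_power_local[of n f g, OF assms] by (simp cong: sum.cong)

lemma pullback_rot:
  assumes "well_shaped \<phi>"
  shows "pullback (rot d gdeg \<phi>) = rot d length (pullback \<phi>)"
proof
  fix X :: "'a word list list"
  define n where "n = length X"
  have "pullback (rot d gdeg (truncate n \<phi>)) = rot d length (pullback (truncate n \<phi>))"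
    using well_shaped_truncate[OF assms]
  proof (rule well_shaped_induct)
    show "length c = n" if "truncate n \<phi> c \<noteq> 0" for c
      using that by (simp add: truncate_def split: if_splits)
    show "pullback (rot d gdeg (cscale a (mono_cochain U))) =
        rot d length (pullback (cscale a (mono_cochain U) :: ('a, 'b) small))"
      if "length U = n" "truncate n \<phi> (map fst U) \<noteq> 0" for a U
    proof -
      have "U \<noteq> []"
        using that(2) well_shaped_Nil[OF well_shaped_truncate[OF assms], of n] by auto
      then obtain y V where "U = y # V"
        by (cases U) auto
      then show ?thesis
        by (simp only: rot_cscale pullback_cscale pullback_mono_cochain rot_mono_cochain rot_Phi_unsym)
    qed
  qed (simp_all add: rot_add pullback_add)
  moreover have "pullback (rot d gdeg (truncate n \<phi>)) X = pullback (rot d gdeg \<phi>) X"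
    by (simp add: rot_truncate pullback_truncate n_def)
  moreover have "rot d length (pullback (truncate n \<phi>)) X = rot d length (pullback \<phi>) X"
    by (simp add: rot_def pullback_truncate n_def)
  ultimately show "pullback (rot d gdeg \<phi>) X = rot d length (pullback \<phi>) X"
    by simp
qed

lemma Phi_eq_symmetrize:
  assumes "well_shaped \<phi>"
  shows "Phi d \<phi> = symmetrize d length (pullback \<phi>)"
proof
  fix X :: "'a word list list"
  define n where "n = length X"
  have "Phi d (truncate n \<phi>) = symmetrize d length (pullback (truncate n \<phi>))"
    using well_shaped_truncate[OF assms]
  proof (rule well_shaped_induct)
    show "length c = n" if "truncate n \<phi> c \<noteq> 0" for c
      using that by (simp add: truncate_def split: if_splits)
    show "Phi d (cscale a (mono_cochain U)) =
        symmetrize d length (pullback (cscale a (mono_cochain U) :: ('a, 'b) small))"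
      if "length U = n" "truncate n \<phi> (map fst U) \<noteq> 0" for a U
    proof -
      have "U \<noteq> []"
        using that(2) well_shaped_Nil[OF well_shaped_truncate[OF assms], of n] by auto
      then show ?thesis
        by (simp only: Phi_cscale Phi_mono_cochain[OF \<open>U \<noteq> []\<close>] pullback_cscale symmetrize_cscale
            pullback_mono_cochain Phi_mono_def)
    qed
  qed (simp_all add: Phi_add pullback_add symmetrize_add)
  moreover have "symmetrize d length (pullback (truncate n \<phi>)) X = symmetrize d length (pullback \<phi>) X"
    by (rule symmetrize_local[of n]) (simp_all add: pullback_truncate n_def)
  ultimately show "Phi d \<phi> X = symmetrize d length (pullback \<phi>) X"
    using Phi_truncate[of X n d \<phi>] n_def by simp
qed

lemma well_shaped_pullback:
  assumes "well_shaped \<phi>"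
  shows "well_shaped (pullback \<phi>)"
proof (rule well_shapedI)
  show "pullback \<phi> [] = 0"
    by (simp add: pullback_def well_shaped_Nil[OF assms])
  fix X v
  assume "v \<in> keys (pullback \<phi> X)"
  then obtain c where "v \<in> keys (lin_ext (\<lambda>u. Phi_unsym (zip c u) X) (\<phi> c))"
    unfolding pullback_def by (meson keys_sum_in)
  then obtain u where "v \<in> keys (scale (Poly_Mapping.lookup (\<phi> c) u) (Phi_unsym (zip c u) X))"
    unfolding lin_ext_def by (meson keys_sum_in)
  then have "v \<in> keys (Phi_unsym (zip c u) X :: ('a, 'b) tensor)"
    by (rule subsetD[OF keys_scale])
  then show "length v = length X"
    by (rule keys_Phi_unsym)
qed

lemma pullback_invariant:
  assumes "\<phi> \<in> invariants d gdeg"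
  shows "pullback \<phi> \<in> invariants d length"
proof -
  have "well_shaped \<phi>" "rot d gdeg \<phi> = \<phi>"
    using assms by (auto simp only: invariants_iff)
  then show ?thesis
    using well_shaped_pullback pullback_rot[of \<phi> d] by (simp add: invariants_iff)
qed

lemma Phi_invariant:
  fixes \<phi> :: "('x::finite, 'k::field_char_0) small"
  assumes "\<phi> \<in> invariants d gdeg"
  shows "Phi d \<phi> = pullback \<phi>"
  using assms Phi_eq_symmetrize[of \<phi> d] symmetrize_eq[OF pullback_invariant[OF assms]]
  by (simp only: invariants_iff)

text \<open>
  The block of the bar resolution that lifts a generator of the small resolution: \<open>dx\<^sub>j\<close> is the
  class of \<open>1 \<otimes> x\<^sub>j \<otimes> 1\<close>. The word \<open>x\<^sub>j\<close> has a single splitting, so a pullback takes its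
  original value on these blocks.
\<close>

fun generator_block :: "'x gen \<Rightarrow> 'x word list" where
  "generator_block Xi = []"
| "generator_block (Delta j) = [[j]]"

lemma splittings_generator_block:
  "splittings c (generator_block e) = (if e = c then {([], [])} else {})"
  by (cases c; cases e) (auto simp: Cons_eq_append_conv)

lemma msplits_generator_blocks:
  "length U = length c \<Longrightarrow> msplits U (map generator_block c) =
     (if c = map fst U then {replicate (length U) ([], [])} else {})"
proof (induction U arbitrary: c)
  case (Cons y U)
  then obtain e c' where c: "c = e # c'" "length U = length c'"
    by (cases c) auto
  have "msplits (y # U) (map generator_block c) =
      set_Cons (splittings (fst y) (generator_block e)) (msplits U (map generator_block c'))"
    by (simp add: c(1))
  also have "\<dots> = (if c = map fst (y # U) then {replicate (length (y # U)) ([], [])} else {})"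
    unfolding Cons.IH[OF c(2)] splittings_generator_block c(1)
    by (auto simp: set_Cons_def)
  finally show ?case .
qed simp

lemma Phi_unsym_generator_blocks: "Phi_unsym U (map generator_block c) = mono_cochain U c"
proof (cases "length U = length c")
  case False
  then show ?thesis
    by (auto simp: Phi_unsym_def mono_cochain_def)
next
  case True
  have "cyc_act (replicate (length U) []) (map snd U) (replicate (length U) []) = map snd U"
    by (intro nth_equalityI) (auto simp: cyc_act_def)
  moreover have "Phi_unsym U (map generator_block c) =
      (\<Sum>ab\<in>(if c = map fst U then {replicate (length U) ([], [])} else {}).
        single (cyc_act (map fst ab) (map snd U) (map snd ab)) 1)"
    unfolding Phi_unsym_def msplits_generator_blocks[OF True] by (simp only: length_map True refl if_True)
  ultimately show ?thesis
    by (cases "c = map fst U") (simp_all add: mono_cochain_def)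
qed

lemma pullback_generator_blocks:
  assumes "well_shaped \<phi>"
  shows "pullback \<phi> (map generator_block c) = \<phi> c"
proof -
  define n where "n = length c"
  have "\<forall>c. pullback (truncate n \<phi>) (map generator_block c) = truncate n \<phi> c"
    using well_shaped_truncate[OF assms]
  proof (rule well_shaped_induct)
    show "length c = n" if "truncate n \<phi> c \<noteq> 0" for c
      using that by (simp add: truncate_def split: if_splits)
    show "\<forall>c. pullback (cscale a (mono_cochain U)) (map generator_block c) =
        (cscale a (mono_cochain U) c :: ('a, 'b) tensor)" for a U
      unfolding pullback_cscale pullback_mono_cochain
      by (simp add: cscale_def Phi_unsym_generator_blocks)
    show "\<forall>c. pullback 0 (map generator_block c) = (0 :: ('a, 'b) small) c"
      by (metis pullback_zero zero_fun_apply)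
    show "\<forall>c. pullback (\<phi> + \<psi>) (map generator_block c) = (\<phi> + \<psi>) c"
      if "\<forall>c. pullback \<phi> (map generator_block c) = \<phi> c"
        "\<forall>c. pullback \<psi> (map generator_block c) = \<psi> c" for \<phi> \<psi> :: "('a, 'b) small"
      unfolding pullback_add
      using that by (intro allI) (subst (1 2) plus_fun_apply, simp)
  qed
  then show ?thesis
    using pullback_truncate[of "map generator_block c" n \<phi>] by (simp add: n_def truncate_def)
qed

lemma Phi_inj_on:
  "inj_on (Phi d) (invariants d gdeg :: ('x::finite, 'k::field_char_0) small set)"
proof (rule inj_onI)
  fix \<phi> \<psi> :: "('x, 'k) small"
  assume *: "\<phi> \<in> invariants d gdeg" "\<psi> \<in> invariants d gdeg" "Phi d \<phi> = Phi d \<psi>"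
  then have "pullback \<phi> = pullback \<psi>"
    by (simp only: Phi_invariant)
  moreover have "well_shaped \<phi>" "well_shaped \<psi>"
    using * by (auto simp only: invariants_iff)
  ultimately show "\<phi> = \<psi>"
    by (metis pullback_generator_blocks ext)
qed

text \<open>
  The quotient map of resolutions preserves the degree.
\<close>

lemma pullback_nonzero:
  assumes "well_shaped \<phi>" "pullback \<phi> X \<noteq> 0"
  obtains c where "\<phi> c \<noteq> 0" "length c = length X" "total_deg gdeg c = inputs X"
proof -
  obtain c where c: "length c = length X" "lin_ext (\<lambda>u. Phi_unsym (zip c u) X) (\<phi> c) \<noteq> 0"
    using assms(2) unfolding pullback_def by (metis (mono_tags, lifting) mem_Collect_eq sum.not_neutral_contains_not_neutral)
  then obtain u where u: "u \<in> keys (\<phi> c)" "Phi_unsym (zip c u) X \<noteq> (0 :: ('a, 'b) tensor)"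
    unfolding lin_ext_def by (metis (mono_tags, lifting) scale_zero(1) sum.not_neutral_contains_not_neutral)
  have len: "length u = length c"
    using well_shapedD[OF assms(1) u(1)] .
  from u(2) obtain l where "l \<in> msplits (zip c u) X"
    unfolding Phi_unsym_def by (metis (mono_tags, lifting) sum.not_neutral_contains_not_neutral)
  then have "inputs X = mdeg (zip c u)"
    using c(1) len by (intro msplits_total_deg) auto
  then show ?thesis
    using c u(1) len by (intro that[of c]) (auto simp: mdeg_def in_keys_iff)
qed

lemma Phi_homogeneous:
  fixes \<phi> :: "('x::finite, 'k::field_char_0) small"
  assumes "\<phi> \<in> invariants d gdeg" "homogeneous gdeg N n \<phi>"
  shows "homogeneous length N n (Phi d \<phi>)"
  unfolding homogeneous_def
proof (intro allI impI)
  fix X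
  assume "Phi d \<phi> X \<noteq> 0"
  then have "pullback \<phi> X \<noteq> 0"
    unfolding Phi_invariant[OF assms(1)] .
  moreover have "well_shaped \<phi>"
    using assms(1) by (simp only: invariants_iff)
  ultimately obtain c where "\<phi> c \<noteq> 0" "length c = length X" "total_deg gdeg c = inputs X"
    using pullback_nonzero by blast
  then show "length X = N \<and> inputs X = int n"
    using assms(2) by (simp add: homogeneous_def)
qed

lemma cyc_mono_invariant: "U \<noteq> [] \<Longrightarrow> cyc_mono d U \<in> invariants d gdeg"
  unfolding cyc_mono_eq by (intro symmetrize_invariant well_shaped_mono_cochain)

lemma rot_power_support:
  assumes "\<And>X. f X \<noteq> 0 \<Longrightarrow> Q X" "\<And>X. Q (rotr X) \<Longrightarrow> Q X" "(rot d deg ^^ s) f X \<noteq> 0"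
  shows "Q X"
  using assms(3)
proof (induction s arbitrary: X)
  case 0
  then show ?case
    by (simp add: assms(1))
next
  case (Suc s)
  then have "(rot d deg ^^ s) f (rotr X) \<noteq> 0"
    by (auto simp: rot_def[of d deg "(rot d deg ^^ s) f"])
  then show ?case
    by (rule assms(2)[OF Suc.IH])
qed

lemma symmetrize_support:
  assumes "\<And>X. f X \<noteq> 0 \<Longrightarrow> Q X" "\<And>X. Q (rotr X) \<Longrightarrow> Q X" "symmetrize d deg f X \<noteq> 0"
  shows "Q X"
proof -
  obtain s where "(rot d deg ^^ s) f X \<noteq> 0"
    using assms(3) unfolding symmetrize_def
    by (metis (no_types, lifting) scale_zero(1) sum.neutral)
  with assms(1,2) show ?thesis
    by (rule rot_power_support)
qed

lemma cyc_mono_support: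
  assumes "cyc_mono d U c \<noteq> 0"
  shows "length c = length U \<and> total_deg gdeg c = mdeg U"
  using _ _ assms unfolding cyc_mono_eq
  by (rule symmetrize_support) (auto simp: mono_cochain_def mdeg_def split: if_splits)

lemma cyc_mono_in_zeta: "U \<noteq> [] \<Longrightarrow> cyc_mono d U \<in> zeta d"
  using cyc_mono_invariant[of U d]
  by (auto simp: zeta_def zeta_prod_def dest: cyc_mono_support intro!: exI[of _ "length U"])

lemma Phi_cyc_mono:
  assumes "U \<noteq> []"
  shows "Phi d (cyc_mono d U :: ('x::finite, 'k::field_char_0) small) = Phi_mono d U"
proof -
  let ?m = "mono_cochain U :: ('x, 'k) small"
  have "Phi d (symmetrize d gdeg ?m) = pullback (symmetrize d gdeg ?m)"
    using assms by (intro Phi_invariant symmetrize_invariant well_shaped_mono_cochain)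
  also have "\<dots> = symmetrize d length (pullback ?m)"
  proof
    fix X :: "'x word list list"
    have power: "pullback ((rot d gdeg ^^ s) ?m) = (rot d length ^^ s) (pullback ?m)" for s
      by (induction s)
        (simp_all add: pullback_rot well_shaped_rot_power well_shaped_mono_cochain assms)
    have "pullback (symmetrize d gdeg ?m) X =
        scale (1 / of_nat (length X)) (\<Sum>s<length X. pullback ((rot d gdeg ^^ s) ?m) X)"
      by (simp add: pullback_def symmetrize_def lin_ext_scale lin_ext_sum scale_sum
          sum.swap[of _ "{..<length X}"])
    then show "pullback (symmetrize d gdeg ?m) X = symmetrize d length (pullback ?m) X"
      by (simp add: power symmetrize_def)
  qed
  finally show ?thesis
    by (simp add: cyc_mono_eq Phi_mono_def pullback_mono_cochain)
qed

section \<open>Compatibility with the differentials\<close>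

text \<open>
  The terms of \<open>dw = \<Sum> a dx\<^sub>j b\<close> together with the letter they belong to.
\<close>

definition all_splittings :: "'x word list \<Rightarrow> ('x gen \<times> 'x word \<times> 'x word) set" where
  "all_splittings B = Sigma UNIV (\<lambda>c. splittings c B)"

abbreviation splits :: "'x word list list \<Rightarrow> ('x gen \<times> 'x word \<times> 'x word) list set" where
  "splits X \<equiv> listset (map all_splittings X)"

abbreviation letters :: "('x gen \<times> 'x word \<times> 'x word) list \<Rightarrow> 'x gen list" where
  "letters S \<equiv> map fst S"

abbreviation lefts :: "('x gen \<times> 'x word \<times> 'x word) list \<Rightarrow> 'x word list" where
  "lefts S \<equiv> map (fst \<circ> snd) S"

abbreviation rights :: "('x gen \<times> 'x word \<times> 'x word) list \<Rightarrow> 'x word list" where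
  "rights S \<equiv> map (snd \<circ> snd) S"

lemma sum_all_splittings:
  "(\<Sum>s\<in>all_splittings B. F s) = (\<Sum>c\<in>UNIV. \<Sum>s\<in>splittings c B. F (c, s))"
  for F :: "('x::finite gen \<times> _) \<Rightarrow> _"
  unfolding all_splittings_def using finite_UNIV_gen by (subst sum.Sigma) auto

lemma sum_letters_splits:
  fixes X :: "'x::finite word list list"
  shows "(\<Sum>c | length c = length X. \<Sum>ab\<in>listset (map2 splittings c X). H c ab) =
    (\<Sum>S\<in>splits X. H (letters S) (map snd S))"
proof (induction X arbitrary: H)
  case Nil
  then show ?case by simp
next
  case (Cons B X)
  let ?C = "{c :: 'x gen list. length c = length X}"
  have C: "{c :: 'x gen list. length c = length (B # X)} = (\<lambda>(y, c). y # c) ` (UNIV \<times> ?C)"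
    by (auto simp: length_Suc_conv)
  have "inj_on (\<lambda>(y, c). y # c) (UNIV \<times> ?C)"
    by (auto simp: inj_on_def)
  then have "(\<Sum>c | length c = length (B # X). \<Sum>ab\<in>listset (map2 splittings c (B # X)). H c ab) =
      (\<Sum>y\<in>UNIV. \<Sum>c\<in>?C. \<Sum>ab\<in>listset (splittings y B # map2 splittings c X). H (y # c) ab)"
    unfolding C by (simp add: sum.reindex case_prod_unfold sum.cartesian_product del: listset.simps)
  also have "\<dots> = (\<Sum>y\<in>UNIV. \<Sum>s\<in>splittings y B. \<Sum>c\<in>?C. \<Sum>ab\<in>listset (map2 splittings c X). H (y # c) (s # ab))"
    by (simp only: sum_listset_Cons sum.swap[of _ ?C])
  also have "\<dots> = (\<Sum>s\<in>all_splittings B. \<Sum>S\<in>splits X. H (fst s # letters S) (snd s # map snd S))"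
    by (simp only: Cons.IH sum_all_splittings fst_conv snd_conv)
  also have "\<dots> = (\<Sum>S\<in>splits (B # X). H (letters S) (map snd S))"
    by (simp only: list.map sum_listset_Cons)
  finally show ?case .
qed

lemma splits_length: "S \<in> splits X \<Longrightarrow> length S = length X"
  by (drule listset_length) simp

lemma splits_total_deg: "S \<in> splits X \<Longrightarrow> total_deg gdeg (letters S) = inputs X"
proof (induction X arbitrary: S)
  case (Cons B X)
  then obtain s S' where "S = s # S'" "s \<in> all_splittings B" "S' \<in> splits X"
    by (auto simp: set_Cons_def)
  moreover from this have "length B = gdeg (fst s)"
    by (auto simp: all_splittings_def dest: splittings_length)
  ultimately show ?case
    using Cons.IH[of S'] by simp
qed simp

lemma bimod_add: "bimod as bs (p + q) = bimod as bs p + bimod as bs q"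
  by (simp add: bimod_def lin_map_add)

lemma bimod_sum: "bimod as bs (sum f I) = (\<Sum>i\<in>I. bimod as bs (f i))"
  by (simp add: bimod_def lin_map_sum)

lemma bimod_scale: "bimod as bs (scale a p) = scale a (bimod as bs p)"
  by (simp add: bimod_def lin_map_scale)

lemma bimod_diff: "bimod as bs (p - q) = bimod as bs p - bimod as bs q"
  using bimod_add[of as bs "p - q" q] by simp

lemma bimod_zero [simp]: "bimod as bs 0 = 0"
  by (simp add: bimod_def)

text \<open>
  Summing over the letters together with the splittings brings the pullback into the form of a
  composition of bimodule homomorphisms.
\<close>

lemma pullback_splits:
  assumes "well_shaped \<phi>"
  shows "pullback \<phi> X = (\<Sum>S\<in>splits X. bimod (lefts S) (rights S) (\<phi> (letters S)))"
proof -
  have "lin_ext (\<lambda>u. Phi_unsym (zip c u) X) (\<phi> c) =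
      (\<Sum>ab\<in>listset (map2 splittings c X). bimod (map fst ab) (map snd ab) (\<phi> c))"
    if "length c = length X" for c
  proof -
    have "lin_ext (\<lambda>u. Phi_unsym (zip c u) X) (\<phi> c) =
      lin_ext (\<lambda>u. \<Sum>ab\<in>listset (map2 splittings c X).
        single (cyc_act (map fst ab) u (map snd ab)) 1) (\<phi> c)"
      using that by (intro lin_ext_cong) (simp add: Phi_unsym_def well_shapedD[OF assms])
    then show ?thesis
      by (simp add: lin_ext_fun_sum bimod_def lin_map_def)
  qed
  then have "pullback \<phi> X = (\<Sum>c | length c = length X. \<Sum>ab\<in>listset (map2 splittings c X).
      bimod (map fst ab) (map snd ab) (\<phi> c))"
    by (simp add: pullback_def)
  then show ?thesis
    by (simp only: sum_letters_splits map_map)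
qed

lemma cyc_act_cyc_act:
  assumes "length as = n" "length as' = n" "length bs = n" "length bs' = n" "length v = n"
  shows "cyc_act as (cyc_act as' v bs') bs = cyc_act (map2 (@) as as') v (map2 (@) bs' bs)"
  using assms by (intro nth_equalityI) (auto simp: cyc_act_def nth_rotate1)

lemma bimod_bimod:
  assumes "length as = n" "length as' = n" "length bs = n" "length bs' = n"
    and "\<And>v. v \<in> keys t \<Longrightarrow> length v = n"
  shows "bimod as bs (bimod as' bs' t) = bimod (map2 (@) as as') (map2 (@) bs' bs) t"
  unfolding bimod_def lin_map_lin_map using assms by (intro lin_map_cong cyc_act_cyc_act) auto

text \<open>
  The unit of a tensor power with one factor replaced by a word: multiplication by it only affects
  one block.
\<close>

definition slot :: "nat \<Rightarrow> 'x word \<Rightarrow> nat \<Rightarrow> 'x word list" where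
  "slot p w q = replicate p [] @ w # replicate q []"

lemma length_slot [simp]: "length (slot p w q) = Suc (p + q)"
  by (simp add: slot_def)

lemma map2_append_replicate_Nil:
  "map2 (@) (replicate (length as) []) as = as" "map2 (@) as (replicate (length as) []) = as"
  by (induction as) auto

lemma map2_slot:
  assumes "length as = p" "length bs = q"
  shows "map2 (@) (slot p w q) (as @ a # bs) = as @ (w @ a) # bs"
    "map2 (@) (as @ a # bs) (slot p w q) = as @ (a @ w) # bs"
  using assms by (auto simp: slot_def map2_append_replicate_Nil)

text \<open>
  The pullback with one block replaced by the element \<open>a c b\<close> of the small resolution. Both
  differentials act on a single block and become identities between such sums.
\<close>

definition slot_sum ::
    "('x::finite, 'k::field) small \<Rightarrow> 'x word list list \<Rightarrow> 'x word list list \<Rightarrow>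
      'x gen \<Rightarrow> 'x word \<Rightarrow> 'x word \<Rightarrow> ('x, 'k) tensor" where
  "slot_sum \<phi> P Q c a b = (\<Sum>S\<in>splits P. \<Sum>T\<in>splits Q.
     bimod (lefts S @ a # lefts T) (rights S @ b # rights T) (\<phi> (letters S @ c # letters T)))"

lemma sum_splits_append:
  "(\<Sum>S\<in>splits (P @ B # Q). F S) =
     (\<Sum>s\<in>all_splittings B. \<Sum>S\<in>splits P. \<Sum>T\<in>splits Q. F (S @ s # T))"
  by (simp only: map_append list.map sum_listset_append sum_listset_Cons
      sum.swap[of _ "all_splittings B"])

lemma pullback_slot:
  assumes "well_shaped \<phi>"
  shows "pullback \<phi> (P @ B # Q) = (\<Sum>(c, a, b)\<in>all_splittings B. slot_sum \<phi> P Q c a b)"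
  unfolding pullback_splits[OF assms] sum_splits_append
  by (simp add: slot_sum_def case_prod_unfold)

lemma bimod_slot_sum:
  assumes "well_shaped \<phi>"
  shows "bimod (slot (length P) w (length Q)) (slot (length P) w' (length Q)) (slot_sum \<phi> P Q c a b) =
    slot_sum \<phi> P Q c (w @ a) (b @ w')"
  unfolding slot_sum_def bimod_sum
proof (intro sum.cong refl)
  fix S T
  assume "S \<in> splits P" "T \<in> splits Q"
  then have len: "length S = length P" "length T = length Q"
    by (auto dest: splits_length)
  show "bimod (slot (length P) w (length Q)) (slot (length P) w' (length Q))
      (bimod (lefts S @ a # lefts T) (rights S @ b # rights T) (\<phi> (letters S @ c # letters T))) =
    bimod (lefts S @ (w @ a) # lefts T) (rights S @ (b @ w') # rights T) (\<phi> (letters S @ c # letters T))"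
    using len by (subst bimod_bimod[of _ "Suc (length P + length Q)"])
      (auto simp: map2_slot dest: well_shapedD[OF assms])
qed

lemma sum_splittings_word:
  "(\<Sum>(p, q)\<in>splittings c [w]. F p q) =
     (\<Sum>k | k < length w \<and> c = Delta (w ! k). F (take k w) (drop (Suc k) w))"
proof (cases c)
  case Xi
  then show ?thesis by simp
next
  case (Delta j)
  let ?K = "{k. k < length w \<and> c = Delta (w ! k)}"
  have "splittings c [w] = (\<lambda>k. (take k w, drop (Suc k) w)) ` ?K"
  proof
    show "splittings c [w] \<subseteq> (\<lambda>k. (take k w, drop (Suc k) w)) ` ?K"
    proof
      fix s
      assume "s \<in> splittings c [w]"
      then obtain a b where "s = (a, b)" "w = a @ [j] @ b"
        using Delta by auto
      then show "s \<in> (\<lambda>k. (take k w, drop (Suc k) w)) ` ?K"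
        using Delta by (intro image_eqI[of _ _ "length a"]) auto
    qed
    show "(\<lambda>k. (take k w, drop (Suc k) w)) ` ?K \<subseteq> splittings c [w]"
      using Delta by (auto simp: id_take_nth_drop)
  qed
  moreover have "inj_on (\<lambda>k. (take k w, drop (Suc k) w)) ?K"
  proof (rule inj_onI)
    fix k l
    assume *: "k \<in> ?K" "l \<in> ?K" "(take k w, drop (Suc k) w) = (take l w, drop (Suc l) w)"
    then have "length (take k w) = length (take l w)"
      by simp
    then show "k = l"
      using *(1,2) by simp
  qed
  ultimately show ?thesis
    by (simp add: sum.reindex case_prod_unfold)
qed

lemma sum_all_splittings_word:
  fixes F :: "'x::finite gen \<times> 'x word \<times> 'x word \<Rightarrow> 'c::comm_monoid_add"
  shows "(\<Sum>s\<in>all_splittings [w]. F s) = (\<Sum>k<length w. F (Delta (w ! k), take k w, drop (Suc k) w))"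
proof -
  let ?F = "\<lambda>c k. F (c, take k w, drop (Suc k) w)"
  have "(\<Sum>s\<in>splittings c [w]. F (c, s)) = (\<Sum>k<length w. if c = Delta (w ! k) then ?F c k else 0)" for c
    using sum_splittings_word[of "\<lambda>a b. F (c, a, b)" c w]
    by (simp add: sum.If_cases lessThan_def Collect_conj_eq Int_commute)
  then have "(\<Sum>s\<in>all_splittings [w]. F s) =
      (\<Sum>k<length w. \<Sum>c\<in>UNIV. if c = Delta (w ! k) then ?F c k else 0)"
    unfolding sum_all_splittings by (simp only: sum.swap[of _ UNIV])
  then show ?thesis
    by (simp add: finite_UNIV_gen)
qed

lemma all_splittings_Nil: "all_splittings [] = {(Xi, [], [])}"
proof -
  have "splittings c ([] :: 'a word list) = (if c = Xi then {([], [])} else {})" for c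
    by (cases c) auto
  then show ?thesis
    by (auto simp: all_splittings_def split: if_splits)
qed

lemma all_splittings_long: "length B \<ge> 2 \<Longrightarrow> all_splittings B = {}"
  by (auto simp: all_splittings_def dest!: splittings_length) (metis One_nat_def gdeg.elims
      not_numeral_le_zero numeral_le_one_iff semiring_norm(69))

lemma pullback_long_block:
  "well_shaped \<phi> \<Longrightarrow> length B \<ge> 2 \<Longrightarrow> pullback \<phi> (P @ B # Q) = 0"
  by (simp add: pullback_slot all_splittings_long)

text \<open>
  The part of the differential that acts on the block \<open>B\<close> standing between \<open>P\<close> and \<open>Q\<close>.
\<close>

definition hochschild_term ::
    "('x, 'k::field) operation \<Rightarrow> 'x word list list \<Rightarrow> 'x word list \<Rightarrow> 'x word list list \<Rightarrow> ('x, 'k) tensor" where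
  "hochschild_term f P B Q = (if B = [] then 0 else \<Sum>k\<le>length B.
     let ys = merge k ([[]] @ B @ [[]])
     in scale (ksign (inputs P + int k + 1))
          (bimod (slot (length P) (hd ys) (length Q)) (slot (length P) (last ys) (length Q))
            (f (P @ butlast (tl ys) # Q))))"

lemma hom_ext_slot:
  "hom_ext f ((map (\<lambda>B. [[]] @ B @ [[]]) (P @ B # Q))[length P := ys]) =
     bimod (slot (length P) (hd ys) (length Q)) (slot (length P) (last ys) (length Q))
       (f (P @ butlast (tl ys) # Q))"
  by (simp add: hom_ext_def slot_def comp_def map_replicate_const list_update_append)

lemma hochschild_diff_terms:
  "hochschild_diff f X = (\<Sum>i<length X. hochschild_term f (take i X) (X ! i) (drop (Suc i) X))"
proof -
  let ?Ys = "map (\<lambda>B. [[]] @ B @ [[]]) X"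
  have slot_term: "hochschild_term f (take i X) (X ! i) (drop (Suc i) X) =
      (\<Sum>k\<le>length (X ! i). scale (ksign (inputs (take i X) + int k + 1))
        (hom_ext f (?Ys[i := merge k (?Ys ! i)])))" if "i < length X" "X ! i \<noteq> []" for i
  proof -
    define P B Q where "P = take i X" "B = X ! i" "Q = drop (Suc i) X"
    have X: "X = P @ B # Q" and i: "i = length P"
      using that by (simp_all add: P_B_Q_def id_take_nth_drop)
    have nth: "?Ys ! i = [[]] @ B @ [[]]"
      by (simp add: X i nth_append)
    have "hom_ext f (?Ys[i := ys]) =
      bimod (slot (length P) (hd ys) (length Q)) (slot (length P) (last ys) (length Q))
       (f (P @ butlast (tl ys) # Q))" for ys
      unfolding X i by (rule hom_ext_slot)
    then show ?thesis
      using that(2) unfolding nth hochschild_term_def P_B_Q_def[symmetric] by (simp add: Let_def)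
  qed
  have "hochschild_diff f X = (\<Sum>i | i < length X \<and> X ! i \<noteq> [].
      hochschild_term f (take i X) (X ! i) (drop (Suc i) X))"
    unfolding hochschild_diff_def Let_def
    by (intro sum.cong refl) (rule slot_term[symmetric], simp_all)
  also have "\<dots> = (\<Sum>i<length X. hochschild_term f (take i X) (X ! i) (drop (Suc i) X))"
    by (intro sum.mono_neutral_left) (auto simp: hochschild_term_def)
  finally show ?thesis .
qed

fun zeta_term :: "('x, 'k::field) small \<Rightarrow> 'x gen list \<Rightarrow> 'x gen \<Rightarrow> 'x gen list \<Rightarrow> ('x, 'k) tensor" where
  "zeta_term \<phi> P Xi Q = 0"
| "zeta_term \<phi> P (Delta j) Q = scale (ksign (total_deg gdeg P))
     (bimod (slot (length P) [] (length Q)) (slot (length P) [j] (length Q)) (\<phi> (P @ Xi # Q))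
      - bimod (slot (length P) [j] (length Q)) (slot (length P) [] (length Q)) (\<phi> (P @ Xi # Q)))"

lemma replicate_slot: "replicate (Suc (p + q)) [] = slot p [] q"
  by (simp add: slot_def replicate_add[symmetric] flip: replicate_Suc)

lemma slot_update: "(slot p [] q)[p := w] = slot p w q"
  by (simp add: slot_def list_update_append)

lemma zeta_diff_terms:
  "zeta_diff \<phi> c = (\<Sum>i<length c. zeta_term \<phi> (take i c) (c ! i) (drop (Suc i) c))"
  unfolding zeta_diff_def Let_def
proof (intro sum.cong refl)
  fix i
  assume "i \<in> {..<length c}"
  then have i: "i < length c"
    by simp
  define P y Q where "P = take i c" "y = c ! i" "Q = drop (Suc i) c"
  have c: "c = P @ y # Q" and i: "i = length P"
    using i by (simp_all add: P_y_Q_def id_take_nth_drop)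
  have one: "replicate (length c) [] = slot (length P) ([] :: 'a word) (length Q)"
    by (simp add: c replicate_slot del: replicate_Suc)
  show "(case c ! i of Xi \<Rightarrow> 0
        | Delta j \<Rightarrow> scale (ksign (total_deg gdeg (take i c)))
            (bimod (replicate (length c) []) ((replicate (length c) [])[i := [j]]) (\<phi> (c[i := Xi]))
             - bimod ((replicate (length c) [])[i := [j]]) (replicate (length c) []) (\<phi> (c[i := Xi])))) =
     zeta_term \<phi> (take i c) (c ! i) (drop (Suc i) c)"
    unfolding one P_y_Q_def[symmetric]
    by (cases y) (simp_all add: c i slot_update list_update_append)
qed

lemma keys_bimod:
  assumes "v \<in> keys (bimod as bs t)"
    and "length as = n" "length bs = n" "\<And>v. v \<in> keys t \<Longrightarrow> length v = n"
  shows "length v = n"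
  using subsetD[OF keys_lin_map assms(1)[unfolded bimod_def]] assms(2-) by (auto simp: cyc_act_def)

lemma keys_zeta_term:
  assumes "well_shaped \<phi>" "v \<in> keys (zeta_term \<phi> P y Q)"
  shows "length v = Suc (length P + length Q)"
proof (cases y)
  case Xi
  with assms show ?thesis by simp
next
  case (Delta j)
  let ?t = "\<phi> (P @ Xi # Q)"
  let ?s = "\<lambda>w. slot (length P) w (length Q)"
  have t: "length v = Suc (length P + length Q)" if "v \<in> keys ?t" for v
    using well_shapedD[OF assms(1) that] by simp
  have "v \<in> keys (bimod (?s []) (?s [j]) ?t - bimod (?s [j]) (?s []) ?t)"
    using subsetD[OF keys_scale] assms(2) Delta by auto
  then have "v \<in> keys (bimod (?s []) (?s [j]) ?t) \<or> v \<in> keys (bimod (?s [j]) (?s []) ?t)"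
    by (meson Poly_Mapping.keys_diff UnE subsetD)
  then show ?thesis
    by (rule disjE) (erule keys_bimod[where n = "Suc (length P + length Q)"]; simp add: t)+
qed

lemma well_shaped_zeta_diff:
  assumes "well_shaped \<phi>"
  shows "well_shaped (zeta_diff \<phi>)"
proof (rule well_shapedI)
  show "zeta_diff \<phi> [] = 0"
    by (simp add: zeta_diff_terms)
  fix c v
  assume "v \<in> keys (zeta_diff \<phi> c)"
  then obtain i where i: "i < length c"
    "v \<in> keys (zeta_term \<phi> (take i c) (c ! i) (drop (Suc i) c))"
    unfolding zeta_diff_terms by (meson keys_sum_in lessThan_iff)
  then show "length v = length c"
    using keys_zeta_term[OF assms i(2)] by simp
qed

lemma rotate1_bimod:
  assumes "length as = Suc n" "length bs = Suc n" "\<And>v. v \<in> keys t \<Longrightarrow> length v = Suc n"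
  shows "lin_map rotate1 (bimod as bs t) = bimod (rotate1 as) (rotate1 bs) (lin_map rotate1 t)"
proof -
  have "rotate1 (cyc_act as v bs) = cyc_act (rotate1 as) (rotate1 v) (rotate1 bs)"
    if "v \<in> keys t" for v
    using assms(1,2) assms(3)[OF that]
    by (auto simp: length_Suc_conv cyc_act_rotate1)
  then show ?thesis
    unfolding bimod_def lin_map_lin_map by (rule lin_map_cong)
qed

text \<open>
  In the following two lemmas the Koszul sign of the rotation and that of the differential are
  exchanged. When the rotated letter \<open>x\<close> is the one on which the differential acts, it becomes \<open>\<xi>\<close> and
  passes the other letters without sign; this is made up for by the sign of the differential at the new
  position.
\<close>

lemma zeta_term_rotate_other:
  assumes "\<phi> \<in> invariants d gdeg"
  shows "scale (ksign (int (gdeg x) * total_deg gdeg (P @ y # Q) + (d - 1) * int (length (P @ y # Q))))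
      (lin_map rotate1 (zeta_term \<phi> (x # P) y Q)) = zeta_term \<phi> P y (Q @ [x])"
proof (cases y)
  case Xi
  then show ?thesis by simp
next
  case (Delta j)
  have ws: "well_shaped \<phi>" and inv: "rot d gdeg \<phi> = \<phi>"
    using assms by (simp_all only: invariants_iff)
  let ?t = "\<phi> (x # P @ Xi # Q)"
  let ?e = "int (gdeg x) * total_deg gdeg (P @ Xi # Q) + (d - 1) * int (length (P @ Xi # Q))"
  have t: "length v = Suc (Suc (length P + length Q))" if "v \<in> keys ?t" for v
    using well_shapedD[OF ws that] by simp
  have rot: "rotate1 (slot (Suc (length P)) w (length Q)) = slot (length P) w (Suc (length Q))" for w
    by (simp add: slot_def replicate_append_same)
  have phi: "\<phi> (P @ Xi # Q @ [x]) = scale (ksign ?e) (lin_map rotate1 ?t)"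
    using fun_cong[OF inv, of "(P @ Xi # Q) @ [x]"] unfolding rot_snoc by simp
  have b: "lin_map rotate1 (bimod (slot (Suc (length P)) w (length Q)) (slot (Suc (length P)) w' (length Q)) ?t) =
      bimod (slot (length P) w (Suc (length Q))) (slot (length P) w' (Suc (length Q))) (lin_map rotate1 ?t)" for w w'
    unfolding rot[symmetric] by (rule rotate1_bimod[of _ "Suc (length P + length Q)"]) (simp_all add: t)
  define e where "e = ?e"
  define D where "D = bimod (slot (length P) [] (Suc (length Q))) (slot (length P) [j] (Suc (length Q))) (lin_map rotate1 ?t)
     - bimod (slot (length P) [j] (Suc (length Q))) (slot (length P) [] (Suc (length Q))) (lin_map rotate1 ?t)"
  have "lin_map rotate1 (zeta_term \<phi> (x # P) y Q) = scale (ksign (total_deg gdeg (x # P))) D"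
    by (simp add: Delta b lin_map_scale lin_map_diff D_def)
  moreover have "zeta_term \<phi> P y (Q @ [x]) = scale (ksign (total_deg gdeg P) * ksign e) D"
    unfolding Delta zeta_term.simps phi e_def[symmetric] bimod_scale scale_diff[symmetric] scale_scale D_def
    by simp
  moreover have "ksign (int (gdeg x) * total_deg gdeg (P @ y # Q) + (d - 1) * int (length (P @ y # Q))) *
      ksign (total_deg gdeg (x # P)) = (ksign (total_deg gdeg P) * ksign e :: 'b)"
    unfolding ksign_add[symmetric] e_def by (rule ksign_cong) (simp add: Delta algebra_simps)
  ultimately show ?thesis
    by (simp only: scale_scale)
qed

lemma zeta_term_rotate_self:
  assumes "\<phi> \<in> invariants d gdeg"
  shows "scale (ksign (int (gdeg x) * total_deg gdeg P + (d - 1) * int (length P)))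
      (lin_map rotate1 (zeta_term \<phi> [] x P)) = zeta_term \<phi> P x []"
proof (cases x)
  case Xi
  then show ?thesis by simp
next
  case (Delta j)
  have ws: "well_shaped \<phi>" and inv: "rot d gdeg \<phi> = \<phi>"
    using assms by (simp_all only: invariants_iff)
  let ?t = "\<phi> (Xi # P)"
  have t: "length v = Suc (length P)" if "v \<in> keys ?t" for v
    using well_shapedD[OF ws that] by simp
  have rot: "rotate1 (slot 0 w (length P)) = slot (length P) w 0" for w
    by (simp add: slot_def)
  have phi: "\<phi> (P @ [Xi]) = scale (ksign ((d - 1) * int (length P))) (lin_map rotate1 ?t)"
    using fun_cong[OF inv, of "P @ [Xi]"] unfolding rot_snoc by simp
  have b: "lin_map rotate1 (bimod (slot 0 w (length P)) (slot 0 w' (length P)) ?t) =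
      bimod (slot (length P) w 0) (slot (length P) w' 0) (lin_map rotate1 ?t)" for w w'
    unfolding rot[symmetric] by (rule rotate1_bimod[of _ "length P"]) (simp_all add: t)
  show ?thesis
    using Delta by (simp add: b bimod_scale lin_map_diff phi lin_map_scale ksign_add flip: scale_diff)
qed

lemma zeta_diff_invariant:
  assumes "\<phi> \<in> invariants d gdeg"
  shows "zeta_diff \<phi> \<in> invariants d gdeg"
proof -
  have ws: "well_shaped \<phi>"
    using assms by (simp only: invariants_iff)
  have "rot d gdeg (zeta_diff \<phi>) c = zeta_diff \<phi> c" for c
  proof (cases c rule: rev_cases)
    case Nil
    then show ?thesis
      by (simp add: rot_Nil zeta_diff_terms)
  next
    case (snoc P x)
    let ?e = "int (gdeg x) * total_deg gdeg P + (d - 1) * int (length P)"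
    have "rot d gdeg (zeta_diff \<phi>) c = scale (ksign ?e) (lin_map rotate1 (zeta_term \<phi> [] x P
        + (\<Sum>i<length P. zeta_term \<phi> (x # take i P) (P ! i) (drop (Suc i) P))))"
      by (simp add: snoc rot_snoc zeta_diff_terms sum.lessThan_Suc_shift del: sum.lessThan_Suc)
    also have "\<dots> = zeta_term \<phi> P x [] + (\<Sum>i<length P. scale (ksign ?e)
        (lin_map rotate1 (zeta_term \<phi> (x # take i P) (P ! i) (drop (Suc i) P))))"
      by (simp only: lin_map_add lin_map_sum scale_add scale_sum zeta_term_rotate_self[OF assms])
    also have "(\<Sum>i<length P. scale (ksign ?e)
        (lin_map rotate1 (zeta_term \<phi> (x # take i P) (P ! i) (drop (Suc i) P)))) =
      (\<Sum>i<length P. zeta_term \<phi> (take i P) (P ! i) (drop (Suc i) P @ [x]))"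
    proof (intro sum.cong refl)
      fix i
      assume "i \<in> {..<length P}"
      then have P: "take i P @ P ! i # drop (Suc i) P = P"
        by (simp add: id_take_nth_drop[symmetric])
      show "scale (ksign ?e) (lin_map rotate1 (zeta_term \<phi> (x # take i P) (P ! i) (drop (Suc i) P))) =
          zeta_term \<phi> (take i P) (P ! i) (drop (Suc i) P @ [x])"
        using zeta_term_rotate_other[OF assms, of x "take i P" "P ! i" "drop (Suc i) P"] unfolding P .
    qed
    also have "zeta_term \<phi> P x [] + \<dots> = zeta_diff \<phi> c"
      by (simp add: snoc zeta_diff_terms nth_append)
    finally show ?thesis .
  qed
  then show ?thesis
    using well_shaped_zeta_diff[OF ws] by (simp add: invariants_iff fun_eq_iff)
qed

lemma zeta_term_splits:
  assumes "well_shaped \<phi>"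
  shows "(\<Sum>S\<in>splits P. \<Sum>T\<in>splits Q.
      bimod (lefts S @ a # lefts T) (rights S @ b # rights T) (zeta_term \<phi> (letters S) (Delta j) (letters T))) =
    scale (ksign (inputs P)) (slot_sum \<phi> P Q Xi a (j # b) - slot_sum \<phi> P Q Xi (a @ [j]) b)"
proof -
  let ?t = "\<lambda>S T. \<phi> (letters S @ Xi # letters T)"
  have "bimod (lefts S @ a # lefts T) (rights S @ b # rights T) (zeta_term \<phi> (letters S) (Delta j) (letters T)) =
     scale (ksign (inputs P)) (bimod (lefts S @ a # lefts T) (rights S @ (j # b) # rights T) (?t S T)
       - bimod (lefts S @ (a @ [j]) # lefts T) (rights S @ b # rights T) (?t S T))"
    if "S \<in> splits P" "T \<in> splits Q" for S T
  proof -
    have "length v = Suc (length S + length T)" if "v \<in> keys (?t S T)" for v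
      using well_shapedD[OF assms that] by simp
    then have "bimod (lefts S @ a # lefts T) (rights S @ b # rights T)
        (bimod (slot (length S) w (length T)) (slot (length S) w' (length T)) (?t S T)) =
      bimod (lefts S @ (a @ w) # lefts T) (rights S @ (w' @ b) # rights T) (?t S T)" for w w'
      by (subst bimod_bimod[of _ "Suc (length S + length T)"]) (auto simp: map2_slot)
    then show ?thesis
      using splits_total_deg[OF that(1)] by (simp add: bimod_scale bimod_diff)
  qed
  then show ?thesis
    by (simp add: slot_sum_def scale_sum sum_subtractf scale_diff)
qed

lemma sum_lessThan_add: "(\<Sum>k<m + n. f k) = (\<Sum>k<m. f k) + (\<Sum>k<n. f (m + k))"
  for f :: "nat \<Rightarrow> 'c::comm_monoid_add"
  by (induction n) (simp_all add: add.assoc)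

text \<open>
  The quotient map of resolutions is a chain map. The four cases are a block without words, whose
  differential vanishes on both sides; a block \<open>w\<close>, where the sum over the splittings of \<open>w\<close>
  telescopes; a block \<open>w\<^sub>1, w\<^sub>2\<close>, where the Leibniz rule makes the left side vanish; and longer
  blocks, whose faces have at least two words.
\<close>

lemma hochschild_term_pullback:
  fixes \<phi> :: "('x::finite, 'k::field) small"
  assumes "well_shaped \<phi>"
  shows "hochschild_term (pullback \<phi>) P B Q =
    (\<Sum>(c, a, b)\<in>all_splittings B. \<Sum>S\<in>splits P. \<Sum>T\<in>splits Q.
      bimod (lefts S @ a # lefts T) (rights S @ b # rights T) (zeta_term \<phi> (letters S) c (letters T)))"
proof -
  let ?s = "\<lambda>w. slot (length P) w (length Q)"
  let ?G = "slot_sum \<phi> P Q"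
  let ?e = "ksign (inputs P) :: 'k"
  have neg: "ksign (inputs P + 1) = - ?e" "ksign (inputs P + 2) = ?e" "ksign (inputs P + 3) = - ?e"
    by (simp_all add: ksign_def)
  consider "B = []" | w where "B = [w]" | w1 w2 where "B = [w1, w2]" | "length B \<ge> 3"
    by (cases B rule: remdups_adj.cases) (auto, metis One_nat_def Suc_le_mono length_Cons le_add1 list.exhaust list.size(3) numeral_3_eq_3 plus_1_eq_Suc)
  then show ?thesis
  proof cases
    case 1
    then show ?thesis
      by (simp add: hochschild_term_def all_splittings_Nil)
  next
    case (2 w)
    have "hochschild_term (pullback \<phi>) P B Q =
        scale ?e (bimod (?s []) (?s w) (pullback \<phi> (P @ [] # Q)) - bimod (?s w) (?s []) (pullback \<phi> (P @ [] # Q)))"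
      by (simp add: 2 hochschild_term_def merge_def neg scale_minus scale_diff Let_def add.assoc)
    also have "\<dots> = scale ?e (?G Xi [] w - ?G Xi w [])"
      by (simp add: pullback_slot[OF assms] all_splittings_Nil bimod_slot_sum[OF assms])
    also have "\<dots> = (\<Sum>k<length w. scale ?e (?G Xi (take k w) (drop k w) - ?G Xi (take (Suc k) w) (drop (Suc k) w)))"
      using sum_lessThan_telescope'[of "\<lambda>k. ?G Xi (take k w) (drop k w)" "length w"]
      by (simp flip: scale_sum)
    also have "\<dots> = (\<Sum>k<length w. scale ?e (?G Xi (take k w) (w ! k # drop (Suc k) w)
        - ?G Xi (take k w @ [w ! k]) (drop (Suc k) w)))"
      by (simp add: take_Suc_conv_app_nth Cons_nth_drop_Suc)
    finally show ?thesis
      unfolding 2 sum_all_splittings_word case_prod_conv zeta_term_splits[OF assms] .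
  next
    case (3 w1 w2)
    have "hochschild_term (pullback \<phi>) P B Q =
        scale ?e (pullback \<phi> (P @ [w1 @ w2] # Q)) -
        (scale ?e (bimod (?s w1) (?s []) (pullback \<phi> (P @ [w2] # Q)))
         + scale ?e (bimod (?s []) (?s w2) (pullback \<phi> (P @ [w1] # Q))))"
    proof -
      have "bimod (?s []) (?s []) (pullback \<phi> (P @ [w1 @ w2] # Q)) = pullback \<phi> (P @ [w1 @ w2] # Q)"
        by (simp add: pullback_slot[OF assms] bimod_sum case_prod_unfold bimod_slot_sum[OF assms])
      then show ?thesis
        by (simp add: 3 hochschild_term_def merge_def neg scale_minus Let_def add.assoc)
    qed
    also have "\<dots> = 0"
    proof -
      have "pullback \<phi> (P @ [w1 @ w2] # Q) =
         (\<Sum>k<length w1. ?G (Delta (w1 ! k)) (take k w1) (drop (Suc k) w1 @ w2)) +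
         (\<Sum>k<length w2. ?G (Delta (w2 ! k)) (w1 @ take k w2) (drop (Suc k) w2))"
        by (simp add: pullback_slot[OF assms] sum_all_splittings_word sum_lessThan_add nth_append)
      then show ?thesis
        by (simp add: pullback_slot[OF assms] sum_all_splittings_word bimod_sum bimod_slot_sum[OF assms]
            add.commute flip: scale_add)
    qed
    finally show ?thesis
      by (simp add: 3 all_splittings_long)
  next
    case 4
    have "pullback \<phi> (P @ butlast (tl (merge k ([[]] @ B @ [[]]))) # Q) = 0" if "k \<le> length B" for k
      using 4 that by (intro pullback_long_block[OF assms]) (simp add: merge_def)
    then show ?thesis
      using 4 by (simp add: hochschild_term_def Let_def all_splittings_long)
  qed
qed

lemma pullback_zeta_diff:
  assumes "well_shaped \<phi>"
  shows "pullback (zeta_diff \<phi>) = hochschild_diff (pullback \<phi>)"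
proof
  fix X
  let ?b = "\<lambda>S. bimod (lefts S) (rights S)"
  let ?z = "\<lambda>i S. zeta_term \<phi> (take i (letters S)) (letters S ! i) (drop (Suc i) (letters S))"
  have "pullback (zeta_diff \<phi>) X = (\<Sum>S\<in>splits X. \<Sum>i<length X. ?b S (?z i S))"
    unfolding pullback_splits[OF well_shaped_zeta_diff[OF assms]] zeta_diff_terms bimod_sum
    by (intro sum.cong refl) (auto dest: splits_length)
  also have "\<dots> = (\<Sum>i<length X. \<Sum>S\<in>splits X. ?b S (?z i S))"
    by (rule sum.swap)
  also have "\<dots> = (\<Sum>i<length X. hochschild_term (pullback \<phi>) (take i X) (X ! i) (drop (Suc i) X))"
  proof (intro sum.cong refl)
    fix i
    assume "i \<in> {..<length X}"
    define P B Q where "P = take i X" "B = X ! i" "Q = drop (Suc i) X"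
    have X: "X = P @ B # Q" and i: "i = length P"
      using \<open>i \<in> _\<close> by (simp_all add: P_B_Q_def id_take_nth_drop)
    have "(\<Sum>S\<in>splits X. ?b S (?z i S)) = (\<Sum>s\<in>all_splittings B. \<Sum>S\<in>splits P. \<Sum>T\<in>splits Q.
        ?b (S @ s # T) (?z i (S @ s # T)))"
      unfolding X by (rule sum_splits_append)
    also have "\<dots> = hochschild_term (pullback \<phi>) P B Q"
      unfolding hochschild_term_pullback[OF assms] case_prod_unfold
      by (intro sum.cong refl) (auto simp: i nth_append dest!: splits_length)
    finally show "(\<Sum>S\<in>splits X. ?b S (?z i S)) =
        hochschild_term (pullback \<phi>) (take i X) (X ! i) (drop (Suc i) X)"
      by (simp add: P_B_Q_def)
  qed
  also have "\<dots> = hochschild_diff (pullback \<phi>) X"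
    by (simp add: hochschild_diff_terms)
  finally show "pullback (zeta_diff \<phi>) X = hochschild_diff (pullback \<phi>) X" .
qed

lemma Phi_zeta_diff:
  fixes \<phi> :: "('x::finite, 'k::field_char_0) small"
  assumes "\<phi> \<in> invariants d gdeg"
  shows "Phi d (zeta_diff \<phi>) = hochschild_diff (Phi d \<phi>)"
proof -
  have "well_shaped \<phi>"
    using assms by (simp only: invariants_iff)
  then show ?thesis
    unfolding Phi_invariant[OF zeta_diff_invariant[OF assms]] Phi_invariant[OF assms]
    by (rule pullback_zeta_diff)
qed

section \<open>Joining chains of words\<close>

text \<open>
  The product of an open chain of words with another one: the last word of the first chain and the
  first word of the second become one word. Nonempty chains form a monoid with unit \<open>[[]]\<close>, namely
  that of the words in the generators and one more letter for the separator of tensor factors.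
  In it a letter whose input splits as \<open>a\<close>, \<open>b\<close> acts as the chain \<open>[b, a]\<close>, and the value of a
  monomial becomes a product of such chains and of words, cut open at its first letter.
\<close>

fun join :: "'a list list \<Rightarrow> 'a list list \<Rightarrow> 'a list list" where
  "join [] ys = ys"
| "join [x] ys = (case ys of [] \<Rightarrow> [x] | y # ys' \<Rightarrow> (x @ y) # ys')"
| "join (x # x' # xs) ys = x # join (x' # xs) ys"

lemma join_Nil_right [simp]: "join xs [] = xs"
  by (induction xs "[] :: 'a list list" rule: join.induct) auto

lemma join_Cons: "xs \<noteq> [] \<Longrightarrow> join (x # xs) ys = x # join xs ys"
  by (cases xs) auto

lemma join_eq_Nil_iff [simp]: "join xs ys = [] \<longleftrightarrow> xs = [] \<and> ys = []"
  by (induction xs ys rule: join.induct) (auto split: list.splits)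

lemma join_assoc: "join (join xs ys) zs = join xs (join ys zs)"
proof (induction xs ys rule: join.induct)
  case (2 x ys)
  show ?case
  proof (cases ys)
    case (Cons y ys')
    then show ?thesis by (cases ys'; cases zs) auto
  qed simp
next
  case (3 x x' xs ys)
  then show ?case by (simp add: join_Cons)
qed simp

lemma length_join: "xs \<noteq> [] \<Longrightarrow> ys \<noteq> [] \<Longrightarrow> length (join xs ys) = length xs + length ys - 1"
  by (induction xs ys rule: join.induct) (auto split: list.splits)

lemma join_Cons_right: "xs \<noteq> [] \<Longrightarrow> join xs (y # ys) = join xs [y] @ ys"
  by (induction xs "y # ys" rule: join.induct) auto

lemma join_singleton_left [simp]: "join [x] (y # ys) = (x @ y) # ys"
  by simp

declare join.simps(2,3) [simp del]

text \<open>
  The chain of a monomial with given splittings of the inputs: the letter with splitting \<open>(a, b)\<close>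
  closes the preceding output with \<open>b\<close> and opens the next one with \<open>a\<close>.
\<close>

fun chain_word :: "(('a list \<times> 'a list) \<times> 'a list) list \<Rightarrow> 'a list list" where
  "chain_word [] = [[]]"
| "chain_word (((a, b), u) # r) = join [b, a @ u] (chain_word r)"

lemma chain_word_Cons: "chain_word ((s, u) # r) = join [snd s, fst s @ u] (chain_word r)"
  by (cases s) simp

lemma chain_word_nonempty [simp]: "chain_word r \<noteq> []"
  by (induction r rule: chain_word.induct) auto

lemma length_chain_word: "length (chain_word r) = Suc (length r)"
  by (induction r rule: chain_word.induct) (auto simp: length_join)

lemma join_unit_left: "ys \<noteq> [] \<Longrightarrow> join [[]] ys = ys"
  by (cases ys) auto

lemma chain_word_append: "chain_word (r @ r') = join (chain_word r) (chain_word r')"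
  by (induction r rule: chain_word.induct) (auto simp: join_assoc join_unit_left)

lemma cyc_act_chain_word:
  "length l = length us \<Longrightarrow>
     cyc_act (a # map fst l) (u # us) (b # map snd l) = join [a @ u] (join (chain_word (zip l us)) [b])"
proof (induction l us arbitrary: a u rule: list_induct2)
  case Nil
  then show ?case by (simp add: cyc_act_def)
next
  case (Cons y l u' us)
  obtain a' b' where y: "y = (a', b')"
    by (cases y)
  have "cyc_act (a # map fst (y # l)) (u # u' # us) (b # map snd (y # l)) =
      (a @ u @ b') # cyc_act (a' # map fst l) (u' # us) (b # map snd l)"
    by (simp add: cyc_act_def y)
  also have "\<dots> = (a @ u @ b') # join [a' @ u'] (join (chain_word (zip l us)) [b])"
    by (simp only: Cons.IH)
  also have "\<dots> = join [a @ u] (join (join [b', a' @ u'] (chain_word (zip l us))) [b])"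
    by (simp add: join_assoc join_Cons)
  finally show ?case
    by (simp add: y)
qed

text \<open>
  Unlike the cyclic value, this is multiplicative in the monomial (\<open>chain_append\<close>), so that cutting
  and rotating become regroupings of a product.
\<close>

definition chain :: "'x monomial \<Rightarrow> 'x word list list \<Rightarrow> ('x, 'k::field) tensor" where
  "chain U X = (if length U = length X
     then \<Sum>l\<in>msplits U X. single (chain_word (zip l (map snd U))) 1 else 0)"

lemma chain_Nil [simp]: "chain [] [] = single [[]] 1"
  by (simp add: chain_def)

lemma chain_length: "length U \<noteq> length X \<Longrightarrow> chain U X = 0"
  by (simp add: chain_def)

lemma keys_chain: "w \<in> keys (chain U X) \<Longrightarrow> length w = Suc (length U)"
proof -
  assume w: "w \<in> keys (chain U X)"
  then have len: "length U = length X"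
    by (auto simp: chain_def split: if_splits)
  with w obtain l where l: "l \<in> msplits U X"
    "w \<in> keys (single (chain_word (zip l (map snd U))) (1::'b))"
    unfolding chain_def by (auto dest!: keys_sum_in split: if_splits)
  then show ?thesis
    using msplits_length[OF l(1) len] len by (auto simp: length_chain_word)
qed

lemma chain_degree:
  assumes "chain U X \<noteq> (0 :: ('x, 'k::field) tensor)"
  shows "length X = length U" "inputs X = mdeg U"
proof -
  show len: "length X = length U"
    using assms chain_length[of U X] by (metis (full_types))
  have "(\<Sum>l\<in>msplits U X. single (chain_word (zip l (map snd U))) (1::'k)) \<noteq> 0"
    using assms by (simp add: chain_def len)
  then obtain l where "l \<in> msplits U X"
    by (meson sum.not_neutral_contains_not_neutral)
  then show "inputs X = mdeg U"
    using msplits_total_deg len by metis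
qed

lemma chain_Cons:
  "chain (y # U) (B # X) =
     (\<Sum>(a, b)\<in>splittings (fst y) B. lin_map (join [b, a @ snd y]) (chain U X))"
proof (cases "length U = length X")
  case True
  have "chain (y # U) (B # X) = (\<Sum>l\<in>listset (splittings (fst y) B # map2 splittings (map fst U) X).
      single (chain_word (zip l (snd y # map snd U))) (1::'b))"
    using True by (simp add: chain_def del: listset.simps)
  then show ?thesis
    using True by (simp add: sum_listset_Cons chain_def lin_map_sum case_prod_unfold
        chain_word_Cons del: listset.simps)
qed (simp add: chain_length)

lemma chain_append:
  assumes "length U = length X"
  shows "chain (U @ V) (X @ Y) = lin_ext (\<lambda>x. lin_map (join x) (chain V Y)) (chain U X)"
proof (cases "length V = length Y")
  case True
  have "chain (U @ V) (X @ Y) = (\<Sum>l\<in>msplits U X. \<Sum>m\<in>msplits V Y.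
      single (chain_word (zip (l @ m) (map snd U @ map snd V))) (1::'b))"
    using assms True by (simp add: chain_def sum_listset_append)
  also have "\<dots> = (\<Sum>l\<in>msplits U X. \<Sum>m\<in>msplits V Y. single
      (join (chain_word (zip l (map snd U))) (chain_word (zip m (map snd V)))) 1)"
  proof (intro sum.cong refl)
    fix l m
    assume "l \<in> msplits U X"
    then have "length l = length (map snd U)"
      using msplits_length assms by fastforce
    then show "single (chain_word (zip (l @ m) (map snd U @ map snd V))) 1 =
      single (join (chain_word (zip l (map snd U))) (chain_word (zip m (map snd V)))) (1::'b)"
      by (simp add: chain_word_append)
  qed
  finally show ?thesis
    using assms True by (simp add: chain_def lin_ext_sum lin_map_sum)
qed (simp add: chain_length assms)

lemma chain_singleton:
  "chain [y] [B] = (\<Sum>(a, b)\<in>splittings (fst y) B. single [b, a @ snd y] 1)"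
  unfolding chain_Cons by (intro sum.cong refl) (auto simp: join_Cons)

lemma chain_snoc:
  "chain (U @ [y]) (X @ [B]) =
     (\<Sum>(a, b)\<in>splittings (fst y) B. lin_map (\<lambda>x. join x [b, a @ snd y]) (chain U X))"
proof (cases "length U = length X")
  case True
  then show ?thesis
    by (simp add: chain_append chain_singleton lin_map_sum case_prod_unfold
        lin_ext_fun_sum lin_ext_sum lin_map_def)
qed (simp add: chain_length)

text \<open>
  The first letter is where the circle is cut open: its \<open>a\<close> begins the first output and its \<open>b\<close>
  ends the last one.
\<close>

lemma Phi_unsym_chain:
  "(Phi_unsym (y # U) (B # X) :: ('x, 'k::field) tensor) =
     (\<Sum>(a, b)\<in>splittings (fst y) B. lin_map (\<lambda>x. join [a @ snd y] (join x [b])) (chain U X))"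
proof (cases "length U = length X")
  case True
  have "cyc_act (fst s # map fst l) (snd y # map snd U) (snd s # map snd l) =
      join [fst s @ snd y] (join (chain_word (zip l (map snd U))) [snd s])" if "l \<in> msplits U X" for s l
    using msplits_length[OF that True] True by (intro cyc_act_chain_word) simp
  then show ?thesis
    unfolding Phi_unsym_Cons[OF True]
    by (simp add: chain_def True lin_map_sum case_prod_unfold)
qed (simp add: chain_length Phi_unsym_def)

section \<open>Cutting a word at a letter\<close>

lemma sum_splittings_append:
  fixes F :: "'a word \<Rightarrow> 'a word \<Rightarrow> 'c::comm_monoid_add"
  shows "(\<Sum>(p, q)\<in>splittings c [a @ h]. F p q) =
     (\<Sum>(p, q)\<in>splittings c [a]. F p (q @ h)) + (\<Sum>(p, q)\<in>splittings c [h]. F (a @ p) q)"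
proof -
  have *: "(\<Sum>k | k < n \<and> P k. f k) = (\<Sum>k<n. if P k then f k else 0)"
    for n and P :: "nat \<Rightarrow> bool" and f :: "nat \<Rightarrow> 'c"
    by (simp add: sum.If_cases lessThan_def Collect_conj_eq Int_commute)
  show ?thesis
    unfolding sum_splittings_word * length_append sum_lessThan_add
    by (intro arg_cong2[of _ _ _ _ plus] sum.cong) (auto simp: nth_append)
qed

lemma splittings_empty_word: "splittings c [[]] = {}"
  by (cases c) auto

text \<open>
  Differentiating with respect to \<open>x\<^sub>i\<close> and then to the right of it with respect to \<open>x\<^sub>j\<close> is
  differentiating with respect to \<open>x\<^sub>j\<close> and then to the left of it with respect to \<open>x\<^sub>i\<close>. This
  is why the double derivatives of the two compositions agree.
\<close>

lemma sum_splittings_coassoc: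
  "(\<Sum>(a, b)\<in>splittings e Y. \<Sum>(p, q)\<in>splittings c [b]. F a p q) =
     (\<Sum>(a, q)\<in>splittings c Y. \<Sum>(a', p)\<in>splittings e [a]. F a' p q)"
proof -
  define S where "S = (SIGMA ab:splittings e Y. splittings c [snd ab])"
  define T where "T = (SIGMA ab:splittings c Y. splittings e [fst ab])"
  have "(\<Sum>s\<in>S. F (fst (fst s)) (fst (snd s)) (snd (snd s))) =
      (\<Sum>t\<in>T. F (fst (snd t)) (snd (snd t)) (snd (fst t)))"
  proof (cases "e = Xi \<or> c = Xi")
    case True
    then have "S = {}" "T = {}"
      by (auto simp: S_def T_def splittings_empty_word split: if_splits simp del: splittings.simps(2))
    then show ?thesis by simp
  next
    case False
    then obtain i j where ec: "e = Delta i" "c = Delta j"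
      by (metis gen.exhaust)
    show ?thesis
      unfolding S_def T_def ec
      by (rule sum.reindex_bij_witness[of _
            "\<lambda>((a', q), (a, p)). ((a, p @ [j] @ q), (p, q))"
            "\<lambda>((a, b), (p, q)). ((a @ [i] @ p, q), (a, p))"]) auto
  qed
  then show ?thesis
    by (simp add: S_def T_def sum.Sigma case_prod_unfold)
qed

definition cut_sum :: "'x gen \<Rightarrow> ('x word \<Rightarrow> 'x word list \<Rightarrow> 'c::comm_monoid_add) \<Rightarrow> 'x word list \<Rightarrow> 'c" where
  "cut_sum c G v = (\<Sum>(p, q)\<in>splittings c [hd v]. G p (q # tl v))"

lemma cut_sum_join:
  assumes "x \<noteq> []"
  shows "cut_sum c G (join [a] x) =
    (\<Sum>(p, q)\<in>splittings c [a]. G p (join [q] x)) + cut_sum c (\<lambda>p. G (a @ p)) x"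
proof -
  obtain h t where "x = h # t"
    using assms by (cases x) auto
  then show ?thesis
    by (simp add: cut_sum_def sum_splittings_append)
qed

section \<open>Inserting one operation into another\<close>

text \<open>
  The only insertions that matter for operations on blocks with at most one word: the inserted
  output is the whole first block of \<open>f\<close>, an operation with \<open>N\<close> outputs.
\<close>

definition composite ::
    "int \<Rightarrow> nat \<Rightarrow> ('x, 'k::field) operation \<Rightarrow> ('x, 'k) operation \<Rightarrow> ('x, 'k) operation" where
  "composite d N f g Z = (case Z of [] \<Rightarrow> 0 | Y # Z' \<Rightarrow>
     let Xs = take (N - 1) Z'; Ys = drop (N - 1) Z'
     in scale (ksign (inputs Xs * (inputs Ys + (d - 1) * int (length Ys))))
          (lin_ext (\<lambda>v. lin_map (\<lambda>w. w @ tl v) (f ([hd v] # Xs))) (g (Y # Ys))))"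

lemma composite_Nil [simp]: "composite d N f g [] = 0"
  by (simp add: composite_def)

lemma composite_Cons:
  assumes "length Xs = N - 1"
  shows "composite d N f g (Y # Xs @ Ys) =
    scale (ksign (inputs Xs * (inputs Ys + (d - 1) * int (length Ys))))
      (lin_ext (\<lambda>v. lin_map (\<lambda>w. w @ tl v) (f ([hd v] # Xs))) (g (Y # Ys)))"
  using assms by (simp add: composite_def)

lemma composite_Cons':
  "composite d N f g (Y # Z) =
    scale (ksign (inputs (take (N - 1) Z) * (inputs (drop (N - 1) Z) + (d - 1) * int (length (drop (N - 1) Z)))))
      (lin_ext (\<lambda>v. lin_map (\<lambda>w. w @ tl v) (f ([hd v] # take (N - 1) Z))) (g (Y # drop (N - 1) Z)))"
  by (simp add: composite_def Let_def)

lemma composite_zero [simp]: "composite d N 0 g = 0" "composite d N f 0 = 0"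
  by (auto simp: fun_eq_iff zero_fun_apply composite_def Let_def split: list.split)

lemma composite_add:
  "composite d N (f + f') g = composite d N f g + composite d N f' g"
  "composite d N f (g + g') = composite d N f g + composite d N f g'"
  by (auto simp: fun_eq_iff plus_fun_apply composite_def Let_def lin_map_add lin_ext_fun_add
      lin_ext_add scale_add split: list.split)

lemma composite_cscale:
  "composite d N (cscale a f) g = cscale a (composite d N f g)"
  "composite d N f (cscale a g) = cscale a (composite d N f g)"
  by (auto simp: fun_eq_iff cscale_def composite_def Let_def lin_map_scale lin_ext_fun_scale
      lin_ext_scale mult.commute split: list.split)

lemma composite_sum:
  "composite d N (sum f I) g = (\<Sum>i\<in>I. composite d N (f i) g)"
  "composite d N f' (sum g' J) = (\<Sum>j\<in>J. composite d N f' (g' j))"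
proof -
  show "composite d N (sum f I) g = (\<Sum>i\<in>I. composite d N (f i) g)"
    by (induction I rule: infinite_finite_induct) (simp_all add: composite_add)
  show "composite d N f' (sum g' J) = (\<Sum>j\<in>J. composite d N f' (g' j))"
    by (induction J rule: infinite_finite_induct) (simp_all add: composite_add)
qed

lemma composite_support:
  assumes f: "\<And>X. f X \<noteq> 0 \<Longrightarrow> length X = N \<and> inputs X = n"
    and g: "\<And>X. g X \<noteq> 0 \<Longrightarrow> length X = M \<and> inputs X = m"
    and nz: "composite d N f g Z \<noteq> 0"
  shows "Suc (length Z) = N + M \<and> inputs Z + 1 = n + m"
proof -
  obtain Y Z' where Z: "Z = Y # Z'"
    using nz by (cases Z) auto
  define Xs Ys where "Xs = take (N - 1) Z'" "Ys = drop (N - 1) Z'"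
  have Z': "Z = Y # Xs @ Ys"
    by (simp add: Z Xs_Ys_def)
  have *: "lin_ext (\<lambda>v. lin_map (\<lambda>w. w @ tl v) (f ([hd v] # Xs))) (g (Y # Ys)) \<noteq> 0"
    using nz by (auto simp: Z composite_Cons' Xs_Ys_def)
  then have "g (Y # Ys) \<noteq> 0"
    by auto
  moreover obtain v where "lin_map (\<lambda>w. w @ tl v) (f ([hd v] # Xs)) \<noteq> 0"
    using * lin_ext_fun_zero[of "g (Y # Ys)"] by (metis (no_types, lifting) lin_ext_cong)
  then have "f ([hd v] # Xs) \<noteq> 0"
    by auto
  ultimately show ?thesis
    using f[of "[hd v] # Xs"] g[of "Y # Ys"] by (auto simp: Z')
qed

subsection \<open>The three places where an output word can be cut\<close>

definition two_chains ::
    "'x monomial \<Rightarrow> 'x word list list \<Rightarrow> 'x monomial \<Rightarrow> 'x word list list \<Rightarrow>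
      ('x word list \<Rightarrow> 'x word list \<Rightarrow> 'x word list) \<Rightarrow> ('x, 'k::field) tensor" where
  "two_chains U Xs W Ys H = lin_ext (\<lambda>w. lin_map (\<lambda>x. H x w) (chain U Xs)) (chain W Ys)"

lemma two_chains_cong:
  assumes "\<And>x w. length x = Suc (length U) \<Longrightarrow> length w = Suc (length W) \<Longrightarrow> H x w = H' x w"
  shows "two_chains U Xs W Ys H = two_chains U Xs W Ys H'"
  unfolding two_chains_def
  by (intro lin_ext_cong lin_map_cong) (auto dest!: keys_chain intro: assms)

lemma two_chains_swap: "two_chains U Xs W Ys H = two_chains W Ys U Xs (\<lambda>w x. H x w)"
  unfolding two_chains_def lin_map_def by (rule lin_ext_swap)

lemma keys_two_chains:
  assumes "v \<in> keys (two_chains U Xs W Ys H)"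
  obtains x w where "v = H x w" "length x = Suc (length U)" "length w = Suc (length W)"
proof -
  obtain w where w: "w \<in> keys (chain W Ys :: ('a, 'b) tensor)"
    "v \<in> keys (scale (Poly_Mapping.lookup (chain W Ys) w) (lin_map (\<lambda>x. H x w) (chain U Xs)) :: ('a, 'b) tensor)"
    using assms unfolding two_chains_def lin_ext_def by (meson keys_sum_in)
  then have "v \<in> (\<lambda>x. H x w) ` keys (chain U Xs :: ('a, 'b) tensor)"
    using subsetD[OF keys_lin_map] subsetD[OF keys_scale] by metis
  then show ?thesis
    using that[of _ w] keys_chain w(1) by blast
qed

text \<open>
  The terms in which the letter \<open>c\<close> of the first monomial hits the part \<open>a\<close>, or the part
  \<open>b\<close>, of the output of the second one (see \<open>composite_Phi_unsym\<close>). In both, one input is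
  differentiated twice: it is \<open>p x\<^sub>j q x\<^sub>i b\<close> with the letter of the first monomial on the left for
  \<open>left_cut\<close>, and has the letter of the first monomial on the right for \<open>right_cut\<close>. For a second monomial with
  one letter, \<open>b\<close> belongs to the input of this letter itself, which is why the part \<open>b\<close> is
  described by cutting the remaining chain.
\<close>

fun left_cut :: "'x monomial \<Rightarrow> 'x monomial \<Rightarrow> ('x, 'k::field) operation" where
  "left_cut ((c, u) # U) ((e, v) # W) (Y # Z) =
     (\<Sum>(a, b)\<in>splittings e Y. \<Sum>(p, q)\<in>splittings c [a].
       two_chains U (take (length U) Z) W (drop (length U) Z)
         (\<lambda>x w. join [p @ u] (join x (join [q @ v] (join w [b])))))"
| "left_cut _ _ _ = 0"

fun right_cut :: "'x monomial \<Rightarrow> 'x monomial \<Rightarrow> ('x, 'k::field) operation" where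
  "right_cut ((c, u) # U) ((e, v) # W) (Y # Z) =
     (\<Sum>(a, b)\<in>splittings e Y. lin_ext (\<lambda>w.
       cut_sum c (\<lambda>p y. lin_map (\<lambda>x. join [a @ v @ p @ u] (join x y)) (chain U (take (length U) Z)))
         (join w [b])) (chain W (drop (length U) Z)))"
| "right_cut _ _ _ = 0"

lemma length_glue_word:
  "W \<noteq> [] \<Longrightarrow> U \<noteq> [] \<Longrightarrow> length (glue_word U W k) = length U + length W - 1"
  by (cases W; cases U) (auto simp: glue_word_def Let_def split: prod.split)

lemma glue_word_nonempty: "glue_word U W k \<noteq> []"
  by (auto simp: glue_word_def Let_def split: prod.split)

text \<open>
  Cutting inside the word \<open>v\<close> between two letters of the second monomial leaves all inputs
  differentiated once, so the result is again the value of a monomial. The two cases are forced by the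
  last word of the first monomial being its first one if this monomial has one letter.
\<close>

lemma Phi_unsym_glue_word:
  assumes "length Xs = length U" "length Ys = length W"
  shows "(Phi_unsym (glue_word ((c, u) # U) ((e, v) # W) k) (Y # Xs @ Ys) :: ('x, 'k::field) tensor) =
    (\<Sum>(a, b)\<in>splittings e Y. two_chains U Xs W Ys
       (\<lambda>x w. join [a @ take k v @ u] (join x (join [drop (Suc k) v] (join w [b])))))"
proof (cases U rule: rev_cases)
  case Nil
  then have "glue_word ((c, u) # U) ((e, v) # W) k = (e, take k v @ u @ drop (Suc k) v) # W"
    by (simp add: glue_word_def)
  moreover have "join [a @ (take k v @ u @ drop (Suc k) v)] (join w [b]) =
      join [a @ take k v @ u] (join [[]] (join [drop (Suc k) v] (join w [b])))" for a b w
    by (cases "join w [b]") simp_all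
  ultimately show ?thesis
    using Nil assms by (simp add: Phi_unsym_chain two_chains_def lin_map_def)
next
  case (snoc U' y)
  obtain c' u' where y: "y = (c', u')"
    by (cases y)
  obtain Xs' B where Xs: "Xs = Xs' @ [B]"
    using assms snoc by (cases Xs rule: rev_cases) auto
  let ?q = "drop (Suc k) v"
  have word: "glue_word ((c, u) # U) ((e, v) # W) k = (e, take k v @ u) # (U' @ [(c', u' @ ?q)]) @ W"
    by (simp add: glue_word_def snoc y butlast_append)
  have join_join: "join (join x y) = (\<lambda>w. join x (join y w))" for x y :: "'x word list"
    by (simp add: join_assoc fun_eq_iff)
  have "(chain (U' @ [(c', u' @ ?q)]) Xs :: ('x, 'k) tensor) = lin_map (\<lambda>x. join x [?q]) (chain U Xs)"
  proof -
    have "join x [b, a @ u' @ ?q] = join (join x [b, a @ u']) [?q]" for x a b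
      by (simp add: join_assoc join_Cons)
    then show ?thesis
      by (simp add: Xs snoc y chain_snoc lin_map_sum lin_map_lin_map case_prod_unfold)
  qed
  then have "(chain ((U' @ [(c', u' @ ?q)]) @ W) (Xs @ Ys) :: ('x, 'k) tensor) =
      lin_ext (\<lambda>x. lin_map (\<lambda>w. join x (join [?q] w)) (chain W Ys)) (chain U Xs)"
    using assms snoc by (subst chain_append) (simp_all add: lin_ext_lin_map join_join)
  then show ?thesis
    unfolding word Phi_unsym_chain two_chains_swap[of U]
    by (simp add: two_chains_def lin_map_lin_ext lin_map_lin_map join_assoc)
qed

text \<open>
  The Leibniz rule for the word \<open>a v b\<close>: the derivative hits \<open>v\<close>, \<open>a\<close> or \<open>b\<close>.
\<close>

lemma composite_Phi_unsym:
  fixes U W :: "'x monomial"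
  shows "(composite d (Suc (length U)) (Phi_unsym ((c, u) # U)) (Phi_unsym ((e, v) # W)) :: ('x, 'k::field) operation) =
    cscale (ksign (mdeg U * (mdeg W + (d - 1) * int (length W))))
      ((\<Sum>k | k < length v \<and> c = Delta (v ! k). Phi_unsym (glue_word ((c, u) # U) ((e, v) # W) k))
       + left_cut ((c, u) # U) ((e, v) # W) + right_cut ((c, u) # U) ((e, v) # W))"
    (is "?L = ?R")
proof
  fix Z
  show "?L Z = ?R Z"
  proof (cases Z)
    case Nil
    then show ?thesis
      by (simp add: cscale_def plus_fun_apply sum_fun_apply Phi_unsym_def glue_word_nonempty)
  next
    case (Cons Y Z')
    define Xs Ys where "Xs = take (length U) Z'" "Ys = drop (length U) Z'"
    have Z: "Z = Y # Xs @ Ys"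
      by (simp add: Cons Xs_Ys_def)
    let ?G = "\<lambda>p y. lin_map (\<lambda>x. join [p @ u] (join x y)) (chain U Xs) :: ('x, 'k) tensor"
    let ?s = "ksign (inputs Xs * (inputs Ys + (d - 1) * int (length Ys))) :: 'k"
    let ?main = "\<Sum>(a, b)\<in>splittings e Y. lin_ext (\<lambda>w.
        \<Sum>(p, q)\<in>splittings c [v]. ?G (a @ p) (join [q] (join w [b]))) (chain W Ys)"
    have f: "lin_map (\<lambda>w. w @ t) (Phi_unsym ((c, u) # U) ([h] # Xs)) = cut_sum c ?G (h # t)" for h t
    proof -
      have "join [p @ u] (join x [q]) @ t = join [p @ u] (join x (q # t))"
        if "x \<in> keys (chain U Xs :: ('x, 'k) tensor)" for x p q
      proof -
        have "x \<noteq> []"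
          using keys_chain[OF that] by auto
        then show ?thesis
          by (simp add: join_Cons_right[of "join _ _" q t] flip: join_assoc)
      qed
      then show ?thesis
        unfolding Phi_unsym_chain cut_sum_def lin_map_sum case_prod_unfold fst_conv snd_conv list.sel
          lin_map_lin_map
        by (intro sum.cong refl lin_map_cong) auto
    qed
    have cut: "cut_sum c ?G (join [a @ v] x) = (\<Sum>(p, q)\<in>splittings c [a]. ?G p (join [q @ v] x))
        + (\<Sum>(p, q)\<in>splittings c [v]. ?G (a @ p) (join [q] x)) + cut_sum c (\<lambda>p. ?G (a @ v @ p)) x"
      if nonempty: "x \<noteq> []" for a x
    proof -
      obtain h t where x: "x = h # t"
        using nonempty by (cases x) auto
      have "join [a @ v] x = join [a] (join [v] x)"
        by (simp add: x)
      then have "cut_sum c ?G (join [a @ v] x) =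
          (\<Sum>(p, q)\<in>splittings c [a]. ?G p (join [q] (join [v] x))) +
          ((\<Sum>(p, q)\<in>splittings c [v]. ?G (a @ p) (join [q] x)) + cut_sum c (\<lambda>p. ?G (a @ v @ p)) x)"
        using nonempty by (simp only: cut_sum_join append_assoc join_eq_Nil_iff list.distinct simp_thms)
      then show ?thesis
        by (simp add: x add.assoc)
    qed
    have "?L Z = scale ?s (lin_ext (\<lambda>v. cut_sum c ?G v) (Phi_unsym ((e, v) # W) (Y # Ys)))"
    proof -
      have "lin_ext (\<lambda>v. lin_map (\<lambda>w. w @ tl v) (Phi_unsym ((c, u) # U) ([hd v] # Xs))) t
        = lin_ext (\<lambda>v. cut_sum c ?G v) t" for t
        by (simp only: f) (simp add: cut_sum_def)
      then show ?thesis
        by (simp add: Cons composite_Cons' Xs_Ys_def)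
    qed
    also have "lin_ext (\<lambda>v. cut_sum c ?G v) (Phi_unsym ((e, v) # W) (Y # Ys)) =
      (\<Sum>(a, b)\<in>splittings e Y. lin_ext (\<lambda>w. cut_sum c ?G (join [a @ v] (join w [b]))) (chain W Ys))"
      by (simp add: Phi_unsym_chain lin_ext_sum lin_ext_lin_map case_prod_unfold)
    also have "\<dots> = ?main + left_cut ((c, u) # U) ((e, v) # W) Z + right_cut ((c, u) # U) ((e, v) # W) Z"
      by (simp add: cut lin_ext_fun_add sum.distrib case_prod_unfold Cons lin_ext_fun_sum
          flip: Xs_Ys_def) (simp add: two_chains_def add_ac)
    also have "?main = (\<Sum>k | k < length v \<and> c = Delta (v ! k). \<Sum>(a, b)\<in>splittings e Y.
        two_chains U Xs W Ys (\<lambda>x w. join [a @ take k v @ u] (join x (join [drop (Suc k) v] (join w [b])))))"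
      unfolding sum_splittings_word lin_ext_fun_sum
      unfolding case_prod_unfold two_chains_def append_assoc
      by (rule sum.swap)
    finally have L: "?L Z = scale ?s ((\<Sum>k | k < length v \<and> c = Delta (v ! k). \<Sum>(a, b)\<in>splittings e Y.
        two_chains U Xs W Ys (\<lambda>x w. join [a @ take k v @ u] (join x (join [drop (Suc k) v] (join w [b])))))
      + left_cut ((c, u) # U) ((e, v) # W) Z + right_cut ((c, u) # U) ((e, v) # W) Z)" .
    show ?thesis
    proof (cases "chain U Xs = (0 :: ('x, 'k) tensor) \<or> chain W Ys = (0 :: ('x, 'k) tensor)")
      case True
      then have two: "two_chains U Xs W Ys H = (0 :: ('x, 'k) tensor)" for H
        by (auto simp: two_chains_def)
      have left: "left_cut ((c, u) # U) ((e, v) # W) Z = (0 :: ('x, 'k) tensor)"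
        by (simp add: Cons two flip: Xs_Ys_def)
      have right: "right_cut ((c, u) # U) ((e, v) # W) Z = (0 :: ('x, 'k) tensor)"
        using True by (auto simp: Cons cut_sum_def simp flip: Xs_Ys_def)
      have glue: "Phi_unsym (glue_word ((c, u) # U) ((e, v) # W) k) Z = (0 :: ('x, 'k) tensor)" for k
      proof (cases "length Xs = length U \<and> length Ys = length W")
        case True
        then show ?thesis
          unfolding Z by (simp add: Phi_unsym_glue_word two)
      next
        case False
        then have "length (glue_word ((c, u) # U) ((e, v) # W) k) \<noteq> length Z"
          by (auto simp: length_glue_word Cons Xs_Ys_def)
        then show ?thesis
          by (simp add: Phi_unsym_def)
      qed
      have "(\<Sum>k | k < length v \<and> c = Delta (v ! k).
          Phi_unsym (glue_word ((c, u) # U) ((e, v) # W) k) Z) = (0 :: ('x, 'k) tensor)"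
        by (intro sum.neutral ballI glue)
      then show ?thesis
        unfolding L cscale_def plus_fun_apply sum_fun_apply left right by (simp add: two)
    next
      case False
      then have len: "length Xs = length U" "length Ys = length W"
        and deg: "inputs Xs = mdeg U" "inputs Ys = mdeg W"
        using chain_degree by blast+
      show ?thesis
        unfolding L using len deg
        by (simp add: cscale_def plus_fun_apply sum_fun_apply Z Phi_unsym_glue_word)
    qed
  qed
qed

subsection \<open>Cancellation of double derivatives\<close>

lemma join_append_right: "ys \<noteq> [] \<Longrightarrow> join xs (ys @ zs) = join xs ys @ zs"
proof (induction xs ys rule: join.induct)
  case (2 x ys)
  then show ?case by (cases ys) auto
next
  case (3 x x' xs ys)
  then show ?case by (simp add: join_Cons)
qed simp

lemma length_join_pos:
  "0 < length xs \<Longrightarrow> 0 < length ys \<Longrightarrow> length (join xs ys) = length xs + length ys - 1"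
  by (simp add: length_join)

lemma join_singletons: "ys \<noteq> [] \<Longrightarrow> join [x] (join [y] ys) = join [x @ y] ys"
  by (cases ys) auto

lemma lin_map_two_chains: "lin_map h (two_chains U Xs W Ys H) = two_chains U Xs W Ys (\<lambda>x w. h (H x w))"
  by (simp add: two_chains_def lin_map_lin_ext lin_map_lin_map)

lemma two_chains_Nil_left: "two_chains [] [] W Ys H = lin_map (H [[]]) (chain W Ys)"
  by (simp add: two_chains_def lin_map_def)

text \<open>
  Both sides differentiate one input by \<open>c\<close> and, to the left of it, by the letter that follows \<open>e\<close>
  cyclically. On the left side that input is the first block; on the right side it follows the block
  \<open>Y\<close> of \<open>e\<close> and the blocks \<open>Xs\<close>. If \<open>W\<close> is empty, the letter that follows \<open>e\<close> is \<open>e\<close> itself, and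
  the rotation is a full turn.
\<close>

lemma left_cut_rotate1:
  fixes U W :: "'x monomial"
  assumes "length Xs = length U" "length Ys = length W"
  shows "left_cut (W @ [(e, v)]) ((c, u) # U) (Ys @ Y # Xs) =
    lin_map (rotate (Suc (length U)))
      (right_cut ((c, u) # U) ((e, v) # W) (Y # Xs @ Ys) :: ('x, 'k::field) tensor)"
proof (cases W)
  case Nil
  let ?F = "\<lambda>a p q. lin_map (\<lambda>x. join [a @ v @ p @ u] (join x [q])) (chain U Xs) :: ('x, 'k) tensor"
  have rotate: "lin_map (rotate (Suc (length U))) (?F a p q) = ?F a p q" for a p q
    unfolding lin_map_lin_map
    by (rule lin_map_cong, rule rotate_id) (auto dest!: keys_chain simp: length_join_pos)
  have right: "right_cut ((c, u) # U) ((e, v) # W) (Y # Xs @ Ys) =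
      (\<Sum>(a, b)\<in>splittings e Y. \<Sum>(p, q)\<in>splittings c [b]. ?F a p q)"
    using assms Nil by (simp add: cut_sum_def)
  have "(left_cut (W @ [(e, v)]) ((c, u) # U) (Ys @ Y # Xs) :: ('x, 'k) tensor) =
      (\<Sum>(a, q)\<in>splittings c Y. \<Sum>(a', p)\<in>splittings e [a]. ?F a' p q)"
    using assms Nil by (simp add: two_chains_Nil_left join_singletons)
  also have "\<dots> = right_cut ((c, u) # U) ((e, v) # W) (Y # Xs @ Ys)"
    by (simp only: right sum_splittings_coassoc)
  also have "\<dots> = lin_map (rotate (Suc (length U))) \<dots>"
    unfolding right by (simp add: lin_map_sum case_prod_unfold rotate)
  finally show ?thesis .
next
  case (Cons y2 W2)
  obtain c2 v2 where y2: "y2 = (c2, v2)"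
    by (cases y2)
  obtain Y2 Ys2 where Ys: "Ys = Y2 # Ys2" "length Ys2 = length W2"
    using assms Cons by (cases Ys) auto
  let ?H = "\<lambda>a b a2 p q x w. join [a2 @ v2] (join (join w [b, a @ v]) (join [p @ u] (join x [q])))"
  let ?T = "\<lambda>a b a2 p q. two_chains U Xs W2 Ys2 (?H a b a2 p q) :: ('x, 'k) tensor"
  have word: "rotate (Suc (length U)) (join [a @ v @ p @ u] (join x (q # join [a2 @ v2] (join w [b])))) = ?H a b a2 p q x w"
    if "length x = Suc (length U)" "length w = Suc (length W2)" for a b a2 p q x w
  proof -
    define J where "J = join [a @ v @ p @ u] (join x [q])"
    define R where "R = join [a2 @ v2] (join w [b])"
    have ne: "x \<noteq> []" "w \<noteq> []"
      using that by auto
    have "join [a @ v @ p @ u] (join x (q # R)) = J @ R"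
      using ne join_Cons_right[of "join [a @ v @ p @ u] x" q R] by (simp add: J_def join_assoc)
    moreover have "length J = Suc (length U)"
      using ne that by (simp add: J_def length_join)
    then have "rotate (Suc (length U)) (J @ R) = R @ J"
      by (metis rotate_append)
    moreover have "join [b, a @ v] (join [p @ u] (join x [q])) = b # J"
      using ne by (simp add: join_Cons join_singletons J_def)
    then have "?H a b a2 p q x w = R @ J"
      using ne join_Cons_right[of w b J] by (simp add: join_assoc R_def join_append_right)
    ultimately show ?thesis
      by (simp add: R_def)
  qed
  have "lin_map (rotate (Suc (length U))) (right_cut ((c, u) # U) ((e, v) # W) (Y # Xs @ Ys)) =
      (\<Sum>(a, b)\<in>splittings e Y. \<Sum>(a2, b2)\<in>splittings c2 Y2. \<Sum>(p, q)\<in>splittings c [b2]. ?T a b a2 p q)"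
  proof -
    have right: "right_cut ((c, u) # U) ((e, v) # W) (Y # Xs @ Ys) =
      (\<Sum>(a, b)\<in>splittings e Y. \<Sum>(a2, b2)\<in>splittings c2 Y2. \<Sum>(p, q)\<in>splittings c [b2].
        two_chains U Xs W2 Ys2 (\<lambda>x w. join [a @ v @ p @ u] (join x (q # join [a2 @ v2] (join w [b])))) :: ('x, 'k) tensor)"
      using assms
      by (simp add: Cons y2 Ys chain_Cons lin_ext_sum lin_ext_lin_map case_prod_unfold cut_sum_def
          join_Cons join_assoc lin_ext_fun_sum two_chains_def)
    show ?thesis
      unfolding right lin_map_sum case_prod_unfold lin_map_two_chains
      by (intro sum.cong refl two_chains_cong word)
  qed
  also have "\<dots> = (\<Sum>(a, b)\<in>splittings e Y. \<Sum>(a', q)\<in>splittings c Y2. \<Sum>(a2, p)\<in>splittings c2 [a']. ?T a b a2 p q)"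
    by (simp only: sum_splittings_coassoc)
  also have "\<dots> = (\<Sum>(a', q)\<in>splittings c Y2. \<Sum>(a, b)\<in>splittings e Y. \<Sum>(a2, p)\<in>splittings c2 [a']. ?T a b a2 p q)"
    unfolding case_prod_unfold by (rule sum.swap)
  also have "\<dots> = (\<Sum>(a', q)\<in>splittings c Y2. \<Sum>(a2, p)\<in>splittings c2 [a']. \<Sum>(a, b)\<in>splittings e Y. ?T a b a2 p q)"
    unfolding case_prod_unfold by (intro sum.cong[OF refl] sum.swap)
  also have "\<dots> = left_cut (W @ [(e, v)]) ((c, u) # U) (Ys @ Y # Xs)"
  proof -
    have "two_chains (W2 @ [(e, v)]) (Ys2 @ [Y]) U Xs (\<lambda>x w. join [a2 @ v2] (join x (join [p @ u] (join w [q])))) =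
      (\<Sum>(a, b)\<in>splittings e Y. ?T a b a2 p q)" for a2 p q
      unfolding two_chains_swap[of U]
      by (simp add: two_chains_def chain_snoc lin_map_sum lin_map_lin_map lin_ext_fun_sum case_prod_unfold)
    then show ?thesis
      using assms Ys(2) by (simp add: Cons y2 Ys(1))
  qed
  finally show ?thesis ..
qed

lemma cut_support:
  fixes t :: "('x, 'k::field) tensor"
  assumes "t = left_cut (x # U) (y # W) Z \<or> t = right_cut (x # U) (y # W) Z" "t \<noteq> 0"
  obtains Y Xs Ys where "Z = Y # Xs @ Ys" "length Xs = length U" "length Ys = length W"
    "inputs Xs = mdeg U" "inputs Ys = mdeg W" "length Y = gdeg (fst y)" "fst x \<noteq> Xi"
proof -
  obtain c u where x: "x = (c, u)" by (cases x)
  obtain e v where y: "y = (e, v)" by (cases y)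
  obtain Y Z' where Z: "Z = Y # Z'"
    using assms by (cases Z) (auto simp: x y)
  define Xs Ys where "Xs = take (length U) Z'" "Ys = drop (length U) Z'"
  have Z': "Z = Y # Xs @ Ys"
    by (simp add: Z Xs_Ys_def)
  have "chain U Xs \<noteq> (0 :: ('x, 'k) tensor) \<and> chain W Ys \<noteq> (0 :: ('x, 'k) tensor) \<and> splittings e Y \<noteq> {} \<and> c \<noteq> Xi"
  proof (rule ccontr)
    assume contra: "\<not> ?thesis"
    have "t = 0"
      using assms(1)
    proof
      assume t: "t = left_cut (x # U) (y # W) Z"
      from contra show ?thesis
        unfolding t x y Z left_cut.simps Xs_Ys_def[symmetric]
        by (auto simp: two_chains_def)
    next
      assume t: "t = right_cut (x # U) (y # W) Z"
      from contra show ?thesis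
        unfolding t x y Z right_cut.simps Xs_Ys_def[symmetric]
        by (auto simp: cut_sum_def)
    qed
    with assms(2) show False ..
  qed
  moreover from this have "length Y = gdeg e"
    using splittings_length by blast
  ultimately show ?thesis
    using that[OF Z'] chain_degree by (auto simp: x y)
qed

lemmas left_cut_support = cut_support[OF disjI1[OF refl]]
  and right_cut_support = cut_support[OF disjI2[OF refl]]

lemma well_shaped_cuts:
  "well_shaped (left_cut U W :: ('a, 'b::field) operation)"
  "well_shaped (right_cut U W :: ('a, 'b) operation)"
proof -
  have "f [] = 0" if "f = left_cut U W \<or> f = right_cut U W" for f :: "('a, 'b) operation"
    using that by (cases U; cases W) auto
  moreover have "length v = length Z" if v: "v \<in> keys (left_cut U W Z :: ('a, 'b) tensor)" for v Z
  proof -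
    obtain c u U' e w W' where UW: "U = (c, u) # U'" "W = (e, w) # W'"
      using v by (cases "(U, W, Z)" rule: left_cut.cases) auto
    obtain Y Xs Ys where Z: "Z = Y # Xs @ Ys" "length Xs = length U'" "length Ys = length W'"
      using v unfolding UW by (metis cut_support keys_zero empty_iff)
    then show ?thesis
      using v by (auto simp: UW case_prod_unfold length_join_pos dest!: keys_sum_in elim!: keys_two_chains)
  qed
  moreover have "length v = length Z" if v: "v \<in> keys (right_cut U W Z :: ('a, 'b) tensor)" for v Z
  proof -
    obtain c u U' e w W' where UW: "U = (c, u) # U'" "W = (e, w) # W'"
      using v by (cases "(U, W, Z)" rule: right_cut.cases) auto
    obtain Y Xs Ys where Z: "Z = Y # Xs @ Ys" "length Xs = length U'" "length Ys = length W'"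
      using v unfolding UW by (metis cut_support keys_zero empty_iff)
    have "v \<in> keys (\<Sum>(a, b)\<in>splittings e Y. lin_ext (\<lambda>y.
       cut_sum c (\<lambda>p z. lin_map (\<lambda>x. join [a @ w @ p @ u] (join x z)) (chain U' Xs :: ('a, 'b) tensor))
         (join y [b])) (chain W' Ys))"
      using v by (simp add: UW Z)
    then obtain a b where "v \<in> keys (lin_ext (\<lambda>y.
       cut_sum c (\<lambda>p z. lin_map (\<lambda>x. join [a @ w @ p @ u] (join x z)) (chain U' Xs :: ('a, 'b) tensor))
         (join y [b])) (chain W' Ys))"
      by (auto dest!: keys_sum_in)
    then obtain y where y: "y \<in> keys (chain W' Ys :: ('a, 'b) tensor)"
      "v \<in> keys (
       cut_sum c (\<lambda>p z. lin_map (\<lambda>x. join [a @ w @ p @ u] (join x z)) (chain U' Xs :: ('a, 'b) tensor))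
         (join y [b]))"
      by (auto dest!: keys_lin_ext)
    then obtain p q where "v \<in> keys (lin_map (\<lambda>x. join [a @ w @ p @ u]
        (join x (q # tl (join y [b])))) (chain U' Xs :: ('a, 'b) tensor))"
      unfolding cut_sum_def by (auto dest!: keys_sum_in)
    then obtain x where x: "x \<in> keys (chain U' Xs :: ('a, 'b) tensor)"
      "v = join [a @ w @ p @ u] (join x (q # tl (join y [b])))"
      by (auto dest!: subsetD[OF keys_lin_map])
    then show ?thesis
      using keys_chain[OF y(1)] keys_chain[OF x(1)] x(2) by (auto simp: Z length_join_pos)
  qed
  ultimately show "well_shaped (left_cut U W :: ('a, 'b) operation)"
    "well_shaped (right_cut U W :: ('a, 'b) operation)"
    by (auto intro!: well_shapedI)
qed

text \<open>
  The sign is that of moving the first \<open>length U + 1\<close> blocks past the others.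
\<close>

lemma rot_power_right_cut:
  "(rot d length ^^ Suc (length U)) (right_cut (x # U) (y # W) :: ('x, 'k::field) operation) =
    cscale (ksign ((int (gdeg (fst y)) + mdeg U) * mdeg W + (d - 1) * int (length U + length W) * int (Suc (length U))))
      (left_cut (W @ [y]) (x # U))" (is "?L = cscale (ksign ?e) ?R")
proof
  fix Z :: "'x word list list"
  show "?L Z = cscale (ksign ?e) ?R Z"
  proof (cases "length Z = Suc (length U + length W)")
    case False
    have "?L Z = 0"
    proof (rule ccontr)
      assume "?L Z \<noteq> 0"
      then have "length Z = Suc (length U + length W)"
        by (rule rot_power_support[rotated 2]) (auto elim!: right_cut_support)
      with False show False ..
    qed
    moreover have "?R Z = 0"
    proof (rule ccontr)
      assume nz: "?R Z \<noteq> 0"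
      obtain z T where zT: "W @ [y] = z # T"
        by (cases "W @ [y]") auto
      have "length T = length W"
        using arg_cong[OF zT, of length] by simp
      with nz have "length Z = Suc (length U + length W)"
        unfolding zT by (auto elim!: left_cut_support)
      with False show False ..
    qed
    ultimately show ?thesis
      by (simp add: cscale_def)
  next
    case True
    define Ys where "Ys = take (length W) Z"
    obtain Y Xs where YXs: "drop (length W) Z = Y # Xs"
      using True by (cases "drop (length W) Z") auto
    have Z: "Z = Ys @ Y # Xs"
      by (metis YXs Ys_def append_take_drop_id)
    have len: "length Ys = length W" "length Xs = length U"
      using True arg_cong[OF YXs, of length] by (simp_all add: Ys_def)
    have "?L Z = scale (ksign (inputs (Y # Xs) * inputs Ys
        + (d - 1) * (int (length Ys + length (Y # Xs)) - 1) * int (Suc (length U))))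
      (lin_map (rotate (Suc (length U))) (right_cut (x # U) (y # W) (Y # Xs @ Ys)))"
      unfolding Z by (subst rot_power_append) (simp_all add: len)
    moreover have "?R Z = lin_map (rotate (Suc (length U))) (right_cut (x # U) (y # W) (Y # Xs @ Ys))"
      using left_cut_rotate1[OF len(2,1), of "fst y" "snd y" "fst x" "snd x" Y] by (simp add: Z)
    moreover have "inputs (Y # Xs) * inputs Ys
        + (d - 1) * (int (length Ys + length (Y # Xs)) - 1) * int (Suc (length U)) = ?e"
      if nonzero: "right_cut (x # U) (y # W) (Y # Xs @ Ys) \<noteq> (0 :: ('x, 'k) tensor)"
    proof -
      obtain Y' Xs' Ys' where *: "Y # Xs @ Ys = Y' # Xs' @ Ys'" "length Xs' = length U" "length Ys' = length W"
        "inputs Xs' = mdeg U" "inputs Ys' = mdeg W" "length Y' = gdeg (fst y)" "fst x \<noteq> Xi"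
        using nonzero by (rule right_cut_support)
      then have "Y' = Y" "Xs' = Xs" "Ys' = Ys"
        using len by auto
      with * len show ?thesis
        by (simp add: algebra_simps)
    qed
    ultimately show ?thesis
      by (cases "right_cut (x # U) (y # W) (Y # Xs @ Ys) = (0 :: ('x, 'k) tensor)")
        (simp_all add: cscale_def)
  qed
qed

definition glue_exp :: "int \<Rightarrow> 'x monomial \<Rightarrow> 'x monomial \<Rightarrow> int" where
  "glue_exp d U W = mdeg (tl U) * (mdeg (tl W) + (d - 1) * (int (length W) - 1))"

text \<open>
  Here \<open>nu + 1\<close> and \<open>mu + 1\<close> are the numbers of letters of \<open>U\<close> and \<open>W\<close>, \<open>n + 1\<close> and
  \<open>m\<close> their degrees, \<open>e\<close> and \<open>w\<close> are the degrees of the first letter of \<open>W\<close> and of the other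
  ones, and \<open>D = d - 1\<close>. The terms are, in this order, the sign exponents of \<open>U \<circ> W\<close>, of the rotation
  that identifies the double derivatives, of the bracket, of rotating \<open>W\<close> by one place, and of
  \<open>W \<circ> U\<close>.
\<close>

lemma exchange_parity:
  fixes n e w D nu mu m :: int
  assumes "m = e + w"
  shows "even (n * (w + D * mu) + ((e + n) * w + D * (nu + mu) * (nu + 1))
    - ((n + D * nu) * (m - 1 + D * mu) + (e * w + D * mu) + (m - 1) * (n + D * nu)))"
  unfolding assms by (simp add: even_add even_diff) blast

text \<open>
  The parity lemma needs the two letters that differentiate the common input to be odd. If one of
  them is \<open>\<xi>\<close>, both sides vanish.
\<close>

lemma symmetrize_cut_exchange:
  fixes U W :: "'x monomial"
  assumes "U \<noteq> []" "W \<noteq> []"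
  shows "cscale (ksign (glue_exp d U W)) (symmetrize d length (right_cut U W)) =
    cscale (ksign (mono_lie_deg d U * mono_lie_deg d W + rotate_exp d 1 W + glue_exp d (rotate1 W) U))
      (symmetrize d length (left_cut (rotate1 W) U) :: ('x, 'k::field) operation)"
proof -
  obtain x U' where U: "U = x # U'"
    using assms by (cases U) auto
  obtain y W' where W: "W = y # W'"
    using assms by (cases W) auto
  obtain z T where zT: "W' @ [y] = z # T"
    by (cases "W' @ [y]") auto
  let ?e = "(int (gdeg (fst y)) + mdeg U') * mdeg W' + (d - 1) * int (length U' + length W') * int (Suc (length U'))"
  let ?R = "right_cut U W :: ('x, 'k) operation"
  let ?L = "left_cut (rotate1 W) U :: ('x, 'k) operation"
  have ex: "(rot d length ^^ Suc (length U')) ?R = cscale (ksign ?e) ?L"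
    unfolding U W rotate1.simps by (rule rot_power_right_cut)
  then have sym: "symmetrize d length ?R = cscale (ksign ?e) (symmetrize d length ?L)"
    by (metis symmetrize_rot_power well_shaped_cuts(2) symmetrize_cscale)
  show ?thesis
  proof (cases "?L = 0")
    case True
    then show ?thesis
      by (simp only: sym symmetrize_zero cscale_zero)
  next
    case False
    then obtain Z where "?L Z \<noteq> 0"
      by (metis ext zero_fun_apply)
    then have z: "fst z \<noteq> Xi"
      unfolding U W rotate1.simps zT by (auto elim: left_cut_support)
    have "?R \<noteq> 0"
    proof
      assume "?R = 0"
      then have "cscale (ksign ?e) ?L = 0"
        using ex by (simp only: rot_power_zero)
      then have "cscale (ksign ?e * ksign ?e) ?L = 0"
        by (simp only: cscale_zero flip: cscale_cscale)
      then show False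
        using False by (simp add: ksign_def split: if_splits)
    qed
    then obtain Z where "?R Z \<noteq> 0"
      by (metis ext zero_fun_apply)
    then have x: "fst x \<noteq> Xi"
      unfolding U W by (auto elim: right_cut_support)
    have degs: "gdeg (fst x) = 1" "gdeg (fst z) = 1"
      using x z by (metis gdeg.simps(2) gen.exhaust)+
    have "mdeg (W' @ [y]) = mdeg (z # T)"
      by (simp only: zT)
    then have T: "mdeg T = int (gdeg (fst y)) + mdeg W' - 1"
      using degs by simp
    have "ksign (glue_exp d U W) * ksign ?e =
      (ksign (mono_lie_deg d U * mono_lie_deg d W + rotate_exp d 1 W + glue_exp d (rotate1 W) U) :: 'k)"
      unfolding ksign_add[symmetric]
    proof (rule ksign_cong)
      have rotW: "rotate1 W = z # T"
        by (simp add: W zT)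
      show "even (glue_exp d U W + ?e - (mono_lie_deg d U * mono_lie_deg d W + rotate_exp d 1 W + glue_exp d (rotate1 W) U))"
        using exchange_parity[OF refl, of "mdeg U'" "mdeg W'" "d - 1" "int (length W')" "int (gdeg (fst y))" "int (length U')"]
        unfolding glue_exp_def rotW
        by (simp add: mono_lie_deg_def lie_deg_def rotate_exp_def T degs U W)
    qed
    then show ?thesis
      by (simp add: sym)
  qed
qed

section \<open>The bracket of two cyclic monomials\<close>

lemma Phi_unsym_support:
  assumes "Phi_unsym U X \<noteq> (0 :: ('x, 'k::field) tensor)"
  shows "length X = length U \<and> inputs X = mdeg U \<and> (\<forall>B\<in>set X. length B \<le> 1)"
proof -
  have len: "length X = length U"
    using assms by (auto simp: Phi_unsym_def split: if_splits)
  obtain l where l: "l \<in> msplits U X"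
    using assms unfolding Phi_unsym_def
    by (metis (mono_tags, lifting) sum.not_neutral_contains_not_neutral)
  have "map length X = map gdeg (map fst U)"
    using msplits_degrees[OF l] len by simp
  moreover have "gdeg c \<le> 1" for c :: "'x gen"
    by (cases c) auto
  ultimately have "length B \<le> 1" if "B \<in> set X" for B
    using that by (metis (no_types, lifting) imageE image_eqI list.set_map)
  then show ?thesis
    using len msplits_total_deg[OF l] by simp
qed

lemma Phi_mono_support:
  assumes "Phi_mono d U X \<noteq> (0 :: ('x, 'k::field) tensor)"
  shows "length X = length U \<and> inputs X = mdeg U \<and> (\<forall>B\<in>set X. length B \<le> 1)"
  using _ _ assms unfolding Phi_mono_def
proof (rule symmetrize_support)
  show "length X = length U \<and> inputs X = mdeg U \<and> (\<forall>B\<in>set X. length B \<le> 1)"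
    if "Phi_unsym U X \<noteq> (0 :: ('x, 'k) tensor)" for X
    using Phi_unsym_support[OF that] .
  show "length X = length U \<and> inputs X = mdeg U \<and> (\<forall>B\<in>set X. length B \<le> 1)"
    if "length (rotr X) = length U \<and> inputs (rotr X) = mdeg U \<and> (\<forall>B\<in>set (rotr X). length B \<le> 1)" for X
    using that by (cases X rule: rev_cases) auto
qed

lemma Phi_mono_invariant: "U \<noteq> [] \<Longrightarrow> Phi_mono d U \<in> invariants d length"
  unfolding Phi_mono_def by (intro symmetrize_invariant well_shaped_Phi_unsym)

lemma mdeg_rotate [simp]: "mdeg (rotate s U) = mdeg U"
proof (induction s)
  case (Suc s)
  have "mdeg (rotate1 V) = mdeg V" for V :: "'a monomial"
    by (cases V) auto
  with Suc show ?case by simp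
qed simp

lemma rotate_exp_Suc:
  assumes "s < length U"
  shows "even (rotate_exp d (Suc s) U - (rotate_exp d s U + rotate_exp d 1 (rotate s U)))"
proof -
  define P y Q where "P = take s U" "y = U ! s" "Q = drop (Suc s) U"
  have U: "U = P @ y # Q" and s: "s = length P"
    using assms by (simp_all add: P_y_Q_def id_take_nth_drop)
  have "rotate s U = y # Q @ P"
    by (simp add: U s rotate_append)
  then show ?thesis
    by (simp add: rotate_exp_def U s algebra_simps)
qed

lemma rot_power_Phi_unsym:
  assumes "s \<le> length U"
  shows "(rot d length ^^ s) (Phi_unsym U :: ('x, 'k::field) operation) =
    cscale (ksign (rotate_exp d s U)) (Phi_unsym (rotate s U))"
  using assms
proof (induction s)
  case 0
  then show ?case by (simp add: rotate_exp_def)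
next
  case (Suc s)
  then have "rotate s U \<noteq> []"
    by auto
  then obtain y V where V: "rotate s U = y # V"
    by (cases "rotate s U") auto
  have len: "length V = length U - 1"
    using arg_cong[OF V, of length] by simp
  have exp: "int (gdeg (fst y)) * mdeg V + (d - 1) * int (length V) = rotate_exp d 1 (rotate s U)"
    by (simp add: rotate_exp_def V)
  have "(rot d length ^^ Suc s) (Phi_unsym U :: ('x, 'k) operation) =
      cscale (ksign (rotate_exp d s U)) (rot d length (Phi_unsym (y # V)))"
    using Suc V by (simp add: rot_cscale)
  also have "\<dots> = cscale (ksign (rotate_exp d s U + rotate_exp d 1 (rotate s U))) (Phi_unsym (V @ [y]))"
    by (simp only: rot_Phi_unsym exp cscale_cscale ksign_add)
  also have "V @ [y] = rotate (Suc s) U"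
    by (simp add: V)
  also have "ksign (rotate_exp d s U + rotate_exp d 1 (rotate s U)) = (ksign (rotate_exp d (Suc s) U) :: 'k)"
    using rotate_exp_Suc[of s U d] Suc.prems by (intro ksign_cong[symmetric]) simp
  finally show ?case .
qed

subsection \<open>Reduction to a sum over rotations\<close>

lemma graft_Nil: "graft [] [] Xs (Y # Ys) = Y # Xs @ Ys"
  by (cases Ys) auto

lemma graft_sizes:
  assumes "Ys \<noteq> []"
  shows "length (graft L R Xs Ys) = length Xs + length Ys"
    "sum_list (map length (graft L R Xs Ys)) =
      length L + length R + sum_list (map length Xs) + sum_list (map length Ys)"
    "\<Union> (set ` set (graft L R Xs Ys)) = set L \<union> set R \<union> \<Union> (set ` set Xs) \<union> \<Union> (set ` set Ys)"
  using assms by (cases "(L, R, Xs, Ys)" rule: graft.cases; auto)+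

lemma finite_grafts: "finite (grafts Z)"
proof -
  let ?n = "sum_list (map length Z)"
  let ?A = "{xs. set xs \<subseteq> \<Union> (set ` set Z) \<and> length xs \<le> ?n}"
  let ?B = "{Xs. set Xs \<subseteq> ?A \<and> length Xs \<le> length Z}"
  have A: "finite ?A"
    by (rule finite_lists_length_le) auto
  have B: "finite ?B"
    by (rule finite_lists_length_le[OF A])
  have "grafts Z \<subseteq> ?A \<times> ?A \<times> ?B \<times> ?B"
  proof
    fix q
    assume "q \<in> grafts Z"
    then obtain L R Xs Ys where q: "q = (L, R, Xs, Ys)" "Ys \<noteq> []" "graft L R Xs Ys = Z"
      by (auto simp: grafts_def)
    note sizes = graft_sizes[OF q(2), of L R Xs, unfolded q(3)]
    have "length X \<le> ?n" if "X \<in> set Xs \<union> set Ys" for X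
      using that member_le_sum_list[of "length X" "map length Xs"]
        member_le_sum_list[of "length X" "map length Ys"] sizes(2) by auto
    then show "q \<in> ?A \<times> ?A \<times> ?B \<times> ?B"
      using sizes q(1) by auto
  qed
  then show ?thesis
    using A B by (meson finite_SigmaI finite_subset)
qed

lemma insertion_nonzero:
  assumes "insertion d f g (L, R, Xs, Ys) \<noteq> 0"
    and f: "\<And>X. f X \<noteq> 0 \<Longrightarrow> length X = N \<and> (\<forall>B\<in>set X. length B \<le> 1)"
    and g: "\<And>X. g X \<noteq> 0 \<Longrightarrow> length X = M"
  shows "L = [] \<and> R = [] \<and> Suc (length Xs) = N \<and> length Ys = M"
proof -
  have nz: "lin_ext (\<lambda>v. lin_map (\<lambda>w. w @ tl v) (f ((L @ [hd v] @ R) # Xs))) (g Ys) \<noteq> 0"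
    using assms(1) by (auto simp: insertion_def)
  then have "g Ys \<noteq> 0"
    by auto
  obtain v where "lin_map (\<lambda>w. w @ tl v) (f ((L @ [hd v] @ R) # Xs)) \<noteq> 0"
    using nz lin_ext_fun_zero[of "g Ys"] by (metis (no_types, lifting) lin_ext_cong)
  then have "f ((L @ [hd v] @ R) # Xs) \<noteq> 0"
    by auto
  from f[OF this] g[OF \<open>g Ys \<noteq> 0\<close>] show ?thesis
    by auto
qed

lemma insertion_composite:
  "insertion d f g ([], [], Xs, Y # Ys) = composite d (Suc (length Xs)) f g (Y # Xs @ Ys)"
proof -
  have "graft_exp d [] [] Xs (Y # Ys) = inputs Xs * (inputs Ys + (d - 1) * int (length Ys))"
    by (cases Ys) (simp_all add: graft_exp_def algebra_simps)
  then show ?thesis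
    by (simp add: insertion_def composite_Cons)
qed

text \<open>
  An inserted word that shares its block with other entries contributes nothing, so the parts \<open>L\<close>
  and \<open>R\<close> of the block are empty and the remaining blocks are determined by the numbers of outputs.
\<close>

lemma circ_eq_composite:
  fixes f g :: "('x, 'k::field) operation"
  assumes f: "\<And>X. f X \<noteq> 0 \<Longrightarrow> length X = N \<and> (\<forall>B\<in>set X. length B \<le> 1)"
    and g: "\<And>X. g X \<noteq> 0 \<Longrightarrow> length X = M"
    and pos: "0 < N" "0 < M"
  shows "circ d f g = symmetrize d length
    (\<Sum>s<N. \<Sum>t<M. composite d N ((rot d length ^^ s) f) ((rot d length ^^ t) g))"
proof -
  let ?f = "\<lambda>s. (rot d length ^^ s) f" and ?g = "\<lambda>t. (rot d length ^^ t) g"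
  have fs: "length X = N \<and> (\<forall>B\<in>set X. length B \<le> 1)" if "?f s X \<noteq> 0" for s X
    using f _ that
  proof (rule rot_power_support)
    show "length X = N \<and> (\<forall>B\<in>set X. length B \<le> 1)"
      if "length (rotr X) = N \<and> (\<forall>B\<in>set (rotr X). length B \<le> 1)" for X :: "'x word list list"
      using that by (cases X rule: rev_cases) auto
  qed
  have gt: "length X = M" if "?g t X \<noteq> 0" for t X
    using g _ that by (rule rot_power_support) simp_all
  let ?S = "\<lambda>(L, R, Xs, Ys). \<Sum>s<Suc (length Xs). \<Sum>t<length Ys. insertion d (?f s) (?g t) (L, R, Xs, Ys)"
  have "(\<Sum>q\<in>grafts Z. ?S q) = (\<Sum>s<N. \<Sum>t<M. composite d N (?f s) (?g t) Z)" for Z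
  proof (cases Z)
    case Nil
    have "grafts [] = ({} :: ('x word list \<times> 'x word list \<times> 'x word list list \<times> 'x word list list) set)"
    proof (rule ccontr)
      assume "grafts [] \<noteq> ({} :: ('x word list \<times> 'x word list \<times> 'x word list list \<times> 'x word list list) set)"
      then obtain L R Xs and Ys :: "'x word list list" where "Ys \<noteq> []" "graft L R Xs Ys = []"
        by (auto simp: grafts_def)
      then show False
        using graft_sizes(1)[of Ys L R Xs] by auto
    qed
    with Nil show ?thesis
      by simp
  next
    case (Cons Y Z')
    define Xs Ys where "Xs = take (N - 1) Z'" "Ys = drop (N - 1) Z'"
    have Z: "Z = Y # Xs @ Ys"
      by (simp add: Cons Xs_Ys_def)
    \<comment> \<open>the only graft that can contribute: it cuts \<open>Z\<close> behind the \<open>N\<close>-th block\<close>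
    let ?q = "([], [], Xs, Y # Ys)"
    have in_grafts: "?q \<in> grafts Z"
      by (simp add: grafts_def graft_Nil Z)
    have "?S q = 0" if q: "q \<in> grafts Z" "q \<noteq> ?q" for q
    proof -
      obtain L R Xs' Ys' where q': "q = (L, R, Xs', Ys')" "Ys' \<noteq> []" "graft L R Xs' Ys' = Z"
        using q(1) by (auto simp: grafts_def)
      have "insertion d (?f s) (?g t) (L, R, Xs', Ys') = 0" for s t
      proof (rule ccontr)
        assume "insertion d (?f s) (?g t) (L, R, Xs', Ys') \<noteq> 0"
        from insertion_nonzero[OF this fs gt] have *: "L = []" "R = []" "Suc (length Xs') = N" "length Ys' = M"
          by auto
        obtain Y' Ys'' where Ys': "Ys' = Y' # Ys''"
          using q'(2) by (cases Ys') auto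
        have "Y' # Xs' @ Ys'' = Y # Z'"
          using q'(3) by (simp add: *(1,2) Ys' graft_Nil Cons)
        then have "Xs' = Xs" "Ys'' = Ys" "Y' = Y"
          using *(3) by (auto simp: Xs_Ys_def)
        with q(2) show False
          by (simp add: q'(1) * Ys')
      qed
      then show ?thesis
        by (simp add: q'(1))
    qed
    then have "(\<Sum>q\<in>grafts Z. ?S q) = (\<Sum>q\<in>{?q}. ?S q)"
      using in_grafts by (intro sum.mono_neutral_right finite_grafts) blast+
    also have "\<dots> = (\<Sum>s<Suc (length Xs). \<Sum>t<Suc (length Ys). insertion d (?f s) (?g t) ?q)"
      by simp
    also have "\<dots> = (\<Sum>s<N. \<Sum>t<M. composite d N (?f s) (?g t) Z)"
    proof (cases "Suc (length Xs) = N \<and> Suc (length Ys) = M")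
      case True
      then show ?thesis
        by (auto simp: insertion_composite Z intro!: sum.cong)
    next
      case False
      have "insertion d (?f s) (?g t) ?q = 0" for s t
        using insertion_nonzero[of d "?f s" "?g t" _ _ Xs "Y # Ys", OF _ fs gt] False by fastforce
      moreover have "composite d N (?f s) (?g t) Z = 0" for s t
      proof (cases "Suc (length Xs) = N")
        case True
        then have "?g t (Y # Ys) = 0"
          using gt[of t "Y # Ys"] False by auto
        then show ?thesis
          unfolding Cons composite_Cons' Xs_Ys_def[symmetric] by simp
      next
        case False
        then have "?f s ([h] # Xs) = 0" for h
          using fs[of s "[h] # Xs"] by auto
        then show ?thesis
          unfolding Cons composite_Cons' Xs_Ys_def[symmetric] by simp
      qed
      ultimately show ?thesis
        by simp
    qed
    finally show ?thesis .
  qed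
  then have "(\<lambda>Z. \<Sum>(L, R, Xs, Ys)\<in>grafts Z. \<Sum>s<Suc (length Xs). \<Sum>t<length Ys.
       insertion d (?f s) (?g t) (L, R, Xs, Ys)) =
    (\<Sum>s<N. \<Sum>t<M. composite d N (?f s) (?g t))"
    by (simp add: fun_eq_iff sum_fun_apply)
  then show ?thesis
    by (simp only: circ_def)
qed

text \<open>
  The rotations of an invariant operation are all equal to it; their sum therefore undoes the
  normalization of the symmetrization.
\<close>

lemma sum_rot_power_Phi_mono:
  fixes U :: "'x monomial"
  assumes "U \<noteq> []"
  shows "(\<Sum>s<length U. (rot d length ^^ s) (Phi_mono d U :: ('x, 'k::field_char_0) operation)) =
    (\<Sum>s<length U. cscale (ksign (rotate_exp d s U)) (Phi_unsym (rotate s U)))"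
proof
  fix X :: "'x word list list"
  have "(\<Sum>s<length U. (rot d length ^^ s) (Phi_mono d U :: ('x, 'k) operation)) X =
      scale (of_nat (length U)) (Phi_mono d U X)"
    by (simp add: rot_power_invariant[OF Phi_mono_invariant[OF assms]] sum_fun_apply sum_const_scale)
  also have "\<dots> = (\<Sum>s<length U. (rot d length ^^ s) (Phi_unsym U) X)"
  proof (cases "length X = length U")
    case True
    then show ?thesis
      using assms by (simp add: Phi_mono_def symmetrize_def)
  next
    case False
    then have "Phi_mono d U X = (0 :: ('x, 'k) tensor)"
      using Phi_mono_support by blast
    moreover have "(rot d length ^^ s) (Phi_unsym U) X = (0 :: ('x, 'k) tensor)" for s
    proof (rule ccontr)
      assume "(rot d length ^^ s) (Phi_unsym U) X \<noteq> (0 :: ('x, 'k) tensor)"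
      then have "length X = length U"
        by (rule rot_power_support[rotated 2]) (auto dest: Phi_unsym_support)
      with False show False ..
    qed
    ultimately show ?thesis by simp
  qed
  finally show "(\<Sum>s<length U. (rot d length ^^ s) (Phi_mono d U :: ('x, 'k) operation)) X =
      (\<Sum>s<length U. cscale (ksign (rotate_exp d s U)) (Phi_unsym (rotate s U))) X"
    by (simp add: sum_fun_apply flip: rot_power_Phi_unsym)
qed

text \<open>
  The sum over all choices of a letter of \<open>U\<close> and of a word of \<open>W\<close>, with the signs of bringing
  them to the front. \<open>U \<circ> W\<close>, its gluing part and its double derivatives all have this form.
\<close>

definition rotation_sum ::
    "int \<Rightarrow> ('x monomial \<Rightarrow> 'x monomial \<Rightarrow> ('x, 'k::field) operation) \<Rightarrow> 'x monomial \<Rightarrow> 'x monomial \<Rightarrow> ('x, 'k) operation" where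
  "rotation_sum d F U W = (\<Sum>s<length U. \<Sum>t<length W.
     cscale (ksign (rotate_exp d s U + rotate_exp d t W + glue_exp d (rotate s U) (rotate t W)))
       (symmetrize d length (F (rotate s U) (rotate t W))))"

definition glue_sum :: "'x monomial \<Rightarrow> 'x monomial \<Rightarrow> ('x, 'k::field) operation" where
  "glue_sum U W = (\<Sum>k | k < length (snd (hd W)) \<and> fst (hd U) = Delta (snd (hd W) ! k).
     Phi_unsym (glue_word U W k))"

lemma composite_monomials:
  assumes "U \<noteq> []" "W \<noteq> []"
  shows "composite d (length U) (Phi_unsym U) (Phi_unsym W) =
    cscale (ksign (glue_exp d U W)) (glue_sum U W + left_cut U W + right_cut U W)"
proof -
  obtain c u U' e v W' where "U = (c, u) # U'" "W = (e, v) # W'"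
    using assms by (metis list.exhaust surj_pair)
  then show ?thesis
    using composite_Phi_unsym[of d U' c u e v W'] by (simp add: glue_exp_def glue_sum_def)
qed

lemma rotation_sum_add: "rotation_sum d (\<lambda>U W. F U W + G U W) U W = rotation_sum d F U W + rotation_sum d G U W"
  by (simp add: rotation_sum_def symmetrize_add cscale_add sum.distrib)

lemma circ_Phi_mono:
  fixes U W :: "'x monomial"
  assumes "U \<noteq> []" "W \<noteq> []"
  shows "circ d (Phi_mono d U) (Phi_mono d W :: ('x, 'k::field_char_0) operation) =
    rotation_sum d glue_sum U W + rotation_sum d left_cut U W + rotation_sum d right_cut U W"
proof -
  let ?N = "length U" and ?M = "length W"
  let ?r = "\<lambda>s. rot d length ^^ s :: ('x, 'k) operation \<Rightarrow> _"
  have "circ d (Phi_mono d U) (Phi_mono d W) =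
      symmetrize d length (\<Sum>s<?N. \<Sum>t<?M. composite d ?N (?r s (Phi_mono d U)) (?r t (Phi_mono d W)))"
    using assms by (intro circ_eq_composite) (auto dest: Phi_mono_support)
  also have "(\<Sum>s<?N. \<Sum>t<?M. composite d ?N (?r s (Phi_mono d U)) (?r t (Phi_mono d W))) =
      composite d ?N (\<Sum>s<?N. ?r s (Phi_mono d U)) (\<Sum>t<?M. ?r t (Phi_mono d W))"
    unfolding composite_sum(1) unfolding composite_sum(2) ..
  also have "\<dots> = (\<Sum>s<?N. \<Sum>t<?M. cscale (ksign (rotate_exp d s U) * ksign (rotate_exp d t W))
      (composite d ?N (Phi_unsym (rotate s U)) (Phi_unsym (rotate t W))))"
    unfolding sum_rot_power_Phi_mono[OF assms(1)] sum_rot_power_Phi_mono[OF assms(2)] composite_sum(1)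
    unfolding composite_sum(2) composite_cscale cscale_cscale by (simp only: mult.commute)
  also have "\<dots> = (\<Sum>s<?N. \<Sum>t<?M. cscale (ksign (rotate_exp d s U + rotate_exp d t W
        + glue_exp d (rotate s U) (rotate t W)))
      (glue_sum (rotate s U) (rotate t W) + left_cut (rotate s U) (rotate t W) + right_cut (rotate s U) (rotate t W)))"
  proof (intro sum.cong refl)
    fix s t
    have "composite d ?N (Phi_unsym (rotate s U)) (Phi_unsym (rotate t W) :: ('x, 'k) operation) =
      cscale (ksign (glue_exp d (rotate s U) (rotate t W)))
        (glue_sum (rotate s U) (rotate t W) + left_cut (rotate s U) (rotate t W) + right_cut (rotate s U) (rotate t W))"
      using composite_monomials[of "rotate s U" "rotate t W" d] assms by simp
    then show "cscale (ksign (rotate_exp d s U) * ksign (rotate_exp d t W))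
      (composite d ?N (Phi_unsym (rotate s U)) (Phi_unsym (rotate t W) :: ('x, 'k) operation)) =
      cscale (ksign (rotate_exp d s U + rotate_exp d t W + glue_exp d (rotate s U) (rotate t W)))
      (glue_sum (rotate s U) (rotate t W) + left_cut (rotate s U) (rotate t W) + right_cut (rotate s U) (rotate t W))"
      by (simp only: cscale_cscale ksign_add)
  qed
  also have "symmetrize d length \<dots> =
      rotation_sum d (\<lambda>U W. glue_sum U W + left_cut U W + right_cut U W) U W"
    by (simp only: rotation_sum_def symmetrize_sum symmetrize_cscale)
  finally show ?thesis
    by (simp only: rotation_sum_add)
qed

text \<open>
  The double derivative belonging to the word number \<open>t\<close> of \<open>W\<close> on the left side belongs to
  the word number \<open>t + 1\<close> on the right side; the sum over all words is not affected by the shift.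
\<close>

lemma rotation_sum_exchange:
  fixes U W :: "'x monomial"
  assumes "U \<noteq> []" "W \<noteq> []"
  shows "rotation_sum d right_cut U W =
    cscale (ksign (mono_lie_deg d U * mono_lie_deg d W)) (rotation_sum d left_cut W U :: ('x, 'k::field) operation)"
proof -
  let ?l = "mono_lie_deg d U * mono_lie_deg d W"
  let ?F = "\<lambda>s t. cscale (ksign (?l + (rotate_exp d t W + rotate_exp d s U + glue_exp d (rotate t W) (rotate s U))))
      (symmetrize d length (left_cut (rotate t W) (rotate s U))) :: ('x, 'k) operation"
  have lie: "mono_lie_deg d (rotate s V) = mono_lie_deg d V" for s and V :: "'x monomial"
    by (simp add: mono_lie_deg_def)
  have step: "cscale (ksign (rotate_exp d s U + rotate_exp d t W + glue_exp d (rotate s U) (rotate t W)))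
       (symmetrize d length (right_cut (rotate s U) (rotate t W))) = ?F s (Suc t)" if "t < length W" for s t
  proof -
    have "cscale (ksign (rotate_exp d s U + rotate_exp d t W + glue_exp d (rotate s U) (rotate t W)))
       (symmetrize d length (right_cut (rotate s U) (rotate t W))) =
      cscale (ksign (rotate_exp d s U + rotate_exp d t W)) (cscale (ksign (glue_exp d (rotate s U) (rotate t W)))
       (symmetrize d length (right_cut (rotate s U) (rotate t W) :: ('x, 'k) operation)))"
      by (simp add: ksign_add)
    also have "\<dots> = cscale (ksign (rotate_exp d s U + rotate_exp d t W)
        * ksign (?l + rotate_exp d 1 (rotate t W) + glue_exp d (rotate (Suc t) W) (rotate s U)))
      (symmetrize d length (left_cut (rotate (Suc t) W) (rotate s U)))"
    proof -
      have nonempty: "rotate s U \<noteq> []" "rotate t W \<noteq> []"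
        using assms by simp_all
      show ?thesis
        unfolding symmetrize_cut_exchange[OF nonempty] lie
        unfolding rotate_Suc cscale_cscale ..
    qed
    also have "ksign (rotate_exp d s U + rotate_exp d t W)
        * ksign (?l + rotate_exp d 1 (rotate t W) + glue_exp d (rotate (Suc t) W) (rotate s U)) =
      (ksign (?l + (rotate_exp d (Suc t) W + rotate_exp d s U + glue_exp d (rotate (Suc t) W) (rotate s U))) :: 'k)"
    proof (subst ksign_add[symmetric], rule ksign_cong)
      show "even (rotate_exp d s U + rotate_exp d t W +
          (?l + rotate_exp d 1 (rotate t W) + glue_exp d (rotate (Suc t) W) (rotate s U)) -
          (?l + (rotate_exp d (Suc t) W + rotate_exp d s U + glue_exp d (rotate (Suc t) W) (rotate s U))))"
        using rotate_exp_Suc[OF that, of d] by presburger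
    qed
    finally show ?thesis .
  qed
  \<comment> \<open>the letter that follows the last one of \<open>W\<close> is the first one; the full turn has an even exponent\<close>
  have period: "?F s (length W) = ?F s 0" for s
  proof -
    have "even (rotate_exp d (length W) W)" "rotate_exp d 0 W = 0"
      by (simp_all add: rotate_exp_def)
    then have "ksign (?l + (rotate_exp d (length W) W + rotate_exp d s U + glue_exp d W (rotate s U))) =
        (ksign (?l + (rotate_exp d 0 W + rotate_exp d s U + glue_exp d W (rotate s U))) :: 'k)"
      by (intro ksign_cong) simp
    then show ?thesis by simp
  qed
  have "rotation_sum d right_cut U W = (\<Sum>s<length U. \<Sum>t<length W. ?F s (Suc t))"
    unfolding rotation_sum_def by (intro sum.cong refl step) simp
  also have "\<dots> = (\<Sum>s<length U. \<Sum>t<length W. ?F s t)"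
  proof (rule sum.cong[OF refl])
    fix s
    have "?F s 0 + (\<Sum>t<length W. ?F s (Suc t)) = ?F s (length W) + (\<Sum>t<length W. ?F s t)"
      using sum.lessThan_Suc_shift[of "?F s" "length W"] sum.lessThan_Suc[of "?F s" "length W"]
      by (simp only: add.commute)
    then show "(\<Sum>t<length W. ?F s (Suc t)) = (\<Sum>t<length W. ?F s t)"
      by (simp only: period add_left_cancel)
  qed
  also have "\<dots> = (\<Sum>t<length W. \<Sum>s<length U. ?F s t)"
    by (rule sum.swap)
  also have "\<dots> = cscale (ksign ?l) (rotation_sum d left_cut W U)"
    by (simp add: rotation_sum_def cscale_sum ksign_add)
  finally show ?thesis .
qed

lemma Phi_glue:
  fixes U W :: "'x::finite monomial"
  shows "Phi d (glue d U W) = (rotation_sum d glue_sum U W :: ('x, 'k::field_char_0) operation)"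
proof -
  have "Phi d (glue d U W) = (\<Sum>s<length U. \<Sum>t<length W.
      \<Sum>k | k < length (snd (W ! t)) \<and> fst (U ! s) = Delta (snd (W ! t) ! k).
        cscale (ksign (rotate_exp d s U + rotate_exp d t W + glue_exp d (rotate s U) (rotate t W)))
          (symmetrize d length (Phi_unsym (glue_word (rotate s U) (rotate t W) k) :: ('x, 'k) operation)))"
    unfolding glue_def Let_def Phi_sum Phi_cscale
    by (simp add: Phi_cyc_mono glue_word_nonempty Phi_mono_def glue_exp_def)
  also have "\<dots> = rotation_sum d glue_sum U W"
  proof -
    have "hd (rotate s V) = V ! s" if "s < length V" for s and V :: "'x monomial"
      using that by (subst hd_rotate_conv_nth) auto
    then show ?thesis
      unfolding rotation_sum_def glue_sum_def symmetrize_sum cscale_sum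
      by (intro sum.cong refl) auto
  qed
  finally show ?thesis .
qed

lemma minus_cscale: "f - g = f + cscale (- 1) g" for f g :: "('b, 'x, 'k::field) cochain"
  by (simp add: fun_eq_iff plus_fun_apply cscale_def scale_minus)

lemma diff_cancel_crosswise: "(a + l + r) - (b + r + l) = a - b"
  for a b l r :: "'a::ab_group_add"
  by simp

text \<open>
  With \<open>G\<close> the gluing part, \<open>L\<close> the left cuts and \<open>e\<close> the sign of the bracket, the exchange of
  left and right cuts gives \<open>U \<circ> W = G U W + L U W + e L W U\<close>. As \<open>e\<^sup>2 = 1\<close>, the terms with \<open>L\<close>
  cancel.
\<close>

lemma commutator_Phi_mono:
  fixes U W :: "'x::finite monomial" and d :: int
  assumes "U \<noteq> []" "W \<noteq> []"
  defines "e \<equiv> ksign (mono_lie_deg d U * mono_lie_deg d W) :: 'k::field_char_0"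
  shows "circ d (Phi_mono d U) (Phi_mono d W) - cscale e (circ d (Phi_mono d W) (Phi_mono d U)) =
    Phi d (glue d U W - cscale e (glue d W U) :: ('x, 'k) small)"
proof -
  have ee: "e * e = 1"
    by (simp add: e_def ksign_def)
  define G where "G = (rotation_sum d glue_sum :: _ \<Rightarrow> _ \<Rightarrow> ('x, 'k) operation)"
  define L where "L = (rotation_sum d left_cut :: _ \<Rightarrow> _ \<Rightarrow> ('x, 'k) operation)"
  have R: "rotation_sum d right_cut U W = cscale e (L W U)" "rotation_sum d right_cut W U = cscale e (L U W)"
    using rotation_sum_exchange[OF assms(1,2), of d] rotation_sum_exchange[OF assms(2,1), of d]
    by (simp_all add: e_def L_def mult.commute)
  have "circ d (Phi_mono d U) (Phi_mono d W) - cscale e (circ d (Phi_mono d W) (Phi_mono d U)) =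
      (G U W + L U W + cscale e (L W U)) - cscale e (G W U + L W U + cscale e (L U W))"
    by (simp only: circ_Phi_mono[OF assms(1,2)] circ_Phi_mono[OF assms(2,1)] R G_def L_def)
  also have "\<dots> = G U W - cscale e (G W U)"
    unfolding cscale_add cscale_cscale ee cscale_one by (rule diff_cancel_crosswise)
  also have "\<dots> = Phi d (glue d U W - cscale e (glue d W U) :: ('x, 'k) small)"
    by (simp only: G_def minus_cscale Phi_add Phi_cscale Phi_glue)
  finally show ?thesis .
qed

section \<open>Closure under the bracket\<close>

lemma insertion_add:
  "insertion d (f + f') g q = insertion d f g q + insertion d f' g q"
  "insertion d f (g + g') q = insertion d f g q + insertion d f g' q"
  by (simp_all add: insertion_def plus_fun_apply lin_map_add lin_ext_fun_add lin_ext_add scale_add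
      split: prod.split)

lemma insertion_cscale:
  "insertion d (cscale a f) g q = scale a (insertion d f g q)"
  "insertion d f (cscale a g) q = scale a (insertion d f g q)"
  by (simp_all add: insertion_def cscale_def lin_map_scale lin_ext_fun_scale lin_ext_scale mult.commute
      split: prod.split)

lemma symmetrize_add_pointwise:
  "symmetrize d deg (\<lambda>Z. f Z + g Z) = symmetrize d deg f + symmetrize d deg g"
  using symmetrize_add[of d deg f g] by (simp only: plus_fun_def)

lemma symmetrize_scale_pointwise:
  "symmetrize d deg (\<lambda>Z. scale a (f Z)) = cscale a (symmetrize d deg f)"
  using symmetrize_cscale[of d deg a f] by (simp only: cscale_def)

lemma circ_add:
  "circ d (f + f') g = circ d f g + circ d f' g"
  "circ d f (g + g') = circ d f g + circ d f g'"
  unfolding circ_def rot_power_add insertion_add sum.distrib case_prod_unfold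
  by (rule symmetrize_add_pointwise)+

lemma circ_cscale:
  "circ d (cscale a f) g = cscale a (circ d f g)"
  "circ d f (cscale a g) = cscale a (circ d f g)"
  unfolding circ_def rot_power_cscale insertion_cscale case_prod_unfold scale_sum[symmetric]
  by (rule symmetrize_scale_pointwise)+

text \<open>
  The summand of the bracket in which the first operation has \<open>N\<close> outputs and \<open>n\<close> inputs and the
  second one \<open>M\<close> outputs and \<open>m\<close> inputs.
\<close>

definition commutator ::
    "int \<Rightarrow> nat \<Rightarrow> nat \<Rightarrow> nat \<Rightarrow> nat \<Rightarrow> ('x, 'k::field) operation \<Rightarrow> ('x, 'k) operation \<Rightarrow> ('x, 'k) operation" where
  "commutator d N n M m f g =
     circ d f g - cscale (ksign (lie_deg d (int N) (int n) * lie_deg d (int M) (int m))) (circ d g f)"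

lemma commutator_add:
  "commutator d N n M m (f + f') g = commutator d N n M m f g + commutator d N n M m f' g"
  "commutator d N n M m f (g + g') = commutator d N n M m f g + commutator d N n M m f g'"
  by (simp_all only: commutator_def circ_add cscale_add add_diff_add)

lemma commutator_cscale:
  "commutator d N n M m (cscale a f) g = cscale a (commutator d N n M m f g)"
  "commutator d N n M m f (cscale a g) = cscale a (commutator d N n M m f g)"
  by (simp_all only: commutator_def minus_cscale circ_cscale cscale_add cscale_cscale mult.commute
      mult.left_commute)

lemma commutator_zero: "commutator d N n M m 0 g = 0" "commutator d N n M m f 0 = 0"
  using commutator_cscale(1)[of d N n M m 0 0 g] commutator_cscale(2)[of d N n M m f 0 0]
  by simp_all

lemma bracket_eq_commutators:
  "bracket d f g Z = (\<Sum>N = 1..length Z. \<Sum>n\<le>Suc (sum_list (map length Z)).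
     commutator d N n (Suc (length Z) - N) (Suc (sum_list (map length Z)) - n)
       (component length N n f)
       (component length (Suc (length Z) - N) (Suc (sum_list (map length Z)) - n) g) Z)"
  by (simp add: bracket_def commutator_def Let_def cscale_def)

lemma component_homogeneous:
  assumes "homogeneous deg N n f"
  shows "component deg N' n' f = (if N' = N \<and> n' = n then f else 0)"
  using assms by (fastforce simp: fun_eq_iff component_def homogeneous_def zero_fun_apply)

lemma bracket_homogeneous:
  assumes f: "homogeneous length N n f" and g: "homogeneous length M m g" and "0 < M" "0 < N"
    and supp: "\<And>Z. commutator d N n M m f g Z \<noteq> 0 \<Longrightarrow>
      Suc (length Z) = N + M \<and> Suc (sum_list (map length Z)) = n + m"
  shows "bracket d f g = commutator d N n M m f g"
proof
  fix Z :: "'a word list list"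
  let ?l = "length Z" and ?r = "sum_list (map length Z)"
  let ?C = "Suc ?l = N + M \<and> Suc ?r = n + m"
  have summand: "commutator d N' n' (Suc ?l - N') (Suc ?r - n') (component length N' n' f)
       (component length (Suc ?l - N') (Suc ?r - n') g) Z =
      (if N' = N then if n' = n then if ?C then commutator d N n M m f g Z else 0 else 0 else 0)"
    if "N' \<in> {1..?l}" "n' \<in> {..Suc ?r}" for N' n'
  proof (cases "N' = N \<and> n' = n")
    case False
    then show ?thesis
      by (auto simp: component_homogeneous[OF f] commutator_zero zero_fun_apply)
  next
    case True
    then show ?thesis
      using that by (auto simp: component_homogeneous[OF f] component_homogeneous[OF g]
          commutator_zero zero_fun_apply)
  qed
  have "bracket d f g Z = (\<Sum>N' = 1..?l. \<Sum>n'\<le>Suc ?r.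
      if N' = N then if n' = n then if ?C then commutator d N n M m f g Z else 0 else 0 else 0)"
    unfolding bracket_eq_commutators by (intro sum.cong refl summand)
  also have "\<dots> = (\<Sum>N' = 1..?l. if N' = N then \<Sum>n'\<le>Suc ?r.
      if n' = n then if ?C then commutator d N n M m f g Z else 0 else 0 else 0)"
    by (intro sum.cong refl) simp
  also have "\<dots> = (if N \<in> {1..?l} \<and> n \<le> Suc ?r \<and> ?C then commutator d N n M m f g Z else 0)"
    by (simp only: sum.delta finite_atLeastAtMost finite_atMost atMost_iff) simp
  also have "\<dots> = commutator d N n M m f g Z"
  proof (cases "commutator d N n M m f g Z = 0")
    case False
    from supp[OF this] show ?thesis
      using assms(3,4) by auto
  qed simp
  finally show "bracket d f g Z = commutator d N n M m f g Z" .
qed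

lemma mdeg_nonneg: "0 \<le> mdeg U"
  by (simp add: mdeg_def total_deg_def)

lemma circ_Phi_mono_support:
  fixes U W :: "'x monomial"
  assumes "U \<noteq> []" "W \<noteq> []"
    and nz: "circ d (Phi_mono d U) (Phi_mono d W :: ('x, 'k::field) operation) Z \<noteq> 0"
  shows "Suc (length Z) = length U + length W \<and> inputs Z + 1 = mdeg U + mdeg W"
proof -
  have power: "length X = length V \<and> inputs X = mdeg V"
    if "(rot d length ^^ s) (Phi_mono d V :: ('x, 'k) operation) X \<noteq> 0" for s X and V :: "'x monomial"
    using _ _ that
  proof (rule rot_power_support)
    show "length X = length V \<and> inputs X = mdeg V" if "Phi_mono d V X \<noteq> (0 :: ('x, 'k) tensor)" for X
      using Phi_mono_support[OF that] by simp
  qed simp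
  have "circ d (Phi_mono d U) (Phi_mono d W) =
      symmetrize d length (\<Sum>s<length U. \<Sum>t<length W. composite d (length U)
        ((rot d length ^^ s) (Phi_mono d U)) ((rot d length ^^ t) (Phi_mono d W :: ('x, 'k) operation)))"
    using assms(1,2) by (intro circ_eq_composite) (auto dest: Phi_mono_support)
  with nz have "symmetrize d length (\<Sum>s<length U. \<Sum>t<length W. composite d (length U)
        ((rot d length ^^ s) (Phi_mono d U)) ((rot d length ^^ t) (Phi_mono d W :: ('x, 'k) operation))) Z \<noteq> 0"
    by simp
  with _ _ show ?thesis
  proof (rule symmetrize_support)
    fix X
    assume "(\<Sum>s<length U. \<Sum>t<length W. composite d (length U)
        ((rot d length ^^ s) (Phi_mono d U)) ((rot d length ^^ t) (Phi_mono d W :: ('x, 'k) operation))) X \<noteq> 0"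
    then obtain s t where "composite d (length U)
        ((rot d length ^^ s) (Phi_mono d U)) ((rot d length ^^ t) (Phi_mono d W :: ('x, 'k) operation)) X \<noteq> 0"
      unfolding sum_fun_apply by (meson sum.not_neutral_contains_not_neutral)
    then show "Suc (length X) = length U + length W \<and> inputs X + 1 = mdeg U + mdeg W"
      using power by (intro composite_support) auto
  qed simp
qed

lemma bracket_Phi_mono:
  fixes U W :: "'x::finite monomial" and d :: int
  assumes "U \<noteq> []" "W \<noteq> []"
  shows "bracket d (Phi_mono d U) (Phi_mono d W) =
    Phi d (glue d U W - cscale (ksign (mono_lie_deg d U * mono_lie_deg d W)) (glue d W U)
      :: ('x, 'k::field_char_0) small)"
proof -
  let ?n = "nat (mdeg U)" and ?m = "nat (mdeg W)"
  let ?F = "Phi_mono d U :: ('x, 'k) operation" and ?G = "Phi_mono d W :: ('x, 'k) operation"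
  have hom: "homogeneous length (length V) (nat (mdeg V)) (Phi_mono d V :: ('x, 'k) operation)" for V :: "'x monomial"
    unfolding homogeneous_def using Phi_mono_support[of d V] mdeg_nonneg[of V] by auto
  have comm: "commutator d (length U) ?n (length W) ?m ?F ?G =
      circ d ?F ?G - cscale (ksign (mono_lie_deg d U * mono_lie_deg d W)) (circ d ?G ?F)"
    by (simp add: commutator_def mono_lie_deg_def mdeg_nonneg)
  have "bracket d ?F ?G = commutator d (length U) ?n (length W) ?m ?F ?G"
  proof (rule bracket_homogeneous[OF hom hom])
    fix Z
    assume "commutator d (length U) ?n (length W) ?m ?F ?G Z \<noteq> 0"
    then have "circ d ?F ?G Z \<noteq> 0 \<or> circ d ?G ?F Z \<noteq> 0"
      by (auto simp: comm cscale_def)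
    then have "Suc (length Z) = length U + length W \<and> inputs Z + 1 = mdeg U + mdeg W"
      using circ_Phi_mono_support[OF assms, of d Z] circ_Phi_mono_support[OF assms(2,1), of d Z]
      by (metis add.commute)
    then show "Suc (length Z) = length U + length W \<and> Suc (sum_list (map length Z)) = ?n + ?m"
      using mdeg_nonneg[of U] mdeg_nonneg[of W] unfolding total_deg_def by linarith
  qed (use assms in auto)
  then show ?thesis
    by (simp only: comm commutator_Phi_mono[OF assms])
qed

lemma zeta_subset: "\<phi> \<in> zeta d \<Longrightarrow> \<phi> \<in> invariants d gdeg"
  by (simp add: zeta_def zeta_prod_def)

lemma zetaI: "\<phi> \<in> invariants d gdeg \<Longrightarrow> (\<And>c. \<phi> c \<noteq> 0 \<Longrightarrow> length c \<le> N) \<Longrightarrow> \<phi> \<in> zeta d"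
  by (auto simp: zeta_def zeta_prod_def)

lemma zetaE:
  assumes "\<phi> \<in> zeta d"
  obtains N where "\<And>c. \<phi> c \<noteq> 0 \<Longrightarrow> length c \<le> N"
  using assms by (auto simp: zeta_def)

lemma zeta_zero: "0 \<in> zeta d"
  by (rule zetaI[of _ _ 0]) (simp_all add: zero_fun_apply)

lemma zeta_add:
  assumes "\<phi> \<in> zeta d" "\<psi> \<in> zeta d"
  shows "\<phi> + \<psi> \<in> zeta d"
proof -
  obtain N M where "\<And>c. \<phi> c \<noteq> 0 \<Longrightarrow> length c \<le> N" "\<And>c. \<psi> c \<noteq> 0 \<Longrightarrow> length c \<le> M"
    using assms by (meson zetaE)
  then have "length c \<le> max N M" if "(\<phi> + \<psi>) c \<noteq> 0" for c
    using that unfolding plus_fun_apply by (metis add_0 max.coboundedI1 max.coboundedI2)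
  then show ?thesis
    by (rule zetaI[OF invariants_add[OF assms[THEN zeta_subset]]])
qed

lemma zeta_cscale:
  assumes "\<phi> \<in> zeta d"
  shows "cscale a \<phi> \<in> zeta d"
proof -
  obtain N where N: "\<And>c. \<phi> c \<noteq> 0 \<Longrightarrow> length c \<le> N"
    using assms by (meson zetaE)
  then have "length c \<le> N" if "cscale a \<phi> c \<noteq> 0" for c
    using that by (metis cscale_def scale_zero(1))
  then show ?thesis
    by (rule zetaI[OF invariants_cscale[OF assms[THEN zeta_subset]]])
qed

lemma zeta_sum: "(\<And>i. i \<in> I \<Longrightarrow> f i \<in> zeta d) \<Longrightarrow> sum f I \<in> zeta d"
  by (induction I rule: infinite_finite_induct) (simp_all add: zeta_zero zeta_add)

lemma glue_in_zeta: "glue d U W \<in> zeta d"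
  unfolding glue_def Let_def
  by (intro zeta_sum zeta_cscale cyc_mono_in_zeta glue_word_nonempty)

lemma zeta_image_zero: "0 \<in> Phi d ` zeta d"
  using zeta_zero Phi_zero by (metis imageI)

lemma zeta_image_add:
  assumes "f \<in> Phi d ` zeta d" "g \<in> Phi d ` zeta d"
  shows "f + g \<in> Phi d ` zeta d"
proof -
  obtain \<phi> \<psi> where "\<phi> \<in> zeta d" "f = Phi d \<phi>" "\<psi> \<in> zeta d" "g = Phi d \<psi>"
    using assms by blast
  then show ?thesis
    using zeta_add[of \<phi> d \<psi>] by (metis Phi_add imageI)
qed

lemma zeta_image_cscale:
  assumes "f \<in> Phi d ` zeta d"
  shows "cscale a f \<in> Phi d ` zeta d"
proof -
  obtain \<phi> where "\<phi> \<in> zeta d" "f = Phi d \<phi>"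
    using assms by blast
  then show ?thesis
    using zeta_cscale[of \<phi> d a] by (metis Phi_cscale imageI)
qed

lemma zeta_image_sum: "(\<And>i. i \<in> I \<Longrightarrow> f i \<in> Phi d ` zeta d) \<Longrightarrow> sum f I \<in> Phi d ` zeta d"
  by (induction I rule: infinite_finite_induct) (simp_all add: zeta_image_zero zeta_image_add)

lemma Phi_span_induct:
  fixes \<phi> :: "('x::finite, 'k::field) small"
  assumes "well_shaped \<phi>" "homogeneous gdeg N n \<phi>" "0 < N"
    and zero: "P 0" and add: "\<And>f g. P f \<Longrightarrow> P g \<Longrightarrow> P (f + g)" and scale: "\<And>a f. P f \<Longrightarrow> P (cscale a f)"
    and mono: "\<And>U. U \<noteq> [] \<Longrightarrow> length U = N \<Longrightarrow> mdeg U = int n \<Longrightarrow> P (Phi_mono d U)"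
  shows "P (Phi d \<phi>)"
  using assms(1)
proof (rule well_shaped_induct)
  show "length c = N" if "\<phi> c \<noteq> 0" for c
    using assms(2) that by (simp add: homogeneous_def)
  show "P (Phi d 0)"
    by (simp add: zero)
  show "P (Phi d (\<psi> + \<chi>))" if "P (Phi d \<psi>)" "P (Phi d \<chi>)" for \<psi> \<chi> :: "('x, 'k) small"
    using that by (simp only: Phi_add add)
  show "P (Phi d (cscale a (mono_cochain U)))" if "length U = N" "\<phi> (map fst U) \<noteq> 0" for a U
  proof -
    have "U \<noteq> []"
      using that(1) assms(3) by auto
    moreover have "mdeg U = int n"
      using assms(2) that(2) by (simp add: homogeneous_def mdeg_def)
    ultimately have "P (Phi_mono d U)"
      using that(1) mono by simp
    then show ?thesis
      unfolding Phi_cscale Phi_mono_cochain[OF \<open>U \<noteq> []\<close>] by (rule scale)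
  qed
qed

lemma commutator_closed:
  fixes \<phi> \<psi> :: "('x::finite, 'k::field_char_0) small"
  assumes "well_shaped \<phi>" "homogeneous gdeg N n \<phi>" "0 < N"
    and "well_shaped \<psi>" "homogeneous gdeg M m \<psi>" "0 < M"
  shows "commutator d N n M m (Phi d \<phi>) (Phi d \<psi>) \<in> Phi d ` zeta d"
  using assms(1-3)
proof (rule Phi_span_induct)
  fix U :: "'x monomial"
  assume U: "U \<noteq> []" "length U = N" "mdeg U = int n"
  show "commutator d N n M m (Phi_mono d U) (Phi d \<psi>) \<in> Phi d ` zeta d"
    using assms(4-6)
  proof (rule Phi_span_induct)
    fix W :: "'x monomial"
    assume W: "W \<noteq> []" "length W = M" "mdeg W = int m"
    let ?e = "ksign (mono_lie_deg d U * mono_lie_deg d W) :: 'k"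
    have "commutator d N n M m (Phi_mono d U) (Phi_mono d W) =
        Phi d (glue d U W - cscale ?e (glue d W U) :: ('x, 'k) small)"
      unfolding commutator_Phi_mono[OF U(1) W(1), symmetric]
      by (simp add: commutator_def mono_lie_deg_def U W)
    also have "\<dots> \<in> Phi d ` zeta d"
      unfolding minus_cscale by (intro imageI zeta_add zeta_cscale glue_in_zeta)
    finally show "commutator d N n M m (Phi_mono d U) (Phi_mono d W :: ('x, 'k) operation) \<in> Phi d ` zeta d" .
  qed (simp_all only: commutator_zero commutator_add commutator_cscale
      zeta_image_zero zeta_image_add zeta_image_cscale)
qed (simp_all only: commutator_zero commutator_add commutator_cscale
    zeta_image_zero zeta_image_add zeta_image_cscale)

lemma rot_component: "rot d deg (component deg N n f) = component deg N n (rot d deg f)"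
  by (simp add: rot_def component_def fun_eq_iff)

lemma well_shaped_component: "well_shaped f \<Longrightarrow> well_shaped (component deg N n f)"
  by (rule well_shapedI) (auto simp: component_def well_shaped_Nil well_shapedD split: if_splits)

lemma component_invariant: "f \<in> invariants d deg \<Longrightarrow> component deg N n f \<in> invariants d deg"
  by (simp add: invariants_iff rot_component well_shaped_component)

lemma homogeneous_component: "homogeneous deg N n (component deg N n f)"
  by (simp add: homogeneous_def component_def)

lemma pullback_local:
  assumes "well_shaped \<phi>" "well_shaped \<psi>"
    and eq: "\<And>c. length c = length X \<Longrightarrow> total_deg gdeg c = inputs X \<Longrightarrow> \<phi> c = \<psi> c"
  shows "pullback \<phi> X = pullback \<psi> X"
proof -
  let ?\<chi> = "\<phi> + cscale (- 1) \<psi>"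
  have "pullback ?\<chi> X = 0"
  proof (rule ccontr)
    assume "pullback ?\<chi> X \<noteq> 0"
    with assms obtain c where "?\<chi> c \<noteq> 0" "length c = length X" "total_deg gdeg c = inputs X"
      by (meson pullback_nonzero well_shaped_add well_shaped_cscale)
    with eq show False
      by (simp add: plus_fun_apply cscale_def scale_minus)
  qed
  then have "pullback \<phi> X + scale (- 1) (pullback \<psi> X) = 0"
    unfolding pullback_add pullback_cscale plus_fun_apply unfolding cscale_def .
  then show ?thesis
    by (simp add: scale_minus)
qed

lemma component_Phi:
  fixes \<phi> :: "('x::finite, 'k::field_char_0) small"
  assumes "\<phi> \<in> invariants d gdeg"
  shows "component length N n (Phi d \<phi>) = Phi d (component gdeg N n \<phi>)"
proof
  fix X :: "'x word list list"
  have ws: "well_shaped \<phi>"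
    using assms by (simp only: invariants_iff)
  let ?c = "component gdeg N n \<phi>"
  have Phi_c: "Phi d ?c = pullback ?c"
    by (intro Phi_invariant component_invariant assms)
  show "component length N n (Phi d \<phi>) X = Phi d ?c X"
  proof (cases "length X = N \<and> inputs X = int n")
    case True
    have "pullback \<phi> X = pullback ?c X"
      using True by (intro pullback_local ws well_shaped_component) (simp add: component_def)
    then show ?thesis
      using True by (simp add: Phi_c Phi_invariant[OF assms] component_def)
  next
    case False
    have "pullback ?c X = 0"
    proof (rule ccontr)
      assume "pullback ?c X \<noteq> 0"
      then obtain c where "?c c \<noteq> 0" "length c = length X" "total_deg gdeg c = inputs X"
        using pullback_nonzero[OF well_shaped_component[OF ws]] by blast
      with False show False
        by (auto simp: component_def split: if_splits)
    qed
    then show ?thesis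
      using False by (auto simp: Phi_c component_def)
  qed
qed

text \<open>
  An element of the direct product lies in the image as soon as each of its homogeneous parts does:
  the value of a pullback on given inputs depends only on the part of the cochain with the same number
  of letters and the same degree (\<open>pullback_local\<close>).
\<close>

lemma patch_Phi:
  fixes h :: "('x::finite, 'k::field_char_0) operation"
  assumes "\<And>l r. \<exists>\<theta>\<in>invariants d gdeg. \<forall>Z. length Z = l \<longrightarrow> sum_list (map length Z) = r \<longrightarrow> h Z = Phi d \<theta> Z"
  shows "h \<in> Phi d ` invariants d gdeg"
proof -
  obtain \<theta> where inv: "\<And>l r. \<theta> l r \<in> invariants d gdeg"
    and h: "\<And>Z. h Z = Phi d (\<theta> (length Z) (sum_list (map length Z))) Z"
    using assms by metis
  \<comment> \<open>invariance is inherited because rotation preserves the number of letters and the degree\<close>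
  define \<Theta> where "\<Theta> c = \<theta> (length c) (sum_list (map gdeg c)) c" for c
  have ws: "well_shaped (\<theta> l r)" and rot: "rot d gdeg (\<theta> l r) = \<theta> l r" for l r
    using inv[of l r] by (simp_all only: invariants_iff)
  have "well_shaped \<Theta>"
  proof (rule well_shapedI)
    show "\<Theta> [] = 0"
      unfolding \<Theta>_def by (rule well_shaped_Nil[OF ws])
    show "length v = length c" if "v \<in> keys (\<Theta> c)" for c v
      using that unfolding \<Theta>_def by (rule well_shapedD[OF ws])
  qed
  moreover have "rot d gdeg \<Theta> c = \<Theta> c" for c
  proof -
    have "sum_list (map gdeg (rotr c)) = sum_list (map gdeg c)"
      by (cases c rule: rev_cases) (simp_all add: rotr_def)
    then have "rot d gdeg \<Theta> c = rot d gdeg (\<theta> (length c) (sum_list (map gdeg c))) c"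
      by (simp add: rot_def[of _ _ \<Theta>] rot_def[of _ _ "\<theta> _ _"] \<Theta>_def)
    then show ?thesis
      by (simp only: rot \<Theta>_def)
  qed
  ultimately have \<Theta>: "well_shaped \<Theta>" "\<Theta> \<in> invariants d gdeg"
    by (auto simp: invariants_iff)
  have "h Z = Phi d \<Theta> Z" for Z
    unfolding h Phi_invariant[OF inv] Phi_invariant[OF \<Theta>(2)]
    by (intro pullback_local ws \<Theta>(1)) (simp add: \<Theta>_def total_deg_def)
  then show ?thesis
    using \<Theta>(2) by blast
qed

lemma bracket_closed:
  fixes \<phi> \<psi> :: "('x::finite, 'k::field_char_0) small"
  assumes "\<phi> \<in> invariants d gdeg" "\<psi> \<in> invariants d gdeg"
  shows "bracket d (Phi d \<phi>) (Phi d \<psi>) \<in> Phi d ` invariants d gdeg"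
proof (rule patch_Phi)
  fix l r
  have ws: "well_shaped \<phi>" "well_shaped \<psi>"
    using assms by (simp_all only: invariants_iff)
  let ?h = "\<Sum>N = 1..l. \<Sum>n\<le>Suc r. commutator d N n (Suc l - N) (Suc r - n)
      (Phi d (component gdeg N n \<phi>)) (Phi d (component gdeg (Suc l - N) (Suc r - n) \<psi>))"
  have "?h \<in> Phi d ` zeta d"
    by (intro zeta_image_sum commutator_closed well_shaped_component ws homogeneous_component) auto
  then obtain \<theta> where \<theta>: "\<theta> \<in> zeta d" "?h = Phi d \<theta>"
    by blast
  have "bracket d (Phi d \<phi>) (Phi d \<psi>) Z = ?h Z" if "length Z = l" "sum_list (map length Z) = r" for Z
    unfolding bracket_eq_commutators that component_Phi[OF assms(1)] component_Phi[OF assms(2)]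
    by (simp only: sum_fun_apply)
  with \<theta> show "\<exists>\<theta>\<in>invariants d gdeg. \<forall>Z. length Z = l \<longrightarrow> sum_list (map length Z) = r \<longrightarrow>
      bracket d (Phi d \<phi>) (Phi d \<psi>) Z = Phi d \<theta> Z"
    using zeta_subset by metis
qed

lemma bracket_bounded:
  assumes "\<And>X. f X \<noteq> 0 \<Longrightarrow> length X \<le> K" "\<And>X. g X \<noteq> 0 \<Longrightarrow> length X \<le> L" "K + L \<le> length Z"
  shows "bracket d f g Z = 0"
proof -
  have zero: "component length N n f = 0" if "N > K" "\<And>X. f X \<noteq> 0 \<Longrightarrow> length X \<le> K"
    for N n K and f :: "('a, 'b) operation"
    using that by (fastforce simp: component_def fun_eq_iff zero_fun_apply)
  have "commutator d N n (Suc (length Z) - N) m (component length N n f)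
       (component length (Suc (length Z) - N) m g) Z = 0" if "N \<in> {1..length Z}" for N n m
  proof (cases "N > K")
    case True
    then show ?thesis
      using zero[of K N f] assms(1) by (simp add: commutator_zero zero_fun_apply)
  next
    case False
    then have "Suc (length Z) - N > L"
      using assms(3) by simp
    then show ?thesis
      using zero[of L _ g] assms(2) by (simp add: commutator_zero zero_fun_apply)
  qed
  then show ?thesis
    unfolding bracket_eq_commutators by (intro sum.neutral ballI)
qed

lemma Phi_bounded:
  fixes \<phi> :: "('x::finite, 'k::field_char_0) small"
  assumes "\<phi> \<in> invariants d gdeg" "\<And>c. \<phi> c \<noteq> 0 \<Longrightarrow> length c \<le> K" "Phi d \<phi> X \<noteq> 0"
  shows "length X \<le> K"
proof -
  have "well_shaped \<phi>"
    using assms(1) by (simp only: invariants_iff)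
  moreover have "pullback \<phi> X \<noteq> 0"
    using assms(3) unfolding Phi_invariant[OF assms(1)] .
  ultimately obtain c where "\<phi> c \<noteq> 0" "length c = length X"
    using pullback_nonzero by blast
  then show ?thesis
    using assms(2)[of c] by simp
qed

text \<open>
  The preimage of the bracket inherits its bound on the number of outputs, since a cochain is
  recovered from its pullback.
\<close>

lemma bracket_closed_zeta:
  fixes \<phi> \<psi> :: "('x::finite, 'k::field_char_0) small"
  assumes "\<phi> \<in> zeta d" "\<psi> \<in> zeta d"
  shows "bracket d (Phi d \<phi>) (Phi d \<psi>) \<in> Phi d ` zeta d"
proof -
  obtain K L where K: "\<And>c. \<phi> c \<noteq> 0 \<Longrightarrow> length c \<le> K" and L: "\<And>c. \<psi> c \<noteq> 0 \<Longrightarrow> length c \<le> L"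
    using assms by (meson zetaE)
  obtain \<Theta> where \<Theta>: "\<Theta> \<in> invariants d gdeg" "bracket d (Phi d \<phi>) (Phi d \<psi>) = Phi d \<Theta>"
    using bracket_closed[OF zeta_subset[OF assms(1)] zeta_subset[OF assms(2)]] by blast
  have ws: "well_shaped \<Theta>"
    using \<Theta>(1) by (simp only: invariants_iff)
  have bounds: "length X \<le> K" if "Phi d \<phi> X \<noteq> 0" for X
    using zeta_subset[OF assms(1)] K that by (rule Phi_bounded)
  have bounds': "length X \<le> L" if "Phi d \<psi> X \<noteq> 0" for X
    using zeta_subset[OF assms(2)] L that by (rule Phi_bounded)
  have "length c \<le> K + L" if "\<Theta> c \<noteq> 0" for c
  proof (rule ccontr)
    assume "\<not> length c \<le> K + L"
    then have "K + L \<le> length (map generator_block c)"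
      by simp
    with bounds bounds' have "bracket d (Phi d \<phi>) (Phi d \<psi>) (map generator_block c) = 0"
      by (rule bracket_bounded)
    then have "pullback \<Theta> (map generator_block c) = 0"
      unfolding \<Theta>(2) Phi_invariant[OF \<Theta>(1)] .
    with that show False
      unfolding pullback_generator_blocks[OF ws] by simp
  qed
  then have "\<Theta> \<in> zeta d"
    using \<Theta>(1) by (rule zetaI[rotated])
  then show ?thesis
    unfolding \<Theta>(2) by (rule imageI)
qed

lemma zeta_diff_zeta:
  assumes "\<phi> \<in> zeta d"
  shows "zeta_diff \<phi> \<in> zeta d"
proof -
  obtain K where K: "\<And>c. \<phi> c \<noteq> 0 \<Longrightarrow> length c \<le> K"
    using assms by (meson zetaE)
  have "zeta_term \<phi> P y Q = 0" if "K < Suc (length P + length Q)" for P y Q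
  proof -
    have "\<phi> (P @ Xi # Q) = 0"
      using K[of "P @ Xi # Q"] that by fastforce
    then show ?thesis
      by (cases y) simp_all
  qed
  then have "zeta_diff \<phi> c = 0" if "K < length c" for c
    unfolding zeta_diff_terms using that by (intro sum.neutral) auto
  then show ?thesis
    using zeta_diff_invariant[OF zeta_subset[OF assms]] by (meson not_le zetaI)
qed

lemma lie_subalgebra_image:
  fixes Z :: "('x::finite, 'k::field_char_0) small set"
  assumes "Z \<subseteq> invariants d gdeg" "0 \<in> Z"
    and add: "\<And>\<phi> \<psi>. \<phi> \<in> Z \<Longrightarrow> \<psi> \<in> Z \<Longrightarrow> \<phi> + \<psi> \<in> Z" and scale: "\<And>a \<phi>. \<phi> \<in> Z \<Longrightarrow> cscale a \<phi> \<in> Z"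
    and closed: "\<And>\<phi> \<psi>. \<phi> \<in> Z \<Longrightarrow> \<psi> \<in> Z \<Longrightarrow> bracket d (Phi d \<phi>) (Phi d \<psi>) \<in> Phi d ` Z"
  shows "lie_subalgebra d (Phi d ` Z)"
  unfolding lie_subalgebra_def hochschild_def
proof (intro conjI ballI allI)
  show "Phi d ` Z \<subseteq> invariants d length"
  proof (rule image_subsetI)
    fix \<phi>
    assume "\<phi> \<in> Z"
    then have "\<phi> \<in> invariants d gdeg"
      using assms(1) by (rule subsetD[rotated])
    then show "Phi d \<phi> \<in> invariants d length"
      by (simp only: Phi_invariant pullback_invariant)
  qed
  show "0 \<in> Phi d ` Z"
    using assms(2) Phi_zero by (metis imageI)
  fix f
  assume "f \<in> Phi d ` Z"
  then obtain \<phi> where \<phi>: "\<phi> \<in> Z" "f = Phi d \<phi>"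
    by (rule imageE)
  show "cscale a f \<in> Phi d ` Z" for a
    unfolding \<phi>(2) Phi_cscale[symmetric] by (intro imageI scale \<phi>(1))
  fix g
  assume "g \<in> Phi d ` Z"
  then obtain \<psi> where \<psi>: "\<psi> \<in> Z" "g = Phi d \<psi>"
    by (rule imageE)
  show "f + g \<in> Phi d ` Z"
    unfolding \<phi>(2) \<psi>(2) Phi_add[symmetric] by (intro imageI add \<phi>(1) \<psi>(1))
  show "bracket d f g \<in> Phi d ` Z"
    unfolding \<phi>(2) \<psi>(2) by (rule closed[OF \<phi>(1) \<psi>(1)])
qed

theorem theorem6p1:
  fixes d :: int
  shows
    "(\<forall>Z \<in> {zeta d, zeta_prod d :: ('x::finite, 'k::field_char_0) small set}.
        (\<forall>\<phi>\<in>Z. \<forall>\<psi>\<in>Z. Phi d (\<phi> + \<psi>) = Phi d \<phi> + Phi d \<psi>)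
      \<and> (\<forall>a. \<forall>\<phi>\<in>Z. Phi d (cscale a \<phi>) = cscale a (Phi d \<phi>))
      \<and> inj_on (Phi d) Z
      \<and> (\<forall>N n. \<forall>\<phi>\<in>Z. homogeneous gdeg N n \<phi> \<longrightarrow> homogeneous length N n (Phi d \<phi>))
      \<and> (\<forall>\<phi>\<in>Z. zeta_diff \<phi> \<in> Z \<and> Phi d (zeta_diff \<phi>) = hochschild_diff (Phi d \<phi>))
      \<and> lie_subalgebra d (Phi d ` Z))
     \<and>
     (\<forall>U :: 'x monomial. U \<noteq> [] \<longrightarrow>
        (cyc_mono d U :: ('x, 'k) small) \<in> zeta d
      \<and> (Phi d (cyc_mono d U) :: ('x, 'k) operation) = Phi_mono d U)
     \<and>
     (\<forall>U W :: 'x monomial. U \<noteq> [] \<longrightarrow> W \<noteq> [] \<longrightarrow>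
        bracket d (Phi_mono d U) (Phi_mono d W) =
          (Phi d (glue d U W - cscale (ksign (mono_lie_deg d U * mono_lie_deg d W)) (glue d W U))
             :: ('x, 'k) operation))"
    (is "(\<forall>Z \<in> _. ?embedding Z) \<and> ?monomials \<and> ?bracket")
proof (intro conjI)
  have embedding: "?embedding Z"
    if Z: "Z \<subseteq> invariants d gdeg" and "\<And>\<phi>. \<phi> \<in> Z \<Longrightarrow> zeta_diff \<phi> \<in> Z" "lie_subalgebra d (Phi d ` Z)"
    for Z :: "('x, 'k) small set"
    using that(2,3) subsetD[OF Z] inj_on_subset[OF Phi_inj_on Z]
    by (simp add: Phi_add Phi_cscale Phi_homogeneous Phi_zeta_diff)
  have zeta_sub: "zeta d \<subseteq> (invariants d gdeg :: ('x, 'k) small set)"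
    using zeta_subset by blast
  have "lie_subalgebra d (Phi d ` (zeta d :: ('x, 'k) small set))"
    by (rule lie_subalgebra_image[OF zeta_sub zeta_zero zeta_add zeta_cscale bracket_closed_zeta])
  with zeta_sub zeta_diff_zeta have embedding_zeta: "?embedding (zeta d)"
    by (rule embedding)
  have "lie_subalgebra d (Phi d ` (invariants d gdeg :: ('x, 'k) small set))"
    by (rule lie_subalgebra_image[OF subset_refl invariants_zero invariants_add invariants_cscale bracket_closed])
  with subset_refl zeta_diff_invariant have embedding_prod: "?embedding (zeta_prod d)"
    unfolding zeta_prod_def by (rule embedding)
  show "\<forall>Z \<in> {zeta d, zeta_prod d}. ?embedding Z"
    using embedding_zeta embedding_prod by (intro ballI, elim insertE emptyE) (simp_all only:)
  show ?monomials
    by (simp add: cyc_mono_in_zeta Phi_cyc_mono)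
  show ?bracket
    by (intro allI impI bracket_Phi_mono)
qed

end
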